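(* Under the standing assumptions below, for every $\gamma\in\mathbb R^I_+$, $x_0\in\mathcal X$, $s_0\in\mathcal S$, the maximum value of the ex-post lottery problem for $(\gamma,x_0,s_0)$ equals $\tilde D(\gamma,x_0,s_0)$. Moreover, $\tilde D$ is the largest solution in $\mathcal N$ of the functional equation $F(\gamma,x,s)=\sup_{a\in\tilde{\mathcal A}(x,s)}\inf_{\lambda\in\mathbb R^I_+}\big[r(x,a,s)+\sum_i(\gamma^ig^i(x,a,s)+\lambda^i(g^i(x,a,s)-\bar g^i))+\beta\mathbb E_sF(\gamma+\lambda,\zeta(x,a,s),s')\big]$.
   Context: Setup. Let $\mathcal S$ be a finite set and $(s_t)_{t\ge0}$ a Markov chain on $\mathcal S$ with transition probabilities $\pi(s'|s)>0$ for all $s,s'$; for $s^t=(s_0,\dots,s_t)$ write $\pi^t(s^t|s_0)$ for its probability and $\mathbb E_{s^t}$ (or $\mathbb E_{s_t}$) for expectation over future shocks given $s^t$; $\mathbb E_s$ denotes expectation over $s'\sim\pi(\cdot|s)$. Let $\mathcal A\subset\mathbb R^n$ be finite, $\mathcal X\subseteq\mathbb R^m$ countable, $\zeta:\mathcal X\times\mathcal A\times\mathcal S\to\mathcal X$, $p:\mathcal X\times\mathcal A\times\mathcal S\to\mathbb R$, $r,g^1,\dots,g^I$ bounded real functions on $\mathcal X\times\mathcal A\times\mathcal S$, $\bar g^i\in\mathbb R$, $\beta\in(0,1)$. A plan is $a=(a(s^t))_{t,s^t}$, $a(s^t)\in\mathcal A$, inducing $x(s^0)=x_0$, $x(s^{t+1})=\zeta(x(s^t),a(s^t),s_t)$.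 $\tilde{\mathcal A}(x,s)=\{a:p(x,a,s)\ge0\}$; $\tilde{\mathcal A}^\infty(x_0)$ is the set of plans with $a(s^t)\in\tilde{\mathcal A}(x(s^t),s_t)$ for all $t,s^t$. A plan is feasible for $(x_0,s_0)$ if it lies in $\tilde{\mathcal A}^\infty(x_0)$ and $\mathbb E_{s_t}\sum_{n\ge0}\beta^ng^i(x(s^{t+n}),a(s^{t+n}),s_{t+n})\ge\bar g^i$ for all $t,s^t,i$. Standing assumption: for every $(x_0,s_0)$ a feasible plan exists. $\tilde D$: post-action histories $\tilde h^t=(s_0,a_0,\dots,s_t,a_t)\in\tilde{\mathcal H}^t=\mathcal S^{t+1}\times\mathcal A^{t+1}$; a plan generates $\tilde h^t=(s_0,a(s^0),\dots,s_t,a(s^t))$. $\tilde\Lambda$: families $\lambda^i(\tilde h^t)\ge0$ with $\sum_t\sum_{\tilde h^t}\sum_i\beta^t\lambda^i(\tilde h^t)\pi^t(s^t|s_0)<\infty$. $\tilde L(a,\lambda;\gamma,x_0,s_0)=\mathbb E_{s_0}\sum_t\beta^t\big[r(x(s^t),a(s^t),s_t)+\sum_i\gamma^ig^i(x(s^t),a(s^t),s_t)+\sum_i\lambda^i(\tilde h^t)(\sum_{n\ge0}\beta^ng^i(x(s^{t+n}),a(s^{t+n}),s_{t+n})-\bar g^i)\big]$ and $\tilde D(\gamma,x_0,s_0)=\inf_{\lambda\in\tilde\Lambda}\sup_{a\in\tilde{\mathcal A}^\infty(x_0)}\tilde L$. Ex-post lottery problem. Give $\tilde{\mathcal A}^\infty(x_0)$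 the product topology, let $\mathcal P(\tilde{\mathcal A}^\infty(x_0))$ be its Borel probability measures, random plans $a\sim P$ independent of shocks. Maximize $\mathbb E^{a\sim P}_{s_0}\sum_t\beta^t\big(r(x(s^t),a(s^t),s_t)+\sum_i\gamma^ig^i(x(s^t),a(s^t),s_t)\big)$ over $P$ subject to: for all $t$, all $\tilde h^t=(s_0,\tilde a_0,\dots,s_t,\tilde a_t)\in\tilde{\mathcal H}^t$ and all $i$, $\mathbb E^{a\sim P}_{s^t}\big[\mathbf 1\{(a(s^0),\dots,a(s^t))=(\tilde a_0,\dots,\tilde a_t)\}(\sum_{n\ge0}\beta^ng^i(x(s^{t+n}),a(s^{t+n}),s_{t+n})-\bar g^i)\big]\ge0$, with $s^t$ the shock history in $\tilde h^t$. Function spaces. $L=(\|r\|_\infty+\sum_i\|g^i\|_\infty)/(1-\beta)$, $B(k)=\{\gamma\in\mathbb R^I_+:\|\gamma\|_\infty\le k\}$, $\mathcal S=\{s_1,\dots,s_{|\mathcal S|}\}$, $\mathcal X=\{x_1,x_2,\dots\}$. $\mathcal M$: functions $F:\mathbb R^I_+\times\mathcal X\times\mathcal S\to\mathbb R$ with $F(\cdot,x,s)\in L^\infty(B(k))$ for all $k$ and $\|F\|_{\mathcal M}=\sum_i2^{-i}\sum_j2^{-j}\sum_{k\ge1}2^{-k}\|F(\cdot,x_j,s_i)\|_{L^\infty(B(k))}<\infty$. $\mathcal N$: those $F\in\mathcal M$ with, for all $x,s$, (i) $F(\cdot,x,s)$ convex; (ii) $|F(\gamma_1,x,s)-F(\gamma_2,x,s)|\le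 L\|\gamma_1-\gamma_2\|_1$; (iii) $F(\gamma,x,s)\ge v^0+\sum_i\gamma^iv^i$ for every feasible plan for $(x,s)$, $v^0=\mathbb E_s\sum_t\beta^tr(\cdot)$, $v^i=\mathbb E_s\sum_t\beta^tg^i(\cdot)$; (iv) $F(\gamma,x,s)\le(1+\sum_i\gamma^i)L$. *)

theory Defs
  imports "HOL-Probability.Probability"
begin

text \<open>Shock histories s^t = (s_0,...,s_t) are nonempty lists.  pi s s' is the
transition probability pi(s'|s).\<close>

definition pathprob :: "('s \<Rightarrow> 's \<Rightarrow> real) \<Rightarrow> 's list \<Rightarrow> real" where
  "pathprob \<pi> h = (\<Prod>k<length h - 1. \<pi> (h ! k) (h ! Suc k))"

definition condE :: "('s::finite \<Rightarrow> 's \<Rightarrow> real) \<Rightarrow> 's list \<Rightarrow> nat \<Rightarrow> ('s list \<Rightarrow> real) \<Rightarrow> real" where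
  "condE \<pi> h n f = (\<Sum>e\<in>{e::'s list. length e = n}. (pathprob \<pi> (h @ e) / pathprob \<pi> h) * f (h @ e))"

primrec xit :: "('x \<Rightarrow> 'a \<Rightarrow> 's \<Rightarrow> 'x) \<Rightarrow> 'x \<Rightarrow> ('s list \<Rightarrow> 'a) \<Rightarrow> 's list \<Rightarrow> nat \<Rightarrow> 'x" where
  "xit \<zeta> x0 a h 0 = x0"
| "xit \<zeta> x0 a h (Suc n) = \<zeta> (xit \<zeta> x0 a h n) (a (take (Suc n) h)) (h ! n)"

definition xpath :: "('x \<Rightarrow> 'a \<Rightarrow> 's \<Rightarrow> 'x) \<Rightarrow> 'x \<Rightarrow> ('s list \<Rightarrow> 'a) \<Rightarrow> 's list \<Rightarrow> 'x" where
  "xpath \<zeta> x0 a h = xit \<zeta> x0 a h (length h - 1)"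

definition flow :: "('x \<Rightarrow> 'a \<Rightarrow> 's \<Rightarrow> real) \<Rightarrow> ('x \<Rightarrow> 'a \<Rightarrow> 's \<Rightarrow> 'x) \<Rightarrow> 'x \<Rightarrow> ('s list \<Rightarrow> 'a) \<Rightarrow> 's list \<Rightarrow> real" where
  "flow f \<zeta> x0 a h = f (xpath \<zeta> x0 a h) (a h) (last h)"

text \<open>E_{s^t} sum_{n>=0} beta^n f(x(s^{t+n}),a(s^{t+n}),s_{t+n}) (expectation of the
bounded discounted sum, written as the series of expectations).\<close>
definition cont :: "real \<Rightarrow> ('s::finite \<Rightarrow> 's \<Rightarrow> real) \<Rightarrow> ('x \<Rightarrow> 'a \<Rightarrow> 's \<Rightarrow> 'x) \<Rightarrow> 'x
     \<Rightarrow> ('s list \<Rightarrow> 'a) \<Rightarrow> ('x \<Rightarrow> 'a \<Rightarrow> 's \<Rightarrow> real) \<Rightarrow> 's list \<Rightarrow> real" where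
  "cont \<beta> \<pi> \<zeta> x0 a f h = (\<Sum>n. \<beta> ^ n * condE \<pi> h n (flow f \<zeta> x0 a))"

definition Atil :: "'a set \<Rightarrow> ('x \<Rightarrow> 'a \<Rightarrow> 's \<Rightarrow> real) \<Rightarrow> 'x \<Rightarrow> 's \<Rightarrow> 'a set" where
  "Atil A p x s = {a \<in> A. p x a s \<ge> 0}"

definition Hist :: "'s list set" where
  "Hist = {h. h \<noteq> []}"

definition Ainf :: "'a set \<Rightarrow> ('x \<Rightarrow> 'a \<Rightarrow> 's \<Rightarrow> real) \<Rightarrow> ('x \<Rightarrow> 'a \<Rightarrow> 's \<Rightarrow> 'x) \<Rightarrow> 'x
     \<Rightarrow> ('s list \<Rightarrow> 'a) set" where
  "Ainf A p \<zeta> x0 = {a \<in> PiE Hist (\<lambda>_. A).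
      \<forall>h\<in>Hist. a h \<in> Atil A p (xpath \<zeta> x0 a h) (last h)}"

definition feasible :: "'a set \<Rightarrow> ('x \<Rightarrow> 'a \<Rightarrow> 's \<Rightarrow> real) \<Rightarrow> ('x \<Rightarrow> 'a \<Rightarrow> 's \<Rightarrow> 'x)
     \<Rightarrow> ('s::finite \<Rightarrow> 's \<Rightarrow> real) \<Rightarrow> real \<Rightarrow> ('i \<Rightarrow> 'x \<Rightarrow> 'a \<Rightarrow> 's \<Rightarrow> real) \<Rightarrow> ('i \<Rightarrow> real)
     \<Rightarrow> 'x \<Rightarrow> 's \<Rightarrow> ('s list \<Rightarrow> 'a) \<Rightarrow> bool" where
  "feasible A p \<zeta> \<pi> \<beta> g gbar x0 s0 a \<longleftrightarrow>
     a \<in> Ainf A p \<zeta> x0 \<and>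
     (\<forall>h\<in>Hist. \<forall>i. hd h = s0 \<longrightarrow> cont \<beta> \<pi> \<zeta> x0 a (g i) h \<ge> gbar i)"

definition htil :: "('s list \<Rightarrow> 'a) \<Rightarrow> 's list \<Rightarrow> ('s \<times> 'a) list" where
  "htil a h = map (\<lambda>k. (h ! k, a (take (Suc k) h))) [0..<length h]"

definition Htil :: "'a set \<Rightarrow> nat \<Rightarrow> ('s \<times> 'a) list set" where
  "Htil A t = {ht. length ht = Suc t \<and> set (map snd ht) \<subseteq> A}"

definition Lam :: "real \<Rightarrow> ('s::finite \<Rightarrow> 's \<Rightarrow> real) \<Rightarrow> 'a set
     \<Rightarrow> (('s \<times> 'a) list \<Rightarrow> real ^ 'i::finite) set" where
  "Lam \<beta> \<pi> A = {lam. (\<forall>t. \<forall>ht\<in>Htil A t. \<forall>i. 0 \<le> lam ht $ i) \<and>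
      summable (\<lambda>t. \<beta> ^ t * (\<Sum>ht\<in>Htil A t. \<Sum>i\<in>UNIV. lam ht $ i * pathprob \<pi> (map fst ht)))}"

definition Ltil :: "real \<Rightarrow> ('s::finite \<Rightarrow> 's \<Rightarrow> real) \<Rightarrow> ('x \<Rightarrow> 'a \<Rightarrow> 's \<Rightarrow> 'x)
     \<Rightarrow> ('x \<Rightarrow> 'a \<Rightarrow> 's \<Rightarrow> real) \<Rightarrow> ('i::finite \<Rightarrow> 'x \<Rightarrow> 'a \<Rightarrow> 's \<Rightarrow> real) \<Rightarrow> ('i \<Rightarrow> real)
     \<Rightarrow> ('s list \<Rightarrow> 'a) \<Rightarrow> (('s \<times> 'a) list \<Rightarrow> real ^ 'i) \<Rightarrow> real ^ 'i \<Rightarrow> 'x \<Rightarrow> 's \<Rightarrow> real" where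
  "Ltil \<beta> \<pi> \<zeta> r g gbar a lam \<gamma> x0 s0 =
     (\<Sum>t. \<beta> ^ t * condE \<pi> [s0] t (\<lambda>h.
        flow r \<zeta> x0 a h + (\<Sum>i\<in>UNIV. \<gamma> $ i * flow (g i) \<zeta> x0 a h)
        + (\<Sum>i\<in>UNIV. lam (htil a h) $ i * (cont \<beta> \<pi> \<zeta> x0 a (g i) h - gbar i))))"

definition Dtil :: "'a set \<Rightarrow> ('x \<Rightarrow> 'a \<Rightarrow> 's \<Rightarrow> real) \<Rightarrow> real \<Rightarrow> ('s::finite \<Rightarrow> 's \<Rightarrow> real)
     \<Rightarrow> ('x \<Rightarrow> 'a \<Rightarrow> 's \<Rightarrow> 'x) \<Rightarrow> ('x \<Rightarrow> 'a \<Rightarrow> 's \<Rightarrow> real) \<Rightarrow> ('i::finite \<Rightarrow> 'x \<Rightarrow> 'a \<Rightarrow> 's \<Rightarrow> real)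
     \<Rightarrow> ('i \<Rightarrow> real) \<Rightarrow> real ^ 'i \<Rightarrow> 'x \<Rightarrow> 's \<Rightarrow> ereal" where
  "Dtil A p \<beta> \<pi> \<zeta> r g gbar \<gamma> x0 s0 =
     (INF lam\<in>Lam \<beta> \<pi> A. SUP a\<in>Ainf A p \<zeta> x0. ereal (Ltil \<beta> \<pi> \<zeta> r g gbar a lam \<gamma> x0 s0))"

text \<open>Plan space with the product topology of the discrete finite set A over the
countably many histories; its Borel sigma-algebra is the product sigma-algebra.\<close>
definition PlanM :: "'a set \<Rightarrow> ('s list \<Rightarrow> 'a) measure" where
  "PlanM A = PiM Hist (\<lambda>_. count_space A)"

definition LotObj :: "real \<Rightarrow> ('s::finite \<Rightarrow> 's \<Rightarrow> real) \<Rightarrow> ('x \<Rightarrow> 'a \<Rightarrow> 's \<Rightarrow> 'x)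
     \<Rightarrow> ('x \<Rightarrow> 'a \<Rightarrow> 's \<Rightarrow> real) \<Rightarrow> ('i::finite \<Rightarrow> 'x \<Rightarrow> 'a \<Rightarrow> 's \<Rightarrow> real)
     \<Rightarrow> real ^ 'i \<Rightarrow> 'x \<Rightarrow> 's \<Rightarrow> ('s list \<Rightarrow> 'a) measure \<Rightarrow> real" where
  "LotObj \<beta> \<pi> \<zeta> r g \<gamma> x0 s0 P =
     (\<integral>a. cont \<beta> \<pi> \<zeta> x0 a (\<lambda>x b s. r x b s + (\<Sum>i\<in>UNIV. \<gamma> $ i * g i x b s)) [s0] \<partial>P)"

definition LotFeas :: "'a set \<Rightarrow> ('x \<Rightarrow> 'a \<Rightarrow> 's \<Rightarrow> real) \<Rightarrow> real \<Rightarrow> ('s::finite \<Rightarrow> 's \<Rightarrow> real)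
     \<Rightarrow> ('x \<Rightarrow> 'a \<Rightarrow> 's \<Rightarrow> 'x) \<Rightarrow> ('i \<Rightarrow> 'x \<Rightarrow> 'a \<Rightarrow> 's \<Rightarrow> real) \<Rightarrow> ('i \<Rightarrow> real)
     \<Rightarrow> 'x \<Rightarrow> ('s list \<Rightarrow> 'a) measure \<Rightarrow> bool" where
  "LotFeas A p \<beta> \<pi> \<zeta> g gbar x0 P \<longleftrightarrow>
     prob_space P \<and> sets P = sets (restrict_space (PlanM A) (Ainf A p \<zeta> x0)) \<and>
     (\<forall>t. \<forall>ht\<in>Htil A t. \<forall>i.
        0 \<le> (\<integral>a. (if map (\<lambda>k. a (take (Suc k) (map fst ht))) [0..<Suc t] = map snd ht
                    then cont \<beta> \<pi> \<zeta> x0 a (g i) (map fst ht) - gbar i else 0) \<partial>P))"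

definition Bk :: "real \<Rightarrow> (real ^ 'i::finite) set" where
  "Bk k = {\<gamma>. \<forall>i. 0 \<le> \<gamma> $ i \<and> \<gamma> $ i \<le> k}"

definition nonneg :: "(real ^ 'i::finite) set" where
  "nonneg = {\<gamma>. \<forall>i. 0 \<le> \<gamma> $ i}"

text \<open>L-infinity norm on B(k) (esssup is top for non-measurable functions).\<close>
definition Linf :: "real \<Rightarrow> (real ^ 'i::finite \<Rightarrow> real) \<Rightarrow> ereal" where
  "Linf k f = esssup (lebesgue_on (Bk k)) (\<lambda>\<gamma>. ereal \<bar>f \<gamma>\<bar>)"

text \<open>X = {x_1, x_2, ...} enumerated by from_nat_into (index j+1 for j = 0,1,...).\<close>
definition inM :: "'x set \<Rightarrow> (real ^ 'i::finite \<Rightarrow> 'x \<Rightarrow> 's::finite \<Rightarrow> real) \<Rightarrow> bool" where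
  "inM X F \<longleftrightarrow>
     (\<forall>x\<in>X. \<forall>s. \<forall>k::nat. k \<ge> 1 \<longrightarrow> Linf (real k) (\<lambda>\<gamma>. F \<gamma> x s) < \<infinity>) \<and>
     (\<Sum>s\<in>(UNIV::'s set). \<Sum>j. \<Sum>k. ennreal ((1/2) ^ Suc j * (1/2) ^ Suc k)
         * e2ennreal (Linf (real (Suc k)) (\<lambda>\<gamma>. F \<gamma> (from_nat_into X j) s))) < \<top>"

definition supnorm :: "'x set \<Rightarrow> 'a set \<Rightarrow> ('x \<Rightarrow> 'a \<Rightarrow> 's \<Rightarrow> real) \<Rightarrow> real" where
  "supnorm X A f = (SUP (x, a, s)\<in>X \<times> A \<times> UNIV. \<bar>f x a s\<bar>)"

definition Lconst :: "'x set \<Rightarrow> 'a set \<Rightarrow> real \<Rightarrow> ('x \<Rightarrow> 'a \<Rightarrow> 's \<Rightarrow> real)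
     \<Rightarrow> ('i::finite \<Rightarrow> 'x \<Rightarrow> 'a \<Rightarrow> 's \<Rightarrow> real) \<Rightarrow> real" where
  "Lconst X A \<beta> r g = (supnorm X A r + (\<Sum>i\<in>UNIV. supnorm X A (g i))) / (1 - \<beta>)"

definition inN :: "'x set \<Rightarrow> 'a set \<Rightarrow> ('x \<Rightarrow> 'a \<Rightarrow> 's \<Rightarrow> real) \<Rightarrow> real \<Rightarrow> ('s::finite \<Rightarrow> 's \<Rightarrow> real)
     \<Rightarrow> ('x \<Rightarrow> 'a \<Rightarrow> 's \<Rightarrow> 'x) \<Rightarrow> ('x \<Rightarrow> 'a \<Rightarrow> 's \<Rightarrow> real) \<Rightarrow> ('i::finite \<Rightarrow> 'x \<Rightarrow> 'a \<Rightarrow> 's \<Rightarrow> real)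
     \<Rightarrow> ('i \<Rightarrow> real) \<Rightarrow> (real ^ 'i \<Rightarrow> 'x \<Rightarrow> 's \<Rightarrow> real) \<Rightarrow> bool" where
  "inN X A p \<beta> \<pi> \<zeta> r g gbar F \<longleftrightarrow> inM X F \<and>
     (\<forall>x\<in>X. \<forall>s.
        convex_on nonneg (\<lambda>\<gamma>. F \<gamma> x s) \<and>
        (\<forall>\<gamma>1\<in>nonneg. \<forall>\<gamma>2\<in>nonneg. \<bar>F \<gamma>1 x s - F \<gamma>2 x s\<bar>
             \<le> Lconst X A \<beta> r g * (\<Sum>i\<in>UNIV. \<bar>\<gamma>1 $ i - \<gamma>2 $ i\<bar>)) \<and>
        (\<forall>a. feasible A p \<zeta> \<pi> \<beta> g gbar x s a \<longrightarrow>
           (\<forall>\<gamma>\<in>nonneg. F \<gamma> x s \<ge> cont \<beta> \<pi> \<zeta> x a r [s]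
                + (\<Sum>i\<in>UNIV. \<gamma> $ i * cont \<beta> \<pi> \<zeta> x a (g i) [s]))) \<and>
        (\<forall>\<gamma>\<in>nonneg. F \<gamma> x s \<le> (1 + (\<Sum>i\<in>UNIV. \<gamma> $ i)) * Lconst X A \<beta> r g))"

definition Bellman :: "'x set \<Rightarrow> 'a set \<Rightarrow> ('x \<Rightarrow> 'a \<Rightarrow> 's \<Rightarrow> real) \<Rightarrow> real \<Rightarrow> ('s::finite \<Rightarrow> 's \<Rightarrow> real)
     \<Rightarrow> ('x \<Rightarrow> 'a \<Rightarrow> 's \<Rightarrow> 'x) \<Rightarrow> ('x \<Rightarrow> 'a \<Rightarrow> 's \<Rightarrow> real) \<Rightarrow> ('i::finite \<Rightarrow> 'x \<Rightarrow> 'a \<Rightarrow> 's \<Rightarrow> real)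
     \<Rightarrow> ('i \<Rightarrow> real) \<Rightarrow> (real ^ 'i \<Rightarrow> 'x \<Rightarrow> 's \<Rightarrow> real) \<Rightarrow> bool" where
  "Bellman X A p \<beta> \<pi> \<zeta> r g gbar F \<longleftrightarrow>
     (\<forall>\<gamma>\<in>nonneg. \<forall>x\<in>X. \<forall>s.
        ereal (F \<gamma> x s) =
          (SUP a\<in>Atil A p x s. INF lam\<in>nonneg.
             ereal (r x a s + (\<Sum>i\<in>UNIV. \<gamma> $ i * g i x a s + lam $ i * (g i x a s - gbar i))
                    + \<beta> * (\<Sum>s'\<in>UNIV. \<pi> s s' * F (\<gamma> + lam) (\<zeta> x a s) s'))))"

end

theory Submission
  imports Defs
begin

text \<open>
  Against a fixed multiplier, the best plan solves a dynamic programme in which the multiplier chosen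
  after the current action is added to the weight \<open>\<gamma>\<close> of the continuation problem. Multipliers may depend
  on the current action and can be chosen separately after every successor shock, so taking the infimum
  over multipliers moves it behind the choice of the action: this is the functional equation. Any other
  solution \<open>G\<close> is dominated, because acting greedily for \<open>G\<close> against a fixed multiplier yields a Lagrangian of
  at least \<open>G\<close> up to a discounted remainder that vanishes as multipliers are summable.

  In the lottery problem only the probabilities \<open>m k\<close> with which the lottery plays along the post-action
  history \<open>k\<close> matter. These families form a compact convex set on which objective and constraints are affine
  and continuous; by compactness finitely many constraints decide solvability, and finitely many
  constraints admit Lagrange multipliers. Every such family is induced by a lottery, which draws the
  actions at all nodes of the history tree independently (Kuhn's theorem). The infimum over multipliers need
  not be attained.
\<close>

section \<open>Series, infima and integrals\<close>

lemma discounted_abs_le: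
  fixes c :: "nat \<Rightarrow> real"
  assumes "0 \<le> \<beta>" "\<beta> < 1" "\<And>n. \<bar>c n\<bar> \<le> B"
  shows "summable (\<lambda>n. \<beta> ^ n * c n)" and "\<bar>\<Sum>n. \<beta> ^ n * c n\<bar> \<le> B / (1 - \<beta>)"
proof -
  have geometric: "(\<lambda>n. \<beta> ^ n * B) sums (B / (1 - \<beta>))"
    using sums_mult2[OF geometric_sums[of \<beta>], of B] assms by simp
  have dominated: "norm (\<beta> ^ n * c n) \<le> \<beta> ^ n * B" for n
    using assms by (simp add: abs_mult mult_left_mono)
  show "summable (\<lambda>n. \<beta> ^ n * c n)"
    by (rule summable_comparison_test'[OF sums_summable[OF geometric] dominated])
  show "\<bar>\<Sum>n. \<beta> ^ n * c n\<bar> \<le> B / (1 - \<beta>)"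
    using norm_suminf_le[OF dominated sums_summable[OF geometric]] sums_unique[OF geometric] by simp
qed

lemma sums_discounted_Suc:
  fixes c :: "nat \<Rightarrow> real"
  assumes c_Suc: "\<And>n. c (Suc n) = (\<Sum>j\<in>J. w j * c' j n)"
    and c'_sums: "\<And>j. j \<in> J \<Longrightarrow> (\<lambda>n. \<beta> ^ n * c' j n) sums C j"
  shows "(\<lambda>n. \<beta> ^ n * c n) sums (c 0 + \<beta> * (\<Sum>j\<in>J. w j * C j))"
proof -
  have "(\<lambda>n. \<beta> * (\<Sum>j\<in>J. w j * (\<beta> ^ n * c' j n))) sums (\<beta> * (\<Sum>j\<in>J. w j * C j))"
    by (intro sums_mult sums_sum c'_sums)
  moreover have "\<beta> * (\<Sum>j\<in>J. w j * (\<beta> ^ n * c' j n)) = \<beta> ^ Suc n * c (Suc n)" for n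
    by (simp add: c_Suc sum_distrib_left ac_simps)
  ultimately show ?thesis
    using sums_Suc[of "\<lambda>n. \<beta> ^ n * c n" "\<beta> * (\<Sum>j\<in>J. w j * C j)"] by (simp add: add.commute)
qed

lemma summable_sum_iff_nonneg:
  fixes f :: "'b \<Rightarrow> nat \<Rightarrow> real"
  assumes "finite S" "\<And>s n. s \<in> S \<Longrightarrow> 0 \<le> f s n"
  shows "summable (\<lambda>n. \<Sum>s\<in>S. f s n) \<longleftrightarrow> (\<forall>s\<in>S. summable (f s))"
proof
  assume sum_summable: "summable (\<lambda>n. \<Sum>s\<in>S. f s n)"
  show "\<forall>s\<in>S. summable (f s)"
  proof
    fix s assume s_in_S: "s \<in> S"
    have "norm (f s n) \<le> (\<Sum>s\<in>S. f s n)" for n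
      using member_le_sum[OF s_in_S, of "\<lambda>s. f s n"] assms s_in_S by simp
    then show "summable (f s)"
      by (intro summable_comparison_test'[OF sum_summable])
  qed
qed (simp add: summable_sum)

lemma summable_half_power_linear: "summable (\<lambda>k. (1 / 2) ^ Suc k * (a + b * real (Suc k)))"
proof -
  have "summable (\<lambda>k. (1 / 2) ^ k :: real)" "summable (\<lambda>k. real (Suc k) * (1 / 2) ^ k)"
    using geometric_deriv_sums[of "1 / 2 :: real"] by (simp_all add: sums_iff summable_geometric)
  then have "summable (\<lambda>k. a / 2 * (1 / 2) ^ k + b / 2 * (real (Suc k) * (1 / 2) ^ k))"
    by (intro summable_add summable_mult)
  moreover have "a / 2 * (1 / 2) ^ k + b / 2 * (real (Suc k) * (1 / 2) ^ k)
      = (1 / 2) ^ Suc k * (a + b * real (Suc k))" for k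
    by (simp add: algebra_simps)
  ultimately show ?thesis
    by (simp only:)
qed

lemma suminf_suminf_ennreal_less_top:
  fixes f :: "nat \<Rightarrow> nat \<Rightarrow> ennreal"
  assumes f_le: "\<And>j k. f j k \<le> ennreal (u j) * ennreal (v k)"
    and u_summable: "summable u" "\<And>j. 0 \<le> u j" and v_summable: "summable v" "\<And>k. 0 \<le> v k"
  shows "(\<Sum>j. \<Sum>k. f j k) < \<top>"
proof -
  have "(\<Sum>j. \<Sum>k. f j k) \<le> (\<Sum>j. \<Sum>k. ennreal (u j) * ennreal (v k))"
    by (intro suminf_le summableI f_le)
  also have "\<dots> = (\<Sum>j. ennreal (u j)) * (\<Sum>k. ennreal (v k))"
    by simp
  also have "\<dots> < \<top>"
    using ennreal_suminf_neq_top[OF u_summable] ennreal_suminf_neq_top[OF v_summable]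
    by (simp add: ennreal_mult_less_top less_top)
  finally show ?thesis .
qed

lemma convex_on_cINF:
  fixes F :: "'b \<Rightarrow> 'a::real_vector \<Rightarrow> real"
  assumes C_convex: "convex C" and I_nonempty: "I \<noteq> {}"
    and bounded_below: "\<And>x. x \<in> C \<Longrightarrow> bdd_below ((\<lambda>i. F i x) ` I)"
    and jointly_convex: "\<And>i j x y u. i \<in> I \<Longrightarrow> j \<in> I \<Longrightarrow> x \<in> C \<Longrightarrow> y \<in> C \<Longrightarrow> 0 < u \<Longrightarrow> u < 1 \<Longrightarrow>
      \<exists>k\<in>I. F k ((1 - u) *\<^sub>R x + u *\<^sub>R y) \<le> (1 - u) * F i x + u * F j y"
  shows "convex_on C (\<lambda>x. INF i\<in>I. F i x)"
proof (rule convex_onI[OF _ C_convex])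
  fix u :: real and x y assume u_bounds: "0 < u" "u < 1" and xy_in_C: "x \<in> C" "y \<in> C"
  let ?z = "(1 - u) *\<^sub>R x + u *\<^sub>R y"
  have z_in_C: "?z \<in> C"
    using C_convex u_bounds xy_in_C by (simp add: convex_alt)
  show "(INF i\<in>I. F i ?z) \<le> (1 - u) * (INF i\<in>I. F i x) + u * (INF i\<in>I. F i y)"
  proof (rule field_le_epsilon)
    fix e :: real assume "0 < e"
    then obtain i j where i_nearly_minimal: "i \<in> I" "F i x < (INF i\<in>I. F i x) + e"
      and j_nearly_minimal: "j \<in> I" "F j y < (INF i\<in>I. F i y) + e"
      using cINF_less_iff[OF I_nonempty bounded_below[OF xy_in_C(1)]]
        cINF_less_iff[OF I_nonempty bounded_below[OF xy_in_C(2)]]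
      by (metis less_add_same_cancel1)
    obtain k where k_le: "k \<in> I" "F k ?z \<le> (1 - u) * F i x + u * F j y"
      using jointly_convex[OF i_nearly_minimal(1) j_nearly_minimal(1) xy_in_C u_bounds] by blast
    have "(INF i\<in>I. F i ?z) \<le> (1 - u) * F i x + u * F j y"
      using cINF_lower2[OF bounded_below[OF z_in_C] k_le] .
    also have "\<dots> \<le> (1 - u) * ((INF i\<in>I. F i x) + e) + u * ((INF i\<in>I. F i y) + e)"
      using u_bounds i_nearly_minimal(2) j_nearly_minimal(2) by (intro add_mono mult_left_mono) auto
    also have "\<dots> = (1 - u) * (INF i\<in>I. F i x) + u * (INF i\<in>I. F i y) + e"
      by (simp add: algebra_simps)
    finally show "(INF i\<in>I. F i ?z) \<le> (1 - u) * (INF i\<in>I. F i x) + u * (INF i\<in>I. F i y) + e" .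
  qed
qed

lemma continuous_on_apply: "continuous_on S (\<lambda>m :: 'k \<Rightarrow> real. m k)"
  by (rule continuous_on_subset[OF continuous_on_product_coordinates]) simp

lemma (in finite_measure) integral_suminf_bounded:
  fixes f :: "nat \<Rightarrow> 'a \<Rightarrow> real"
  assumes [measurable]: "\<And>n. f n \<in> borel_measurable M"
    and bounded: "\<And>n x. x \<in> space M \<Longrightarrow> \<bar>f n x\<bar> \<le> b n" and "summable b"
  shows "integrable M (\<lambda>x. \<Sum>n. f n x)" and "(\<lambda>n. \<integral>x. f n x \<partial>M) sums (\<integral>x. (\<Sum>n. f n x) \<partial>M)"
proof -
  have integrable_f: "integrable M (f n)" for n
    by (rule integrable_const_bound[of _ "b n"]) (use bounded in auto)
  have abs_summable: "AE x in M. summable (\<lambda>n. norm (f n x))"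
    by (intro AE_I2 summable_comparison_test'[OF \<open>summable b\<close>]) (use bounded in auto)
  have "(\<integral>x. norm (f n x) \<partial>M) \<le> b n * measure M (space M)" for n
    using integral_mono[OF integrable_norm[OF integrable_f] integrable_const, of n "b n"] bounded
    by (simp add: mult.commute)
  then have "summable (\<lambda>n. \<integral>x. norm (f n x) \<partial>M)"
    by (intro summable_comparison_test'[OF summable_mult2[OF \<open>summable b\<close>]]) simp
  then show "integrable M (\<lambda>x. \<Sum>n. f n x)" and "(\<lambda>n. \<integral>x. f n x \<partial>M) sums (\<integral>x. (\<Sum>n. f n x) \<partial>M)"
    using integrable_suminf[OF integrable_f abs_summable] sums_integral[OF integrable_f abs_summable]
    by auto
qed

lemma emeasure_restrict_pmf_single:
  assumes "set_pmf q \<subseteq> S"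
  shows "emeasure (restrict_space (measure_pmf q) S) ({b} \<inter> S) = pmf q b"
proof -
  have "emeasure (restrict_space (measure_pmf q) S) ({b} \<inter> S) = emeasure (measure_pmf q) ({b} \<inter> S)"
    by (rule emeasure_restrict_space) auto
  also have "\<dots> = emeasure (measure_pmf q) ({b} \<inter> S \<inter> set_pmf q)"
    by (rule emeasure_Int_set_pmf[symmetric])
  also have "{b} \<inter> S \<inter> set_pmf q = {b} \<inter> set_pmf q"
    using assms by blast
  also have "emeasure (measure_pmf q) \<dots> = pmf q b"
    by (simp only: emeasure_Int_set_pmf emeasure_pmf_single)
  finally show ?thesis .
qed

section \<open>Lagrange duality for concavelike functions\<close>

definition concavelike_on :: "'a set \<Rightarrow> ('a \<Rightarrow> real) set \<Rightarrow> bool" where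
  "concavelike_on C F \<longleftrightarrow> (\<forall>x\<in>C. \<forall>y\<in>C. \<forall>u\<in>{0..1}. \<exists>z\<in>C. \<forall>f\<in>F. (1 - u) * f x + u * f y \<le> f z)"

lemma concavelike_onE:
  assumes "concavelike_on C F" "x \<in> C" "y \<in> C" "0 \<le> u" "u \<le> 1"
  obtains z where "z \<in> C" "\<And>f. f \<in> F \<Longrightarrow> (1 - u) * f x + u * f y \<le> f z"
  using assms by (force simp: concavelike_on_def)

lemma concavelike_on_mono: "concavelike_on C F \<Longrightarrow> G \<subseteq> F \<Longrightarrow> concavelike_on C G"
  unfolding concavelike_on_def by blast

lemma concavelike_on_superlevel:
  assumes "concavelike_on C F" "g \<in> F"
  shows "concavelike_on {x \<in> C. 0 \<le> g x} F"
  unfolding concavelike_on_def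
proof (intro ballI)
  fix x y and u :: real assume *: "x \<in> {x \<in> C. 0 \<le> g x}" "y \<in> {x \<in> C. 0 \<le> g x}" "u \<in> {0..1}"
  then obtain z where z_dominates: "z \<in> C" "\<And>f. f \<in> F \<Longrightarrow> (1 - u) * f x + u * f y \<le> f z"
    using concavelike_onE[OF assms(1), of x y u] by auto
  have "0 \<le> (1 - u) * g x + u * g y"
    using * by simp
  also have "\<dots> \<le> g z"
    by (rule z_dominates(2)[OF assms(2)])
  finally show "\<exists>z\<in>{x \<in> C. 0 \<le> g x}. \<forall>f\<in>F. (1 - u) * f x + u * f y \<le> f z"
    using z_dominates by blast
qed

lemma concavelike_on_nonneg_combination:
  assumes "concavelike_on C F" "f \<in> F" "\<And>j. j \<in> J \<Longrightarrow> g j \<in> F" "\<And>j. j \<in> J \<Longrightarrow> 0 \<le> l j"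
  shows "concavelike_on C (insert (\<lambda>x. f x + (\<Sum>j\<in>J. l j * g j x)) F)"
  unfolding concavelike_on_def
proof (intro ballI)
  fix x y and u :: real assume "x \<in> C" "y \<in> C" "u \<in> {0..1}"
  then obtain z where z_dominates: "z \<in> C" "\<And>f. f \<in> F \<Longrightarrow> (1 - u) * f x + u * f y \<le> f z"
    using concavelike_onE[OF assms(1), of x y u] by auto
  have "(1 - u) * (f x + (\<Sum>j\<in>J. l j * g j x)) + u * (f y + (\<Sum>j\<in>J. l j * g j y))
      = ((1 - u) * f x + u * f y) + (\<Sum>j\<in>J. l j * ((1 - u) * g j x + u * g j y))"
    by (simp add: sum_distrib_left sum.distrib sum_subtractf algebra_simps)
  also have "\<dots> \<le> f z + (\<Sum>j\<in>J. l j * g j z)"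
    using z_dominates(2) assms(2-) by (intro add_mono sum_mono mult_left_mono) auto
  finally show "\<exists>z\<in>C. \<forall>f\<in>insert (\<lambda>x. f x + (\<Sum>j\<in>J. l j * g j x)) F. (1 - u) * f x + u * f y \<le> f z"
    using z_dominates by auto
qed

lemma compact_superlevel:
  fixes g :: "'a::topological_space \<Rightarrow> real"
  assumes "compact C" "continuous_on C g"
  shows "compact {x \<in> C. 0 \<le> g x}"
proof -
  have "closedin (top_of_set C) (C \<inter> g -` {0..})"
    by (intro continuous_closedin_preimage assms(2)) simp
  then show ?thesis
    using closedin_compact[OF assms(1)] by (simp add: Int_def)
qed

lemma ex_superlevel_fip:
  fixes g :: "'j \<Rightarrow> 'a::topological_space \<Rightarrow> real"
  assumes "compact C" and cont: "\<And>j. j \<in> J \<Longrightarrow> continuous_on C (g j)"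
    and fip: "\<And>J'. finite J' \<Longrightarrow> J' \<subseteq> J \<Longrightarrow> \<exists>x\<in>C. \<forall>j\<in>J'. 0 \<le> g j x"
  shows "\<exists>x\<in>C. \<forall>j\<in>J. 0 \<le> g j x"
proof -
  have "\<exists>T. closed T \<and> C \<inter> g j -` {0..} = C \<inter> T" if "j \<in> J" for j
    using continuous_closedin_preimage[OF cont[OF that], of "{0..}"] by (auto simp: closedin_closed)
  then obtain T where T_closed: "\<And>j. j \<in> J \<Longrightarrow> closed (T j)" "\<And>j. j \<in> J \<Longrightarrow> C \<inter> g j -` {0..} = C \<inter> T j"
    by metis
  then have T_iff: "x \<in> T j \<longleftrightarrow> 0 \<le> g j x" if "x \<in> C" "j \<in> J" for x j
    using that by blast
  have "C \<inter> (\<Inter>j\<in>J. T j) \<noteq> {}"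
  proof (rule compact_imp_fip_image[OF assms(1) T_closed(1)])
    fix J' assume "finite J'" "J' \<subseteq> J"
    then show "C \<inter> (\<Inter>j\<in>J'. T j) \<noteq> {}"
      using fip[of J'] T_iff by blast
  qed
  then show ?thesis
    using T_iff by blast
qed

lemma convex_hypograph_if_concavelike:
  assumes "concavelike_on C {f, g}"
  shows "convex {v. \<exists>z\<in>C. fst v \<le> f z \<and> snd v \<le> g z}" (is "convex ?H")
  unfolding convex_alt
proof (intro ballI allI impI)
  fix v w and u :: real assume "v \<in> ?H" "w \<in> ?H" and u_bounds: "0 \<le> u \<and> u \<le> 1"
  then obtain x y where v_below: "x \<in> C" "fst v \<le> f x" "snd v \<le> g x"
    and w_below: "y \<in> C" "fst w \<le> f y" "snd w \<le> g y"
    by auto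
  obtain z where z_dominates: "z \<in> C" "(1 - u) * f x + u * f y \<le> f z" "(1 - u) * g x + u * g y \<le> g z"
    using concavelike_onE[OF assms v_below(1) w_below(1)] u_bounds by (metis insertCI)
  have "(1 - u) * fst v + u * fst w \<le> (1 - u) * f x + u * f y"
    and "(1 - u) * snd v + u * snd w \<le> (1 - u) * g x + u * g y"
    using v_below w_below u_bounds by (auto intro!: add_mono mult_left_mono)
  with z_dominates show "(1 - u) *\<^sub>R v + u *\<^sub>R w \<in> ?H"
    by (auto intro: order_trans)
qed

lemma slope_nonneg_if_bounded_below:
  fixes p :: real
  assumes "\<And>t. 0 \<le> t \<Longrightarrow> b < c + p * t"
  shows "0 \<le> p"
proof (rule ccontr)
  assume "\<not> 0 \<le> p"
  then show False
    using assms[of 0] assms[of "(b - c) / p"] by (simp add: divide_nonpos_neg)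
qed

lemma separate_from_quadrant:
  assumes concave: "concavelike_on C {f, g}" and compact: "compact ((\<lambda>x. (f x, g x)) ` C)" and "C \<noteq> {}"
    and f_less_d: "\<And>x. x \<in> C \<Longrightarrow> 0 \<le> g x \<Longrightarrow> f x < d"
  obtains p q b :: real where "0 \<le> p" "0 \<le> q" "b < p * d" "\<And>x. x \<in> C \<Longrightarrow> p * f x + q * g x < b"
proof -
  let ?S = "(\<lambda>x. (f x, g x)) ` C" and ?Q = "{d..} \<times> {0::real..}"
  let ?H = "{v. \<exists>z\<in>C. fst v \<le> f z \<and> snd v \<le> g z}"
  have "?S \<subseteq> ?H" and "?H \<inter> ?Q = {}"
    using f_less_d by force+
  then have disjoint: "convex hull ?S \<inter> ?Q = {}"
    using hull_minimal[of ?S ?H convex] convex_hypograph_if_concavelike[OF concave] by blast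
  have nonempty: "convex hull ?S \<noteq> {}" and convex_closed_quadrant: "convex ?Q" "closed ?Q"
    using \<open>C \<noteq> {}\<close> by (auto intro!: convex_Times closed_Times)
  obtain a b where below_hull: "\<forall>v\<in>convex hull ?S. inner a v < b"
    and above_quadrant: "\<forall>v\<in>?Q. b < inner a v"
    using separating_hyperplane_compact_closed
      [OF convex_convex_hull compact_convex_hull[OF compact] nonempty convex_closed_quadrant disjoint]
    by blast
  obtain p q where a_eq: "a = (p, q)"
    by (cases a)
  have ray: "b < p * (d + v) + q * w" if "0 \<le> v" "0 \<le> w" for v w
    using bspec[OF above_quadrant, of "(d + v, w)"] that by (simp add: a_eq)
  have less_p_d: "b < p * d"
    using ray[of 0 0] by simp
  have "0 \<le> p"
    using ray[of _ 0] by (intro slope_nonneg_if_bounded_below[of b "p * d"]) (simp add: distrib_left)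
  moreover have "0 \<le> q"
    using ray[of 0] by (intro slope_nonneg_if_bounded_below[of b "p * d"]) simp
  moreover have "p * f x + q * g x < b" if "x \<in> C" for x
    using bspec[OF below_hull hull_inc, of "(f x, g x)"] that by (simp add: a_eq)
  ultimately show thesis
    using that less_p_d by blast
qed

lemma lagrange_multiplier:
  assumes compact: "compact C" and cont: "continuous_on C f" "continuous_on C g"
    and concave: "concavelike_on C {f, g}"
    and feasible: "x \<in> C" "0 \<le> g x" and f_less_d: "\<And>x. x \<in> C \<Longrightarrow> 0 \<le> g x \<Longrightarrow> f x < d"
  obtains l where "0 \<le> l" "\<And>x. x \<in> C \<Longrightarrow> f x + l * g x < d"
proof -
  have "compact ((\<lambda>x. (f x, g x)) ` C)"
    by (intro compact_continuous_image continuous_on_Pair cont compact)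
  then obtain p q b where pq_nonneg: "0 \<le> p" "0 \<le> q"
    and separated: "b < p * d" "\<And>x. x \<in> C \<Longrightarrow> p * f x + q * g x < b"
    using separate_from_quadrant[OF concave _ _ f_less_d] feasible(1) by blast
  have "p \<noteq> 0"
    using separated(1) separated(2)[OF feasible(1)] mult_nonneg_nonneg[OF pq_nonneg(2) feasible(2)]
    by auto
  then have p_pos: "0 < p"
    using pq_nonneg(1) by simp
  have "f x + q / p * g x < d" if "x \<in> C" for x
    using separated(2)[OF that] separated(1) p_pos by (simp add: field_simps)
  then show thesis
    using that[of "q / p"] pq_nonneg p_pos by simp
qed

lemma lagrange_multipliers:
  fixes f :: "'a::topological_space \<Rightarrow> real"
  assumes "compact C" and "finite J"
    and "continuous_on C f" "\<And>j. j \<in> J \<Longrightarrow> continuous_on C (g j)"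
    and "concavelike_on C (insert f (g ` J))"
    and "\<exists>x\<in>C. \<forall>j\<in>J. 0 \<le> g j x"
    and "\<And>x. x \<in> C \<Longrightarrow> \<forall>j\<in>J. 0 \<le> g j x \<Longrightarrow> f x < d"
  shows "\<exists>l. (\<forall>j\<in>J. 0 \<le> l j) \<and> (\<forall>x\<in>C. f x + (\<Sum>j\<in>J. l j * g j x) < d)"
  using \<open>finite J\<close> assms(1) assms(3-)
proof (induction J arbitrary: C rule: finite_induct)
  case (insert i J)
  let ?C = "{x \<in> C. 0 \<le> g i x}"
  have "\<exists>l. (\<forall>j\<in>J. 0 \<le> l j) \<and> (\<forall>x\<in>?C. f x + (\<Sum>j\<in>J. l j * g j x) < d)"
  proof (rule insert.IH)
    show "compact ?C"
      using insert.prems(1,3) by (intro compact_superlevel) auto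
    show "concavelike_on ?C (insert f (g ` J))"
      by (rule concavelike_on_mono[OF concavelike_on_superlevel[OF insert.prems(4)]]) auto
  qed (use insert.prems in \<open>auto intro: continuous_on_subset\<close>)
  then obtain l where l_nonneg: "\<forall>j\<in>J. 0 \<le> l j" and Lagrangian: "\<forall>x\<in>?C. f x + (\<Sum>j\<in>J. l j * g j x) < d"
    by blast
  have "concavelike_on C (insert (\<lambda>x. f x + (\<Sum>j\<in>J. l j * g j x)) (insert f (g ` insert i J)))"
    using l_nonneg by (intro concavelike_on_nonneg_combination insert.prems) auto
  then have "concavelike_on C {\<lambda>x. f x + (\<Sum>j\<in>J. l j * g j x), g i}"
    by (rule concavelike_on_mono) auto
  moreover have "continuous_on C (\<lambda>x. f x + (\<Sum>j\<in>J. l j * g j x))"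
    using insert.prems(2,3) by (intro continuous_intros) auto
  moreover obtain x where "x \<in> C" "0 \<le> g i x"
    using insert.prems(5) by auto
  ultimately obtain m where m_multiplier: "0 \<le> m" "\<And>x. x \<in> C \<Longrightarrow> f x + (\<Sum>j\<in>J. l j * g j x) + m * g i x < d"
    using lagrange_multiplier[OF insert.prems(1), of "\<lambda>x. f x + (\<Sum>j\<in>J. l j * g j x)" "g i" x d]
      insert.prems(3) Lagrangian
    by auto
  have "(\<Sum>j\<in>insert i J. (l(i := m)) j * g j x) = m * g i x + (\<Sum>j\<in>J. l j * g j x)" for x
    using insert.hyps by (auto intro: sum.cong)
  then show ?case
    using l_nonneg m_multiplier insert.hyps
    by (intro exI[of _ "l(i := m)"]) (auto simp: add.assoc add.commute add.left_commute)
qed auto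

lemma lagrange_duality_finite:
  fixes f :: "'a::topological_space \<Rightarrow> real"
  assumes "compact C" "finite J" "continuous_on C f" "\<And>j. j \<in> J \<Longrightarrow> continuous_on C (g j)"
    and "concavelike_on C (insert f (g ` J))"
    and "\<exists>x\<in>C. \<forall>j\<in>J. 0 \<le> g j x"
    and dual: "\<And>l. (\<And>j. j \<in> J \<Longrightarrow> 0 \<le> l j) \<Longrightarrow> \<exists>x\<in>C. y \<le> f x + (\<Sum>j\<in>J. l j * g j x)"
  shows "\<exists>x\<in>C. y \<le> f x \<and> (\<forall>j\<in>J. 0 \<le> g j x)"
proof (rule ccontr)
  assume "\<not> ?thesis"
  then have "\<exists>l. (\<forall>j\<in>J. 0 \<le> l j) \<and> (\<forall>x\<in>C. f x + (\<Sum>j\<in>J. l j * g j x) < y)"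
    using assms(6) by (intro lagrange_multipliers assms(1-5)) (force simp: not_le)+
  then show False
    using dual by (metis not_less)
qed

theorem lagrange_duality:
  fixes f :: "'a::topological_space \<Rightarrow> real"
  assumes compact: "compact C" and cont: "continuous_on C f" "\<And>j. j \<in> J \<Longrightarrow> continuous_on C (g j)"
    and concave: "concavelike_on C (insert f (g ` J))"
    and feasible: "\<exists>x\<in>C. \<forall>j\<in>J. 0 \<le> g j x"
    and dual: "\<And>J' l y. finite J' \<Longrightarrow> J' \<subseteq> J \<Longrightarrow> (\<And>j. j \<in> J' \<Longrightarrow> 0 \<le> l j) \<Longrightarrow> y < d \<Longrightarrow>
      \<exists>x\<in>C. y \<le> f x + (\<Sum>j\<in>J'. l j * g j x)"
  shows "\<exists>x\<in>C. d \<le> f x \<and> (\<forall>j\<in>J. 0 \<le> g j x)"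
proof -
  have finitely_many: "\<exists>x\<in>C. y \<le> f x \<and> (\<forall>j\<in>J'. 0 \<le> g j x)"
    if "finite J'" "J' \<subseteq> J" "y < d" for J' y
    using that cont(2) feasible
    by (intro lagrange_duality_finite compact cont(1) concavelike_on_mono[OF concave] dual) auto
  define constraint where "constraint z x = (case z of Inl y \<Rightarrow> f x - y | Inr j \<Rightarrow> g j x)"
    for z :: "real + 'b" and x
  have "\<exists>x\<in>C. \<forall>z\<in>Inl ` {..<d} \<union> Inr ` J. 0 \<le> constraint z x"
  proof (rule ex_superlevel_fip[OF compact])
    fix Z assume finite_Z: "finite Z" "Z \<subseteq> Inl ` {..<d} \<union> Inr ` J"
    define Y J' where "Y = insert (d - 1) (Inl -` Z)" and "J' = Inr -` Z"
    have "finite J'" "J' \<subseteq> J" "finite Y" "Max Y < d"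
      using finite_Z by (auto simp: Y_def J'_def finite_vimageI)
    then obtain x where x_superlevel: "x \<in> C" "Max Y \<le> f x" "\<forall>j\<in>J'. 0 \<le> g j x"
      using finitely_many by blast
    then have "y \<le> f x" if "Inl y \<in> Z" for y
      using that \<open>finite Y\<close> Max_ge[of Y y] by (auto simp: Y_def)
    with x_superlevel show "\<exists>x\<in>C. \<forall>z\<in>Z. 0 \<le> constraint z x"
      by (intro bexI[of _ x]) (auto simp: constraint_def J'_def split: sum.split)
  qed (auto simp: constraint_def intro!: continuous_intros cont)
  then obtain x where "x \<in> C" and x_superlevel: "\<And>z. z \<in> Inl ` {..<d} \<union> Inr ` J \<Longrightarrow> 0 \<le> constraint z x"
    by blast
  have "y \<le> f x" if "y < d" for y
    using x_superlevel[of "Inl y"] that by (simp add: constraint_def)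
  then have "d \<le> f x"
    by (rule dense_le)
  moreover have "0 \<le> g j x" if "j \<in> J" for j
    using x_superlevel[of "Inr j"] that by (simp add: constraint_def)
  ultimately show ?thesis
    using \<open>x \<in> C\<close> by blast
qed

section \<open>Weights and the function space\<close>

abbreviation l1norm :: "real ^ 'i::finite \<Rightarrow> real" where
  "l1norm \<gamma> \<equiv> \<Sum>i\<in>UNIV. \<bar>\<gamma> $ i\<bar>"

lemma l1norm_nonneg_eq: "\<gamma> \<in> nonneg \<Longrightarrow> l1norm \<gamma> = (\<Sum>i\<in>UNIV. \<gamma> $ i)"
  by (simp add: nonneg_def)

lemma l1norm_add: "l1norm (\<gamma> + \<mu>) \<le> l1norm \<gamma> + l1norm \<mu>"
  by (simp add: sum_mono abs_triangle_ineq flip: sum.distrib)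

lemma nonneg_convex: "convex (nonneg :: (real ^ 'i::finite) set)"
  by (auto simp: convex_def nonneg_def)

lemma nonneg_add: "\<gamma> \<in> nonneg \<Longrightarrow> \<mu> \<in> nonneg \<Longrightarrow> \<gamma> + \<mu> \<in> nonneg" for \<gamma> \<mu> :: "real ^ 'i::finite"
  by (simp add: nonneg_def)

lemma Bk_subset_nonneg: "Bk k \<subseteq> nonneg"
  by (auto simp: Bk_def nonneg_def)

lemma continuous_on_if_l1_lipschitz:
  fixes f :: "real ^ 'i::finite \<Rightarrow> real"
  assumes "0 \<le> L" "\<And>\<gamma>1 \<gamma>2. \<gamma>1 \<in> S \<Longrightarrow> \<gamma>2 \<in> S \<Longrightarrow> \<bar>f \<gamma>1 - f \<gamma>2\<bar> \<le> L * l1norm (\<gamma>1 - \<gamma>2)"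
  shows "continuous_on S f"
proof -
  have "l1norm (\<gamma>1 - \<gamma>2) \<le> CARD('i) * dist \<gamma>1 \<gamma>2" for \<gamma>1 \<gamma>2 :: "real ^ 'i"
    using sum_mono[of UNIV "\<lambda>i. \<bar>(\<gamma>1 - \<gamma>2) $ i\<bar>" "\<lambda>_. dist \<gamma>1 \<gamma>2"] component_le_norm_cart[of "\<gamma>1 - \<gamma>2"]
    by (simp add: dist_norm)
  then have "\<bar>f \<gamma>1 - f \<gamma>2\<bar> \<le> L * (CARD('i) * dist \<gamma>1 \<gamma>2)" if "\<gamma>1 \<in> S" "\<gamma>2 \<in> S" for \<gamma>1 \<gamma>2
    using assms(2)[OF that] mult_left_mono[OF _ assms(1)] order_trans by blast
  then have "(L * CARD('i))-lipschitz_on S f"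
    using assms(1) by (intro lipschitz_onI) (auto simp: dist_real_def mult.assoc)
  then show ?thesis
    by (rule lipschitz_on_continuous_on)
qed

lemma Linf_le:
  fixes f :: "real ^ 'i::finite \<Rightarrow> real"
  assumes "continuous_on (Bk k) f" "\<And>\<gamma>. \<gamma> \<in> Bk k \<Longrightarrow> \<bar>f \<gamma>\<bar> \<le> c"
  shows "Linf k f \<le> ereal c"
proof -
  have "closed (Bk k :: (real ^ 'i) set)"
    unfolding Bk_def
    by (intro closed_Collect_all closed_Collect_conj closed_Collect_le continuous_intros)
  then have Bk_lebesgue: "(Bk k :: (real ^ 'i) set) \<in> sets lebesgue"
    using lebesgue_closedin[of UNIV "Bk k :: (real ^ 'i) set"] by simp
  have "f \<in> borel_measurable (lebesgue_on (Bk k))"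
    by (rule continuous_imp_measurable_on_sets_lebesgue[OF assms(1) Bk_lebesgue])
  then have "(\<lambda>\<gamma>. ereal \<bar>f \<gamma>\<bar>) \<in> borel_measurable (lebesgue_on (Bk k))"
    by measurable
  then show ?thesis
    unfolding Linf_def using Bk_lebesgue assms(2)
    by (intro esssup_I AE_I2) (auto simp: space_restrict_space)
qed

lemma Linf_le_if_linear_growth:
  fixes f :: "real ^ 'i::finite \<Rightarrow> real" and k L :: real
  assumes "continuous_on nonneg f" "0 \<le> L"
    and growth: "\<And>\<gamma>. \<gamma> \<in> nonneg \<Longrightarrow> \<bar>f \<gamma>\<bar> \<le> (1 + l1norm \<gamma>) * L"
  shows "Linf k f \<le> ereal ((1 + CARD('i) * k) * L)"
proof (rule Linf_le[OF continuous_on_subset[OF assms(1) Bk_subset_nonneg]])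
  fix \<gamma> :: "real ^ 'i" assume \<gamma>_in_Bk: "\<gamma> \<in> Bk k"
  then have "l1norm \<gamma> \<le> CARD('i) * k"
    using sum_mono[of UNIV "\<lambda>i. \<bar>\<gamma> $ i\<bar>" "\<lambda>_. k"] by (simp add: Bk_def)
  then have "(1 + l1norm \<gamma>) * L \<le> (1 + CARD('i) * k) * L"
    using \<open>0 \<le> L\<close> by (intro mult_right_mono) auto
  then show "\<bar>f \<gamma>\<bar> \<le> (1 + CARD('i) * k) * L"
    using growth[of \<gamma>] \<gamma>_in_Bk Bk_subset_nonneg by (meson order_trans subsetD)
qed

lemma inM_if_linear_growth:
  fixes F :: "real ^ 'i::finite \<Rightarrow> 'x \<Rightarrow> 's::finite \<Rightarrow> real"
  assumes cont: "\<And>x s. continuous_on nonneg (\<lambda>\<gamma>. F \<gamma> x s)" and "0 \<le> L"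
    and growth: "\<And>\<gamma> x s. \<gamma> \<in> nonneg \<Longrightarrow> \<bar>F \<gamma> x s\<bar> \<le> (1 + l1norm \<gamma>) * L"
  shows "inM X F"
proof -
  define v where "v k = (1 + CARD('i) * real k) * L" for k
  have v_nonneg: "0 \<le> v k" for k
    using \<open>0 \<le> L\<close> by (simp add: v_def)
  have Linf_le_v: "Linf (real k) (\<lambda>\<gamma>. F \<gamma> x s) \<le> ereal (v k)" for k x s
    unfolding v_def by (rule Linf_le_if_linear_growth[OF cont \<open>0 \<le> L\<close> growth])
  have "(\<Sum>j. \<Sum>k. ennreal ((1 / 2) ^ Suc j * (1 / 2) ^ Suc k)
      * e2ennreal (Linf (real (Suc k)) (\<lambda>\<gamma>. F \<gamma> (from_nat_into X j) s))) < \<top>" for s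
  proof (rule suminf_suminf_ennreal_less_top)
    fix j k
    have "e2ennreal (Linf (real (Suc k)) (\<lambda>\<gamma>. F \<gamma> (from_nat_into X j) s)) \<le> ennreal (v (Suc k))"
      using e2ennreal_mono[OF Linf_le_v, of "Suc k" "from_nat_into X j" s] by (simp del: of_nat_Suc)
    then show "ennreal ((1 / 2) ^ Suc j * (1 / 2) ^ Suc k)
          * e2ennreal (Linf (real (Suc k)) (\<lambda>\<gamma>. F \<gamma> (from_nat_into X j) s))
        \<le> ennreal ((1 / 2) ^ Suc j) * ennreal ((1 / 2) ^ Suc k * v (Suc k))"
      using v_nonneg by (simp add: ennreal_mult mult.assoc mult_left_mono del: power_Suc)
  next
    show "summable (\<lambda>j. (1 / 2 :: real) ^ Suc j)"
      using summable_half_power_linear[of 1 0] by simp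
    show "summable (\<lambda>k. (1 / 2) ^ Suc k * v (Suc k))"
      using summable_half_power_linear[of L "CARD('i) * L"] by (simp add: v_def algebra_simps)
  qed (use v_nonneg in auto)
  moreover have "Linf (real k) (\<lambda>\<gamma>. F \<gamma> x s) < \<infinity>" for k x s
    by (rule le_less_trans[OF Linf_le_v]) simp
  ultimately show ?thesis
    unfolding inM_def ennreal_sum_less_top[OF finite] by blast
qed

section \<open>Histories and conditional expectations\<close>

lemma pathprob_single [simp]: "pathprob \<pi> [s] = 1"
  by (simp add: pathprob_def)

lemma pathprob_Cons:
  assumes "h \<noteq> []"
  shows "pathprob \<pi> (s # h) = \<pi> s (hd h) * pathprob \<pi> h"
  using assms
  by (cases h) (simp_all add: pathprob_def prod.lessThan_Suc_shift del: prod.lessThan_Suc)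

lemma pathprob_snoc: "h \<noteq> [] \<Longrightarrow> pathprob \<pi> (h @ [s]) = pathprob \<pi> h * \<pi> (last h) s"
  by (induction h rule: list_nonempty_induct) (simp_all add: pathprob_Cons)

lemma sum_lists_length_Suc:
  fixes f :: "'b list \<Rightarrow> 'c::comm_monoid_add"
  assumes "finite B"
  shows "(\<Sum>e | set e \<subseteq> B \<and> length e = Suc n. f e) = (\<Sum>x\<in>B. \<Sum>e | set e \<subseteq> B \<and> length e = n. f (x # e))"
proof -
  have lists_Suc: "{e. set e \<subseteq> B \<and> length e = Suc n}
      = (\<lambda>(x, e). x # e) ` (B \<times> {e. set e \<subseteq> B \<and> length e = n})"
    by (force simp: length_Suc_conv)
  show ?thesis
    unfolding lists_Suc
    by (subst sum.reindex)
      (auto simp: inj_on_def sum.cartesian_product assms case_prod_beta intro!: sum.cong)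
qed

lemma condE_cong:
  assumes "\<And>e. length e = n \<Longrightarrow> f (h @ e) = f' (h @ e)"
  shows "condE \<pi> h n f = condE \<pi> h n f'"
  unfolding condE_def using assms by (intro sum.cong) auto

lemma condE_add: "condE \<pi> h n (\<lambda>h'. f h' + f' h') = condE \<pi> h n f + condE \<pi> h n f'"
  by (simp add: condE_def distrib_left sum.distrib)

lemma condE_cmult: "condE \<pi> h n (\<lambda>h'. c * f h') = c * condE \<pi> h n f"
  by (simp add: condE_def algebra_simps sum_distrib_left)

lemma condE_sum: "condE \<pi> h n (\<lambda>h'. \<Sum>i\<in>I. f i h') = (\<Sum>i\<in>I. condE \<pi> h n (f i))"
  unfolding condE_def sum_distrib_left by (rule sum.swap)

locale positive_chain =
  fixes \<pi> :: "'s::finite \<Rightarrow> 's \<Rightarrow> real"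
  assumes pi_pos: "\<And>s s'. \<pi> s s' > 0"
    and pi_sum: "\<And>s. (\<Sum>s'\<in>UNIV. \<pi> s s') = 1"
begin

abbreviation expect :: "'s \<Rightarrow> ('s \<Rightarrow> real) \<Rightarrow> real" where
  "expect s f \<equiv> \<Sum>s'\<in>UNIV. \<pi> s s' * f s'"

lemma expect_mono: "(\<And>s'. f s' \<le> f' s') \<Longrightarrow> expect s f \<le> expect s f'"
  using pi_pos by (intro sum_mono mult_left_mono) (auto simp: less_imp_le)

lemma expect_const [simp]: "expect s (\<lambda>_. c) = c"
  using pi_sum[of s] by (simp flip: sum_distrib_right)

lemma expect_add: "expect s (\<lambda>s'. f s' + f' s') = expect s f + expect s f'"
  by (simp add: distrib_left sum.distrib)

lemma pathprob_pos: "0 < pathprob \<pi> h"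
  unfolding pathprob_def using pi_pos by (intro prod_pos) auto

lemma pathprob_append_ratio:
  assumes "h \<noteq> []"
  shows "pathprob \<pi> (h @ s # e) / pathprob \<pi> h
    = \<pi> (last h) s * (pathprob \<pi> ((h @ [s]) @ e) / pathprob \<pi> (h @ [s]))"
  using pathprob_pos[of h] pi_pos[of "last h" s] by (simp add: pathprob_snoc[OF assms])

lemma condE_0 [simp]: "condE \<pi> h 0 f = f h"
  using pathprob_pos[of h] by (simp add: condE_def)

lemma condE_Suc:
  assumes "h \<noteq> []"
  shows "condE \<pi> h (Suc n) f = expect (last h) (\<lambda>s. condE \<pi> (h @ [s]) n f)"
proof -
  have sum_Suc: "(\<Sum>e | length e = Suc n. F e) = (\<Sum>s\<in>UNIV. \<Sum>e | length e = n. F (s # e))"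
    for F :: "'s list \<Rightarrow> real"
    using sum_lists_length_Suc[of "UNIV :: 's set" F n] by simp
  show ?thesis
    unfolding condE_def sum_Suc pathprob_append_ratio[OF assms] sum_distrib_left
    by (simp add: mult.assoc)
qed

lemma condE_Cons:
  assumes "h \<noteq> []"
  shows "condE \<pi> (s # h) n f = condE \<pi> h n (\<lambda>h'. f (s # h'))"
  using pi_pos[of s "hd h"] assms by (simp add: condE_def pathprob_Cons)

lemma condE_single_Suc: "condE \<pi> [s] (Suc n) f = expect s (\<lambda>s'. condE \<pi> [s'] n (\<lambda>h. f (s # h)))"
  by (simp add: condE_Suc condE_Cons)

lemma condE_single_point:
  "condE \<pi> [s] t (\<lambda>h. if h = h' then y else 0)
    = (if h' \<noteq> [] \<and> hd h' = s \<and> t = length h' - 1 then pathprob \<pi> h' * y else 0)"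
proof -
  have "condE \<pi> [s] t (\<lambda>h. if h = h' then y else 0)
      = (\<Sum>e | length e = t. if s # e = h' then pathprob \<pi> h' * y else 0)"
    unfolding condE_def by (intro sum.cong) auto
  also have "\<dots> = (if h' \<noteq> [] \<and> hd h' = s \<and> t = length h' - 1 then pathprob \<pi> h' * y else 0)"
  proof (cases h')
    case (Cons s' e')
    have "finite {e :: 's list. length e = t}"
      using finite_lists_length_eq[of "UNIV :: 's set" t] by simp
    then show ?thesis
      by (cases "s' = s") (simp_all add: Cons sum.delta' eq_commute[of _ e'])
  qed simp
  finally show ?thesis .
qed

lemma condE_mono:
  assumes "\<And>e. length e = n \<Longrightarrow> f (h @ e) \<le> f' (h @ e)"
  shows "condE \<pi> h n f \<le> condE \<pi> h n f'"
  unfolding condE_def using assms pathprob_pos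
  by (intro sum_mono mult_left_mono) (auto simp: less_imp_le)

lemma condE_const: "h \<noteq> [] \<Longrightarrow> condE \<pi> h n (\<lambda>_. c) = c"
  by (induction n arbitrary: h) (simp_all add: condE_Suc)

lemma condE_abs_le:
  assumes "\<And>e. length e = n \<Longrightarrow> \<bar>f (h @ e)\<bar> \<le> f' (h @ e)"
  shows "\<bar>condE \<pi> h n f\<bar> \<le> condE \<pi> h n f'"
proof -
  have "condE \<pi> h n (\<lambda>h'. - 1 * f' h') \<le> condE \<pi> h n f" "condE \<pi> h n f \<le> condE \<pi> h n f'"
    using assms by (intro condE_mono; force simp: abs_le_iff)+
  then show ?thesis
    unfolding condE_cmult by (simp add: abs_le_iff)
qed

end

section \<open>Post-action histories and plans\<close>

definition histories :: "'a set \<Rightarrow> nat \<Rightarrow> ('s \<times> 'a) list set" where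
  "histories A n = {k. set k \<subseteq> UNIV \<times> A \<and> length k = n}"

lemma histories_0 [simp]: "histories A 0 = {[]}"
  by (auto simp: histories_def)

lemma Cons_histories [simp]: "(s, b) # k \<in> histories A (Suc n) \<longleftrightarrow> b \<in> A \<and> k \<in> histories A n"
  by (auto simp: histories_def)

lemma snoc_histories [simp]: "k @ [(s, b)] \<in> histories A (Suc n) \<longleftrightarrow> b \<in> A \<and> k \<in> histories A n"
  by (auto simp: histories_def)

lemma append_histories: "k \<in> histories A m \<Longrightarrow> e \<in> histories A n \<Longrightarrow> k @ e \<in> histories A (m + n)"
  by (auto simp: histories_def)

lemma Htil_eq_histories: "Htil A t = histories A (Suc t)"
  by (auto simp: Htil_def histories_def)

lemma Htil_nonempty: "k \<in> Htil A t \<Longrightarrow> k \<noteq> []"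
  by (auto simp: Htil_def)

lemma finite_histories [simp]:
  assumes "finite A"
  shows "finite (histories A n :: ('s::finite \<times> 'a) list set)"
  unfolding histories_def using assms by (intro finite_lists_length_eq) simp

lemma sum_histories_Suc:
  fixes f :: "('s::finite \<times> 'a) list \<Rightarrow> 'b::comm_monoid_add"
  assumes "finite A"
  shows "(\<Sum>k\<in>histories A (Suc n). f k) = (\<Sum>s\<in>UNIV. \<Sum>b\<in>A. \<Sum>k\<in>histories A n. f ((s, b) # k))"
  unfolding histories_def using assms by (simp add: sum_lists_length_Suc sum.cartesian_product')

lemma htil_Nil [simp]: "htil a [] = []"
  by (simp add: htil_def)

lemma htil_snoc: "htil a (h @ [s]) = htil a h @ [(s, a (h @ [s]))]"
  by (simp add: htil_def nth_append)

lemma length_htil [simp]: "length (htil a h) = length h"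
  by (simp add: htil_def)

lemma map_fst_htil [simp]: "map fst (htil a h) = h"
  by (simp add: htil_def o_def map_nth)

lemma htil_eq_iff_actions:
  "htil a (map fst k) = k \<longleftrightarrow> map (\<lambda>j. a (take (Suc j) (map fst k))) [0..<length k] = map snd k"
  (is "_ \<longleftrightarrow> ?actions = _")
proof
  assume "htil a (map fst k) = k"
  then have "map snd (htil a (map fst k)) = map snd k"
    by simp
  then show "?actions = map snd k"
    by (simp add: htil_def o_def)
next
  assume "?actions = map snd k"
  moreover have "htil a (map fst k) = zip (map fst k) ?actions"
    by (rule nth_equalityI) (simp_all add: htil_def)
  ultimately show "htil a (map fst k) = k"
    by (simp only: zip_map_fst_snd)
qed

lemma htil_in_histories:
  assumes "\<And>h. h \<noteq> [] \<Longrightarrow> a h \<in> A"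
  shows "htil a h \<in> histories A (length h)"
  by (auto simp: htil_def histories_def intro!: assms)

lemma htil_agree:
  assumes "\<And>h. h \<noteq> [] \<Longrightarrow> hd h = s \<Longrightarrow> a h = a' h" and "hd h = s"
  shows "htil a h = htil a' h"
proof -
  have "a (take (Suc k) h) = a' (take (Suc k) h)" if "k < length h" for k
    using assms that by (cases h) auto
  then show ?thesis
    by (simp add: htil_def)
qed

definition follows :: "('s list \<Rightarrow> 'a) \<Rightarrow> ('s \<times> 'a) list \<Rightarrow> real" where
  "follows a k = of_bool (htil a (map fst k) = k)"

lemma follows_Nil [simp]: "follows a [] = 1"
  by (simp add: follows_def)

lemma follows_snoc: "follows a (k @ [(s, b)]) = of_bool (a (map fst k @ [s]) = b) * follows a k"
  by (auto simp: follows_def htil_snoc)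

lemma follows_nonneg [simp]: "0 \<le> follows a k"
  by (simp add: follows_def)

lemma follows_le_1 [simp]: "follows a k \<le> 1"
  by (simp add: follows_def)

lemma sum_follows_snoc:
  assumes "finite A" "a (map fst k @ [s]) \<in> A"
  shows "(\<Sum>b\<in>A. follows a (k @ [(s, b)])) = follows a k"
  using assms by (simp add: follows_snoc of_bool_def sum.delta' flip: sum_distrib_right)

definition state_after :: "('x \<Rightarrow> 'a \<Rightarrow> 's \<Rightarrow> 'x) \<Rightarrow> 'x \<Rightarrow> ('s \<times> 'a) list \<Rightarrow> 'x" where
  "state_after \<zeta> = foldl (\<lambda>x (s, b). \<zeta> x b s)"

lemma state_after_Nil [simp]: "state_after \<zeta> x [] = x"
  by (simp add: state_after_def)

lemma state_after_Cons [simp]: "state_after \<zeta> x ((s, b) # k) = state_after \<zeta> (\<zeta> x b s) k"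
  by (simp add: state_after_def)

lemma state_after_snoc [simp]: "state_after \<zeta> x (k @ [(s, b)]) = \<zeta> (state_after \<zeta> x k) b s"
  by (simp add: state_after_def)

lemma xpath_snoc: "xpath \<zeta> x a (h @ [s]) = state_after \<zeta> x (htil a h)"
proof -
  have "xit \<zeta> x a (h @ e) (length h) = state_after \<zeta> x (htil a h)" for e
  proof (induction h arbitrary: e rule: rev_induct)
    case (snoc s h)
    show ?case
      using snoc[of "s # e"] by (simp add: htil_snoc nth_append)
  qed simp
  then show ?thesis
    by (simp add: xpath_def)
qed

definition payoff_at ::
  "('x \<Rightarrow> 'a \<Rightarrow> 's \<Rightarrow> real) \<Rightarrow> ('x \<Rightarrow> 'a \<Rightarrow> 's \<Rightarrow> 'x) \<Rightarrow> 'x \<Rightarrow> ('s \<times> 'a) list \<Rightarrow> real" where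
  "payoff_at f \<zeta> x k = f (state_after \<zeta> x (butlast k)) (snd (last k)) (fst (last k))"

lemma flow_eq_payoff_at: "h \<noteq> [] \<Longrightarrow> flow f \<zeta> x a h = payoff_at f \<zeta> x (htil a h)"
  by (cases h rule: rev_cases) (simp_all add: flow_def payoff_at_def xpath_snoc htil_snoc)

lemma Ainf_iff:
  "a \<in> Ainf A p \<zeta> x \<longleftrightarrow> a [] = undefined \<and> (\<forall>h s. a (h @ [s]) \<in> Atil A p (state_after \<zeta> x (htil a h)) s)"
proof -
  have "a \<in> Ainf A p \<zeta> x
      \<longleftrightarrow> a [] = undefined \<and> (\<forall>h. h \<noteq> [] \<longrightarrow> a h \<in> Atil A p (xpath \<zeta> x a h) (last h))"
    by (auto simp: Ainf_def Hist_def PiE_def Pi_def extensional_def Atil_def)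
  also have "(\<forall>h. h \<noteq> [] \<longrightarrow> a h \<in> Atil A p (xpath \<zeta> x a h) (last h))
      \<longleftrightarrow> (\<forall>h s. a (h @ [s]) \<in> Atil A p (state_after \<zeta> x (htil a h)) s)"
    by (metis append_is_Nil_conv last_snoc not_Cons_self2 rev_exhaust xpath_snoc)
  finally show ?thesis .
qed

lemma AtilD: "b \<in> Atil A p x s \<Longrightarrow> b \<in> A"
  by (simp add: Atil_def)

lemma plan_in_A: "a \<in> Ainf A p \<zeta> x \<Longrightarrow> h \<noteq> [] \<Longrightarrow> a h \<in> A"
  by (auto simp: Ainf_def Hist_def)

lemma plan_first_action: "a \<in> Ainf A p \<zeta> x \<Longrightarrow> a [s] \<in> Atil A p x s"
  unfolding Ainf_iff by (metis append_Nil htil_Nil state_after_Nil)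

definition continuation_plan :: "('s list \<Rightarrow> 'a) \<Rightarrow> 's \<Rightarrow> 's list \<Rightarrow> 'a" where
  "continuation_plan a s = (\<lambda>h. if h = [] then undefined else a (s # h))"

definition cons_plan :: "('s \<Rightarrow> 'a) \<Rightarrow> ('s \<Rightarrow> 's list \<Rightarrow> 'a) \<Rightarrow> 's list \<Rightarrow> 'a" where
  "cons_plan b c = (\<lambda>h. if h = [] then undefined else if tl h = [] then b (hd h) else c (hd h) (tl h))"

definition splice_plans :: "('s \<Rightarrow> 's list \<Rightarrow> 'a) \<Rightarrow> 's list \<Rightarrow> 'a" where
  "splice_plans c = (\<lambda>h. if h = [] then undefined else c (hd h) h)"

lemma htil_Cons: "htil a (s # h) = (s, a [s]) # htil (continuation_plan a s) h"
proof (induction h rule: rev_induct)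
  case (snoc s' h)
  then show ?case
    using htil_snoc[of a "s # h" s'] by (simp add: htil_snoc continuation_plan_def)
qed (simp add: htil_def)

lemma flow_Cons: "h \<noteq> [] \<Longrightarrow> flow f \<zeta> x a (s # h) = flow f \<zeta> (\<zeta> x (a [s]) s) (continuation_plan a s) h"
  by (simp add: flow_eq_payoff_at htil_Cons payoff_at_def)
    (metis htil_Nil length_0_conv length_htil)

lemma flow_single [simp]: "flow f \<zeta> x a [s] = f x (a [s]) s"
  by (simp add: flow_def xpath_def)

lemma continuation_plan_Ainf:
  fixes a :: "'s list \<Rightarrow> 'a"
  assumes "a \<in> Ainf A p \<zeta> x"
  shows "continuation_plan a s \<in> Ainf A p \<zeta> (\<zeta> x (a [s]) s)"
  unfolding Ainf_iff
proof (intro conjI allI)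
  fix h :: "'s list" and s'
  have "a (s # h @ [s']) \<in> Atil A p (state_after \<zeta> x (htil a (s # h))) s'"
    using assms unfolding Ainf_iff by (metis append_Cons)
  then show "continuation_plan a s (h @ [s'])
      \<in> Atil A p (state_after \<zeta> (\<zeta> x (a [s]) s) (htil (continuation_plan a s) h)) s'"
    by (simp add: htil_Cons continuation_plan_def)
qed (simp add: continuation_plan_def)

lemma cons_plan_single [simp]: "cons_plan b c [s] = b s"
  by (simp add: cons_plan_def)

lemma continuation_cons_plan:
  "c s [] = undefined \<Longrightarrow> continuation_plan (cons_plan b c) s = c s"
  by (auto simp: continuation_plan_def cons_plan_def)

lemma cons_plan_Ainf:
  fixes c :: "'s \<Rightarrow> 's list \<Rightarrow> 'a"
  assumes "\<And>s. b s \<in> Atil A p x s" "\<And>s. c s \<in> Ainf A p \<zeta> (\<zeta> x (b s) s)"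
  shows "cons_plan b c \<in> Ainf A p \<zeta> x"
  unfolding Ainf_iff
proof (intro conjI allI)
  fix h :: "'s list" and s'
  have continuation: "continuation_plan (cons_plan b c) s = c s" for s
    using assms(2) by (intro continuation_cons_plan) (simp add: Ainf_iff)
  show "cons_plan b c (h @ [s']) \<in> Atil A p (state_after \<zeta> x (htil (cons_plan b c) h)) s'"
  proof (cases h)
    case Nil
    then show ?thesis
      using assms(1) by simp
  next
    case (Cons s h')
    have "c s (h' @ [s']) \<in> Atil A p (state_after \<zeta> (\<zeta> x (b s) s) (htil (c s) h')) s'"
      using assms(2) by (simp add: Ainf_iff)
    then show ?thesis
      by (simp add: Cons htil_Cons continuation) (simp add: cons_plan_def)
  qed
qed (simp add: cons_plan_def)

lemma splice_plans_Ainf: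
  fixes c :: "'s \<Rightarrow> 's list \<Rightarrow> 'a"
  assumes "\<And>s. c s \<in> Ainf A p \<zeta> x"
  shows "splice_plans c \<in> Ainf A p \<zeta> x"
  unfolding Ainf_iff
proof (intro conjI allI)
  fix h :: "'s list" and s'
  let ?s = "hd (h @ [s'])"
  have "htil (splice_plans c) h = htil (c ?s) h"
    by (cases "h = []") (auto intro!: htil_agree[where s = ?s] simp: splice_plans_def)
  moreover have "c ?s (h @ [s']) \<in> Atil A p (state_after \<zeta> x (htil (c ?s) h)) s'"
    using assms[of ?s] by (simp add: Ainf_iff)
  ultimately show "splice_plans c (h @ [s']) \<in> Atil A p (state_after \<zeta> x (htil (splice_plans c) h)) s'"
    by (simp add: splice_plans_def)
qed (simp add: splice_plans_def)

lemma cont_agree: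
  assumes "\<And>h. h \<noteq> [] \<Longrightarrow> hd h = s \<Longrightarrow> a h = a' h" and "h \<noteq> []" "hd h = s"
  shows "cont \<beta> \<pi> \<zeta> x a f h = cont \<beta> \<pi> \<zeta> x a' f h"
proof -
  have "flow f \<zeta> x a (h @ e) = flow f \<zeta> x a' (h @ e)" for e
    using htil_agree[of s a a' "h @ e", OF assms(1)] assms(2,3) by (simp add: flow_eq_payoff_at)
  then show ?thesis
    unfolding cont_def by (simp cong: condE_cong)
qed

lemma Ltil_agree:
  assumes plans_agree: "\<And>h. h \<noteq> [] \<Longrightarrow> hd h = s \<Longrightarrow> a h = a' h"
    and multipliers_agree: "\<And>k. k \<noteq> [] \<Longrightarrow> fst (hd k) = s \<Longrightarrow> lam k = lam' k"
  shows "Ltil \<beta> \<pi> \<zeta> r g gbar a lam \<gamma> x s = Ltil \<beta> \<pi> \<zeta> r g gbar a' lam' \<gamma> x s"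
proof -
  have htil_eq: "htil a ([s] @ e) = htil a' ([s] @ e)" for e
    by (rule htil_agree[where s = s, OF plans_agree]) auto
  have flow_eq: "flow f \<zeta> x a ([s] @ e) = flow f \<zeta> x a' ([s] @ e)" for f e
    using htil_eq[of e] by (simp add: flow_eq_payoff_at)
  have cont_eq: "cont \<beta> \<pi> \<zeta> x a f ([s] @ e) = cont \<beta> \<pi> \<zeta> x a' f ([s] @ e)" for f e
    by (rule cont_agree[where s = s, OF plans_agree]) auto
  have lam_eq: "lam (htil a' ([s] @ e)) = lam' (htil a' ([s] @ e))" for e
    by (rule multipliers_agree) (auto simp: htil_Cons)
  show ?thesis
    unfolding Ltil_def
    by (intro suminf_cong arg_cong2[where f = "(*)"] refl condE_cong)
      (simp only: flow_eq cont_eq htil_eq lam_eq)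
qed

fun admissible ::
  "'a set \<Rightarrow> ('x \<Rightarrow> 'a \<Rightarrow> 's \<Rightarrow> real) \<Rightarrow> ('x \<Rightarrow> 'a \<Rightarrow> 's \<Rightarrow> 'x) \<Rightarrow> 'x \<Rightarrow> ('s \<times> 'a) list \<Rightarrow> bool" where
  "admissible A p \<zeta> x [] = True"
| "admissible A p \<zeta> x ((s, b) # k) = (b \<in> Atil A p x s \<and> admissible A p \<zeta> (\<zeta> x b s) k)"

lemma admissible_snoc:
  "admissible A p \<zeta> x (k @ [(s, b)]) \<longleftrightarrow> admissible A p \<zeta> x k \<and> b \<in> Atil A p (state_after \<zeta> x k) s"
  by (induction k arbitrary: x) auto

lemma admissible_in_histories: "admissible A p \<zeta> x k \<Longrightarrow> k \<in> histories A (length k)"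
  by (induction k arbitrary: x) (auto dest: AtilD)

lemma admissible_htil: "a \<in> Ainf A p \<zeta> x \<Longrightarrow> admissible A p \<zeta> x (htil a h)"
  by (induction h rule: rev_induct) (simp_all add: htil_snoc admissible_snoc Ainf_iff)

section \<open>Sums over the history tree\<close>

locale finite_action_chain = positive_chain \<pi> for \<pi> :: "'s::finite \<Rightarrow> 's \<Rightarrow> real" +
  fixes A :: "'a set"
  assumes A_fin: "finite A"
begin

definition descendant_sum :: "('s \<times> 'a) list \<Rightarrow> nat \<Rightarrow> (('s \<times> 'a) list \<Rightarrow> real) \<Rightarrow> real" where
  "descendant_sum k n \<psi> =
     (\<Sum>e\<in>histories A n. pathprob \<pi> (map fst (k @ e)) / pathprob \<pi> (map fst k) * \<psi> (k @ e))"

lemma descendant_sum_0 [simp]: "descendant_sum k 0 \<psi> = \<psi> k"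
  using pathprob_pos[of "map fst k"] by (simp add: descendant_sum_def)

lemma descendant_sum_Suc:
  assumes "k \<noteq> []"
  shows "descendant_sum k (Suc n) \<psi>
    = expect (fst (last k)) (\<lambda>s. \<Sum>b\<in>A. descendant_sum (k @ [(s, b)]) n \<psi>)"
proof -
  have ratio: "pathprob \<pi> (map fst (k @ (s, b) # e)) / pathprob \<pi> (map fst k) = \<pi> (fst (last k)) s *
      (pathprob \<pi> (map fst ((k @ [(s, b)]) @ e)) / pathprob \<pi> (map fst (k @ [(s, b)])))" for s b e
    using pathprob_append_ratio[of "map fst k" s "map fst e"] assms by (simp add: last_map)
  show ?thesis
    unfolding descendant_sum_def sum_histories_Suc[OF A_fin] ratio sum_distrib_left
    by (simp add: mult.assoc)
qed

lemma descendant_sum_Cons: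
  assumes "k \<noteq> []"
  shows "descendant_sum ((s, b) # k) n \<psi> = descendant_sum k n (\<lambda>k'. \<psi> ((s, b) # k'))"
  using pi_pos[of s "hd (map fst k)"] assms by (simp add: descendant_sum_def pathprob_Cons)

lemma descendant_sum_cong:
  "(\<And>e. e \<in> histories A n \<Longrightarrow> \<psi> (k @ e) = \<psi>' (k @ e)) \<Longrightarrow> descendant_sum k n \<psi> = descendant_sum k n \<psi>'"
  unfolding descendant_sum_def by (intro sum.cong) auto

lemma descendant_sum_mono:
  "(\<And>e. e \<in> histories A n \<Longrightarrow> \<psi> (k @ e) \<le> \<psi>' (k @ e)) \<Longrightarrow> descendant_sum k n \<psi> \<le> descendant_sum k n \<psi>'"
  unfolding descendant_sum_def using pathprob_pos
  by (intro sum_mono mult_left_mono) (auto simp: less_imp_le)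

lemma descendant_sum_add:
  "descendant_sum k n (\<lambda>k'. \<psi> k' + \<psi>' k') = descendant_sum k n \<psi> + descendant_sum k n \<psi>'"
  by (simp add: descendant_sum_def distrib_left sum.distrib)

lemma descendant_sum_cmult: "descendant_sum k n (\<lambda>k'. c * \<psi> k') = c * descendant_sum k n \<psi>"
  by (simp add: descendant_sum_def sum_distrib_left mult.left_commute)

lemma descendant_sum_abs_le:
  assumes "\<And>e. e \<in> histories A n \<Longrightarrow> \<bar>\<psi> (k @ e)\<bar> \<le> \<psi>' (k @ e)"
  shows "\<bar>descendant_sum k n \<psi>\<bar> \<le> descendant_sum k n \<psi>'"
proof -
  have "descendant_sum k n (\<lambda>k'. - 1 * \<psi>' k') \<le> descendant_sum k n \<psi>"
    "descendant_sum k n \<psi> \<le> descendant_sum k n \<psi>'"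
    using assms by (intro descendant_sum_mono; force simp: abs_le_iff)+
  then show ?thesis
    unfolding descendant_sum_cmult by (simp add: abs_le_iff)
qed

lemma descendant_sum_follows:
  assumes "\<And>h. h \<noteq> [] \<Longrightarrow> a h \<in> A" "k \<noteq> []"
  shows "descendant_sum k n (\<lambda>k'. follows a k' * \<psi> k')
      = follows a k * condE \<pi> (map fst k) n (\<lambda>h. \<psi> (htil a h))"
  using assms(2)
proof (induction n arbitrary: k)
  case 0
  then show ?case
    by (simp add: follows_def)
next
  case (Suc n)
  let ?E = "\<lambda>h. condE \<pi> h n (\<lambda>h'. \<psi> (htil a h'))"
  have "(\<Sum>b\<in>A. descendant_sum (k @ [(s, b)]) n (\<lambda>k'. follows a k' * \<psi> k'))
      = follows a k * ?E (map fst k @ [s])" for s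
    using Suc.IH sum_follows_snoc[OF A_fin, of a k s] assms(1) by (simp flip: sum_distrib_right)
  then have "descendant_sum k (Suc n) (\<lambda>k'. follows a k' * \<psi> k')
      = expect (fst (last k)) (\<lambda>s. follows a k * ?E (map fst k @ [s]))"
    by (simp add: descendant_sum_Suc[OF Suc.prems])
  also have "\<dots> = follows a k * condE \<pi> (map fst k) (Suc n) (\<lambda>h. \<psi> (htil a h))"
    using Suc.prems by (simp add: condE_Suc last_map sum_distrib_left mult.left_commute)
  finally show ?case .
qed

lemma
  assumes "\<And>e. e \<in> histories A n \<Longrightarrow> integrable M (\<lambda>z. F z (k @ e))"
  shows integrable_descendant_sum: "integrable M (\<lambda>z. descendant_sum k n (F z))"
    and integral_descendant_sum: "(\<integral>z. descendant_sum k n (F z) \<partial>M)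
        = descendant_sum k n (\<lambda>k'. \<integral>z. F z k' \<partial>M)"
  unfolding descendant_sum_def using assms by (simp_all add: Bochner_Integration.integral_sum)

definition history_sum :: "'s \<Rightarrow> nat \<Rightarrow> (('s \<times> 'a) list \<Rightarrow> real) \<Rightarrow> real" where
  "history_sum s n \<psi> = (\<Sum>b\<in>A. descendant_sum [(s, b)] n \<psi>)"

lemma history_sum_0: "history_sum s 0 \<psi> = (\<Sum>b\<in>A. \<psi> [(s, b)])"
  by (simp add: history_sum_def)

lemma history_sum_Suc:
  "history_sum s (Suc n) \<psi> = (\<Sum>b\<in>A. expect s (\<lambda>s'. history_sum s' n (\<lambda>k. \<psi> ((s, b) # k))))"
  by (simp add: history_sum_def descendant_sum_Suc descendant_sum_Cons)

lemma history_sum_cong: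
  assumes "\<And>k. k \<in> Htil A n \<Longrightarrow> fst (hd k) = s \<Longrightarrow> \<psi> k = \<psi>' k"
  shows "history_sum s n \<psi> = history_sum s n \<psi>'"
  unfolding history_sum_def using assms
  by (intro sum.cong refl descendant_sum_cong) (simp add: Htil_eq_histories)

lemma history_sum_mono:
  assumes "\<And>k. k \<in> Htil A n \<Longrightarrow> \<psi> k \<le> \<psi>' k"
  shows "history_sum s n \<psi> \<le> history_sum s n \<psi>'"
  unfolding history_sum_def using assms
  by (intro sum_mono descendant_sum_mono) (simp add: Htil_eq_histories)

lemma history_sum_nonneg:
  assumes "\<And>k. k \<in> Htil A n \<Longrightarrow> 0 \<le> \<psi> k"
  shows "0 \<le> history_sum s n \<psi>"
  using history_sum_mono[of n "\<lambda>_. 0 * 0" \<psi> s] assms unfolding history_sum_def descendant_sum_cmult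
  by simp

lemma history_sum_add: "history_sum s n (\<lambda>k. \<psi> k + \<psi>' k) = history_sum s n \<psi> + history_sum s n \<psi>'"
  by (simp add: history_sum_def descendant_sum_add sum.distrib)

lemma history_sum_cmult: "history_sum s n (\<lambda>k. c * \<psi> k) = c * history_sum s n \<psi>"
  by (simp add: history_sum_def descendant_sum_cmult sum_distrib_left)

lemma history_sum_follows:
  assumes "\<And>h. h \<noteq> [] \<Longrightarrow> a h \<in> A"
  shows "history_sum s n (\<lambda>k. follows a k * \<psi> k) = condE \<pi> [s] n (\<lambda>h. \<psi> (htil a h))"
  unfolding history_sum_def using assms sum_follows_snoc[OF A_fin, of a "[]" s]
  by (simp add: descendant_sum_follows flip: sum_distrib_right)

lemma
  assumes "\<And>k. k \<in> Htil A n \<Longrightarrow> integrable M (\<lambda>z. F z k)"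
  shows integrable_history_sum: "integrable M (\<lambda>z. history_sum s n (F z))"
    and integral_history_sum: "(\<integral>z. history_sum s n (F z) \<partial>M) = history_sum s n (\<lambda>k. \<integral>z. F z k \<partial>M)"
proof -
  have "integrable M (\<lambda>z. F z ([(s, b)] @ e))" if "b \<in> A" "e \<in> histories A n" for b e
    using assms that by (simp add: Htil_eq_histories)
  then show "integrable M (\<lambda>z. history_sum s n (F z))"
    and "(\<integral>z. history_sum s n (F z) \<partial>M) = history_sum s n (\<lambda>k. \<integral>z. F z k \<partial>M)"
    unfolding history_sum_def
    by (simp_all add: integrable_descendant_sum integral_descendant_sum Bochner_Integration.integral_sum)
qed

lemma sum_Htil_eq_history_sum:
  "(\<Sum>k\<in>Htil A t. \<psi> k * pathprob \<pi> (map fst k)) = (\<Sum>s\<in>UNIV. history_sum s t \<psi>)"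
  unfolding Htil_eq_histories sum_histories_Suc[OF A_fin] history_sum_def descendant_sum_def
  by (simp add: mult.commute)

end

section \<open>Discounted payoffs of a plan\<close>

definition bounded_payoff :: "'x set \<Rightarrow> 'a set \<Rightarrow> ('x \<Rightarrow> 'a \<Rightarrow> 's \<Rightarrow> real) \<Rightarrow> bool" where
  "bounded_payoff X A f \<longleftrightarrow> (\<exists>B. \<forall>x\<in>X. \<forall>a\<in>A. \<forall>s. \<bar>f x a s\<bar> \<le> B)"

lemma abs_le_supnorm:
  assumes "bounded_payoff X A f" "x \<in> X" "b \<in> A"
  shows "\<bar>f x b s\<bar> \<le> supnorm X A f"
proof -
  obtain B where "\<forall>x\<in>X. \<forall>a\<in>A. \<forall>s. \<bar>f x a s\<bar> \<le> B"
    using assms(1) by (auto simp: bounded_payoff_def)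
  then have "bdd_above ((\<lambda>(x, a, s). \<bar>f x a s\<bar>) ` (X \<times> A \<times> UNIV))"
    by (intro bdd_aboveI[of _ B]) auto
  then show ?thesis
    unfolding supnorm_def using assms(2,3) by (intro cSUP_upper2[where x = "(x, b, s)"]) auto
qed

lemma bounded_payoff_lincomb:
  assumes "bounded_payoff X A f" "\<And>i. bounded_payoff X A (g i)"
  shows "bounded_payoff X A (\<lambda>x b s. f x b s + (\<Sum>i\<in>I. c i * g i x b s))"
  unfolding bounded_payoff_def
proof (intro exI ballI allI)
  fix x b s assume "x \<in> X" "b \<in> A"
  then have "\<bar>\<Sum>i\<in>I. c i * g i x b s\<bar> \<le> (\<Sum>i\<in>I. \<bar>c i\<bar> * supnorm X A (g i))"
    using abs_le_supnorm[OF assms(2)]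
    by (intro order_trans[OF sum_abs] sum_mono) (simp add: abs_mult mult_left_mono)
  then show "\<bar>f x b s + (\<Sum>i\<in>I. c i * g i x b s)\<bar> \<le> supnorm X A f + (\<Sum>i\<in>I. \<bar>c i\<bar> * supnorm X A (g i))"
    using abs_le_supnorm[OF assms(1) \<open>x \<in> X\<close> \<open>b \<in> A\<close>, of s] by linarith
qed

locale dynamics = finite_action_chain \<pi> A for \<pi> :: "'s::finite \<Rightarrow> 's \<Rightarrow> real" and A :: "'a set" +
  fixes X :: "'x set"
    and \<zeta> :: "'x \<Rightarrow> 'a \<Rightarrow> 's \<Rightarrow> 'x"
    and p :: "'x \<Rightarrow> 'a \<Rightarrow> 's \<Rightarrow> real"
    and \<beta> :: real
  assumes zeta_X: "\<And>x a s. x \<in> X \<Longrightarrow> a \<in> A \<Longrightarrow> \<zeta> x a s \<in> X"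
    and beta: "0 < \<beta>" "\<beta> < 1"
begin

abbreviation "plans x \<equiv> Ainf A p \<zeta> x"
abbreviation "cont_value x a f h \<equiv> cont \<beta> \<pi> \<zeta> x a f h"

lemma state_after_X: "x \<in> X \<Longrightarrow> k \<in> histories A n \<Longrightarrow> state_after \<zeta> x k \<in> X"
proof (induction k arbitrary: x n)
  case (Cons sb k)
  then show ?case
    by (cases n; cases sb) (auto intro: zeta_X simp: histories_def)
qed simp

lemma abs_payoff_at_le:
  assumes "bounded_payoff X A f" "x \<in> X" "k \<in> Htil A t"
  shows "\<bar>payoff_at f \<zeta> x k\<bar> \<le> supnorm X A f"
proof -
  obtain k' s b where "k = k' @ [(s, b)]" "k' \<in> histories A t" "b \<in> A"
    using assms(3) Htil_nonempty[OF assms(3)] by (cases k rule: rev_cases) (auto simp: Htil_eq_histories)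
  then show ?thesis
    using abs_le_supnorm[OF assms(1) state_after_X[OF assms(2)]] by (simp add: payoff_at_def)
qed

lemma htil_in_Htil:
  assumes "a \<in> plans x"
  shows "htil a (s # h) \<in> Htil A (length h)"
  using htil_in_histories[of a A "s # h"] plan_in_A[OF assms] by (simp add: Htil_eq_histories)

lemma abs_condE_flow_le:
  assumes "bounded_payoff X A f" "x \<in> X" "a \<in> plans x" "h \<noteq> []"
  shows "\<bar>condE \<pi> h n (flow f \<zeta> x a)\<bar> \<le> supnorm X A f"
proof -
  have "\<bar>flow f \<zeta> x a (h @ e)\<bar> \<le> supnorm X A f" for e
    using abs_payoff_at_le[OF assms(1,2) htil_in_Htil[OF assms(3)]] assms(4)
    by (cases h) (simp_all add: flow_eq_payoff_at)
  then have "\<bar>condE \<pi> h n (flow f \<zeta> x a)\<bar> \<le> condE \<pi> h n (\<lambda>_. supnorm X A f)"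
    by (intro condE_abs_le)
  then show ?thesis
    by (simp add: condE_const[OF assms(4)])
qed

lemma cont_sums:
  assumes "bounded_payoff X A f" "x \<in> X" "a \<in> plans x" "h \<noteq> []"
  shows "(\<lambda>n. \<beta> ^ n * condE \<pi> h n (flow f \<zeta> x a)) sums cont_value x a f h"
  unfolding cont_def
  by (rule summable_sums[OF discounted_abs_le(1)[OF _ _ abs_condE_flow_le[OF assms]]]) (use beta in auto)

lemma abs_cont_le:
  assumes "bounded_payoff X A f" "x \<in> X" "a \<in> plans x" "h \<noteq> []"
  shows "\<bar>cont_value x a f h\<bar> \<le> supnorm X A f / (1 - \<beta>)"
  unfolding cont_def using beta by (intro discounted_abs_le(2) abs_condE_flow_le[OF assms]) auto

lemma cont_lincomb:
  assumes "bounded_payoff X A f" "\<And>i. bounded_payoff X A (g i)" "x \<in> X" "a \<in> plans x" "h \<noteq> []"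
  shows "cont_value x a (\<lambda>x b s. f x b s + (\<Sum>i\<in>I. c i * g i x b s)) h
    = cont_value x a f h + (\<Sum>i\<in>I. c i * cont_value x a (g i) h)"
proof -
  let ?F = "\<lambda>x b s. f x b s + (\<Sum>i\<in>I. c i * g i x b s)"
  have "flow ?F \<zeta> x a = (\<lambda>h. flow f \<zeta> x a h + (\<Sum>i\<in>I. c i * flow (g i) \<zeta> x a h))"
    by (simp add: flow_def fun_eq_iff)
  then have "\<beta> ^ n * condE \<pi> h n (flow ?F \<zeta> x a) = \<beta> ^ n * condE \<pi> h n (flow f \<zeta> x a)
      + (\<Sum>i\<in>I. c i * (\<beta> ^ n * condE \<pi> h n (flow (g i) \<zeta> x a)))" for n
    by (simp add: condE_add condE_sum condE_cmult distrib_left sum_distrib_left mult.left_commute)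
  moreover have "(\<lambda>n. \<beta> ^ n * condE \<pi> h n (flow f \<zeta> x a)
        + (\<Sum>i\<in>I. c i * (\<beta> ^ n * condE \<pi> h n (flow (g i) \<zeta> x a))))
      sums (cont_value x a f h + (\<Sum>i\<in>I. c i * cont_value x a (g i) h))"
    using assms by (intro sums_add sums_sum sums_mult cont_sums)
  ultimately show ?thesis
    unfolding cont_def[of \<beta> \<pi> \<zeta> x a ?F] by (simp add: sums_iff)
qed

lemma cont_Cons:
  assumes "h \<noteq> []"
  shows "cont_value x a f (s # h) = cont_value (\<zeta> x (a [s]) s) (continuation_plan a s) f h"
proof -
  have "condE \<pi> (s # h) n (flow f \<zeta> x a)
      = condE \<pi> h n (flow f \<zeta> (\<zeta> x (a [s]) s) (continuation_plan a s))" for n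
    unfolding condE_Cons[OF assms] using assms by (intro condE_cong flow_Cons) simp
  then show ?thesis
    by (simp add: cont_def)
qed

lemma plan_step:
  assumes "x \<in> X" "a \<in> plans x"
  shows "a [s] \<in> A" and "\<zeta> x (a [s]) s \<in> X" and "continuation_plan a s \<in> plans (\<zeta> x (a [s]) s)"
  using assms plan_in_A[OF assms(2), of "[s]"] by (auto intro: zeta_X continuation_plan_Ainf)

lemma sum_follows_first_action:
  assumes "a \<in> plans x"
  shows "(\<Sum>b\<in>A. follows a [(s, b)] * y) = y"
  using sum_follows_snoc[OF A_fin, of a "[]" s] plan_in_A[OF assms] by (simp flip: sum_distrib_right)

lemma condE_flow_Suc:
  "condE \<pi> [s] (Suc n) (flow f \<zeta> x a)
    = expect s (\<lambda>s'. condE \<pi> [s'] n (flow f \<zeta> (\<zeta> x (a [s]) s) (continuation_plan a s)))"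
  unfolding condE_single_Suc
  by (intro sum.cong refl arg_cong2[where f = "(*)"] condE_cong flow_Cons) simp

lemma cont_single:
  assumes f_bounded: "bounded_payoff X A f" and x_in_X: "x \<in> X" and a_plan: "a \<in> plans x"
  shows "cont_value x a f [s] = f x (a [s]) s
    + \<beta> * expect s (\<lambda>s'. cont_value (\<zeta> x (a [s]) s) (continuation_plan a s) f [s'])"
proof -
  have "(\<lambda>n. \<beta> ^ n * condE \<pi> [s] n (flow f \<zeta> x a))
      sums (condE \<pi> [s] 0 (flow f \<zeta> x a)
        + \<beta> * expect s (\<lambda>s'. cont_value (\<zeta> x (a [s]) s) (continuation_plan a s) f [s']))"
    by (rule sums_discounted_Suc, rule condE_flow_Suc)
      (rule cont_sums[OF f_bounded plan_step(2,3)[OF x_in_X a_plan]], simp)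
  then show ?thesis
    using cont_sums[OF f_bounded x_in_X a_plan, of "[s]"] by (simp add: sums_iff)
qed

section \<open>Realization weights of lotteries\<close>

text \<open>Families of probabilities \<open>m k\<close> that a lottery plays the actions of \<open>k\<close> along the shocks of \<open>k\<close>.\<close>

definition realization_weights :: "'x \<Rightarrow> (('s \<times> 'a) list \<Rightarrow> real) set" where
  "realization_weights x = {m. (\<forall>k. 0 \<le> m k) \<and> m [] = 1 \<and> (\<forall>k s. (\<Sum>b\<in>A. m (k @ [(s, b)])) = m k) \<and>
     (\<forall>k. \<not> admissible A p \<zeta> x k \<longrightarrow> m k = 0)}"

lemma
  assumes "m \<in> realization_weights x"
  shows realization_weights_nonneg: "0 \<le> m k"
    and realization_weights_Nil: "m [] = 1"
    and realization_weights_sum_snoc: "(\<Sum>b\<in>A. m (k @ [(s, b)])) = m k"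
    and realization_weights_inadmissible: "\<not> admissible A p \<zeta> x k \<Longrightarrow> m k = 0"
  using assms by (auto simp: realization_weights_def)

lemma realization_weights_snoc_eq_0:
  "m \<in> realization_weights x \<Longrightarrow> b \<notin> A \<Longrightarrow> m (k @ [(s, b)]) = 0"
  by (rule realization_weights_inadmissible) (auto simp: admissible_snoc dest: AtilD)

lemma realization_weights_snoc_le:
  assumes m_weights: "m \<in> realization_weights x"
  shows "m (k @ [(s, b)]) \<le> m k"
proof (cases "b \<in> A")
  case True
  then show ?thesis
    using member_le_sum[of b A "\<lambda>b. m (k @ [(s, b)])"] A_fin realization_weights_nonneg[OF m_weights]
    by (simp add: realization_weights_sum_snoc[OF m_weights])
qed (simp add: realization_weights_snoc_eq_0[OF m_weights] realization_weights_nonneg[OF m_weights])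

lemma realization_weights_le_1:
  assumes m_weights: "m \<in> realization_weights x"
  shows "m k \<le> 1"
proof (induction k rule: rev_induct)
  case (snoc sb k)
  then show ?case
    using realization_weights_snoc_le[OF m_weights, of k "fst sb" "snd sb"] by simp
qed (simp add: realization_weights_Nil[OF m_weights])

lemma closed_realization_weights: "closed (realization_weights x)"
proof -
  have "closed {m :: ('s \<times> 'a) list \<Rightarrow> real. \<not> admissible A p \<zeta> x k \<longrightarrow> m k = 0}" for k
    by (cases "admissible A p \<zeta> x k") (auto intro!: closed_Collect_eq continuous_intros)
  then show ?thesis
    unfolding realization_weights_def
    by (intro closed_Collect_conj closed_Collect_all closed_Collect_le closed_Collect_eq
          continuous_intros) auto
qed

lemma compact_realization_weights: "compact (realization_weights x)"
proof -
  have "compactin (product_topology (\<lambda>_. euclidean) UNIV) (PiE UNIV (\<lambda>_::('s \<times> 'a) list. {0..1::real}))"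
    unfolding compactin_PiE by auto
  then have "compact (PiE UNIV (\<lambda>_::('s \<times> 'a) list. {0..1::real}))"
    by (simp add: euclidean_product_topology)
  moreover have "realization_weights x \<subseteq> PiE UNIV (\<lambda>_. {0..1})"
    using realization_weights_nonneg realization_weights_le_1 by auto
  ultimately show ?thesis
    using compact_Int_closed[OF _ closed_realization_weights[of x]] by (metis inf.absorb_iff2)
qed

lemma realization_weights_convex_combination:
  assumes "m \<in> realization_weights x" "m' \<in> realization_weights x" "0 \<le> u" "u \<le> 1"
  shows "(\<lambda>k. (1 - u) * m k + u * m' k) \<in> realization_weights x"
  using assms unfolding realization_weights_def by (auto simp: sum.distrib simp flip: sum_distrib_left)

lemma concavelike_on_realization_weights:
  assumes "\<And>f m m' u. f \<in> F \<Longrightarrow> m \<in> realization_weights x \<Longrightarrow> m' \<in> realization_weights x \<Longrightarrow>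
    f (\<lambda>k. (1 - u) * m k + u * m' k) = (1 - u) * f m + u * f m'"
  shows "concavelike_on (realization_weights x) F"
  unfolding concavelike_on_def
proof (intro ballI)
  fix m m' and u :: real
  assume "m \<in> realization_weights x" "m' \<in> realization_weights x" "u \<in> {0..1}"
  then show "\<exists>z\<in>realization_weights x. \<forall>f\<in>F. (1 - u) * f m + u * f m' \<le> f z"
    using assms by (intro bexI[OF _ realization_weights_convex_combination[of m x m' u]]) auto
qed

lemma follows_realization_weights:
  assumes "a \<in> plans x"
  shows "follows a \<in> realization_weights x"
proof -
  have "follows a k = 0" if "\<not> admissible A p \<zeta> x k" for k
    using that admissible_htil[OF assms, of "map fst k"] by (auto simp: follows_def)
  then show ?thesis
    unfolding realization_weights_def using plan_in_A[OF assms]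
    by (auto intro!: sum_follows_snoc[OF A_fin])
qed

lemma descendant_sum_realization_weights:
  assumes "m \<in> realization_weights x" "k \<noteq> []"
  shows "descendant_sum k n m = m k"
  using assms(2)
  by (induction n arbitrary: k)
    (simp_all add: descendant_sum_Suc realization_weights_sum_snoc[OF assms(1)])

definition weighted_cont ::
  "'x \<Rightarrow> ('x \<Rightarrow> 'a \<Rightarrow> 's \<Rightarrow> real) \<Rightarrow> (('s \<times> 'a) list \<Rightarrow> real) \<Rightarrow> ('s \<times> 'a) list \<Rightarrow> real" where
  "weighted_cont x f m k = (\<Sum>n. \<beta> ^ n * descendant_sum k n (\<lambda>k'. m k' * payoff_at f \<zeta> x k'))"

lemma abs_weighted_payoff_le:
  assumes f_bounded: "bounded_payoff X A f" and x_in_X: "x \<in> X"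
    and m_weights: "m \<in> realization_weights x" and k_Htil: "k \<in> Htil A t"
  shows "\<bar>descendant_sum k n (\<lambda>k'. m k' * payoff_at f \<zeta> x k')\<bar> \<le> supnorm X A f"
proof -
  have extension: "k @ e \<in> Htil A (t + n)" if "e \<in> histories A n" for e
    using append_histories[OF _ that, of k "Suc t"] k_Htil by (simp add: Htil_eq_histories)
  have "\<bar>m (k @ e) * payoff_at f \<zeta> x (k @ e)\<bar> \<le> supnorm X A f * m (k @ e)" if "e \<in> histories A n" for e
    using mult_right_mono[OF abs_payoff_at_le[OF f_bounded x_in_X extension[OF that]]]
      realization_weights_nonneg[OF m_weights, of "k @ e"]
    by (simp add: abs_mult mult.commute[of "m (k @ e)"])
  then have "\<bar>descendant_sum k n (\<lambda>k'. m k' * payoff_at f \<zeta> x k')\<bar>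
      \<le> descendant_sum k n (\<lambda>k'. supnorm X A f * m k')"
    by (rule descendant_sum_abs_le)
  also have "\<dots> = supnorm X A f * m k"
    by (simp add: descendant_sum_cmult
          descendant_sum_realization_weights[OF m_weights Htil_nonempty[OF k_Htil]])
  also have "\<dots> \<le> supnorm X A f"
    using order_trans[OF abs_ge_zero abs_payoff_at_le[OF f_bounded x_in_X k_Htil]]
      realization_weights_le_1[OF m_weights]
    by (simp add: mult_left_le)
  finally show ?thesis .
qed

lemma weighted_cont_sums:
  assumes "bounded_payoff X A f" "x \<in> X" "m \<in> realization_weights x" "k \<in> Htil A t"
  shows "(\<lambda>n. \<beta> ^ n * descendant_sum k n (\<lambda>k'. m k' * payoff_at f \<zeta> x k')) sums weighted_cont x f m k"
  unfolding weighted_cont_def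
  by (rule summable_sums[OF discounted_abs_le(1)[OF _ _ abs_weighted_payoff_le[OF assms]]])
    (use beta in auto)

lemma weighted_cont_affine:
  assumes "bounded_payoff X A f" "x \<in> X" "m \<in> realization_weights x" "m' \<in> realization_weights x"
    "k \<in> Htil A t"
  shows "weighted_cont x f (\<lambda>k. (1 - u) * m k + u * m' k) k
    = (1 - u) * weighted_cont x f m k + u * weighted_cont x f m' k"
proof -
  let ?D = "\<lambda>m n. descendant_sum k n (\<lambda>k'. m k' * payoff_at f \<zeta> x k')"
  have "?D (\<lambda>k. (1 - u) * m k + u * m' k) n = (1 - u) * ?D m n + u * ?D m' n" for n
    unfolding descendant_sum_cmult[symmetric] descendant_sum_add[symmetric]
    by (simp add: distrib_right mult.assoc)
  then have "\<beta> ^ n * ?D (\<lambda>k. (1 - u) * m k + u * m' k) n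
      = (1 - u) * (\<beta> ^ n * ?D m n) + u * (\<beta> ^ n * ?D m' n)" for n
    by (simp add: distrib_left mult.left_commute)
  moreover have "(\<lambda>n. (1 - u) * (\<beta> ^ n * ?D m n) + u * (\<beta> ^ n * ?D m' n))
      sums ((1 - u) * weighted_cont x f m k + u * weighted_cont x f m' k)"
    by (intro sums_add sums_mult weighted_cont_sums[OF assms(1,2) _ assms(5)] assms(3,4))
  ultimately show ?thesis
    unfolding weighted_cont_def[of x f "\<lambda>k. (1 - u) * m k + u * m' k"] by (simp add: sums_iff)
qed

lemma continuous_on_weighted_cont:
  assumes "bounded_payoff X A f" "x \<in> X" "k \<in> Htil A t"
  shows "continuous_on (realization_weights x) (\<lambda>m. weighted_cont x f m k)"
proof -
  let ?term = "\<lambda>n m. \<beta> ^ n * descendant_sum k n (\<lambda>k'. m k' * payoff_at f \<zeta> x k')"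
  have "uniform_limit (realization_weights x) (\<lambda>N m. \<Sum>n<N. ?term n m)
      (\<lambda>m. weighted_cont x f m k) sequentially"
    unfolding weighted_cont_def
  proof (rule Weierstrass_m_test)
    fix n m assume "m \<in> realization_weights x"
    then show "norm (?term n m) \<le> \<beta> ^ n * supnorm X A f"
      using abs_weighted_payoff_le[OF assms(1,2) _ assms(3)] beta by (simp add: abs_mult mult_left_mono)
  next
    show "summable (\<lambda>n. \<beta> ^ n * supnorm X A f)"
      using beta by (intro summable_mult2 summable_geometric) auto
  qed
  moreover have "continuous_on (realization_weights x) (\<lambda>m. \<Sum>n<N. ?term n m)" for N
    unfolding descendant_sum_def by (intro continuous_intros continuous_on_apply)
  ultimately show ?thesis
    by (intro uniform_limit_theorem[where F = sequentially]) (auto intro: always_eventually)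
qed

lemma weighted_cont_follows:
  assumes "a \<in> plans x" "k \<noteq> []"
  shows "weighted_cont x f (follows a) k = follows a k * cont_value x a f (map fst k)"
proof -
  have "condE \<pi> (map fst k) n (\<lambda>h. payoff_at f \<zeta> x (htil a h)) = condE \<pi> (map fst k) n (flow f \<zeta> x a)"
    for n
    using assms(2) by (intro condE_cong) (simp add: flow_eq_payoff_at)
  then have "descendant_sum k n (\<lambda>k'. follows a k' * payoff_at f \<zeta> x k')
      = follows a k * condE \<pi> (map fst k) n (flow f \<zeta> x a)" for n
    using plan_in_A[OF assms(1)] by (simp add: descendant_sum_follows[OF _ assms(2)])
  then show ?thesis
    by (simp add: weighted_cont_def cont_def follows_def)
qed

abbreviation plan_space :: "'x \<Rightarrow> ('s list \<Rightarrow> 'a) measure" where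
  "plan_space x \<equiv> restrict_space (PlanM A) (plans x)"

definition lotteries :: "'x \<Rightarrow> ('s list \<Rightarrow> 'a) measure set" where
  "lotteries x = {P. prob_space P \<and> sets P = sets (plan_space x)}"

definition induced_weights :: "('s list \<Rightarrow> 'a) measure \<Rightarrow> ('s \<times> 'a) list \<Rightarrow> real" where
  "induced_weights P k = (\<integral>a. follows a k \<partial>P)"

lemma prob_space_lottery: "P \<in> lotteries x \<Longrightarrow> prob_space P"
  by (simp add: lotteries_def)

lemma space_lottery: "P \<in> lotteries x \<Longrightarrow> space P = plans x"
  using sets_eq_imp_space_eq[of P "plan_space x"]
  by (auto simp: lotteries_def space_restrict_space PlanM_def space_PiM Ainf_def)

lemma measurable_plan_action:
  assumes "h \<noteq> []"
  shows "(\<lambda>a. a h) \<in> measurable (plan_space x) (count_space A)"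
  unfolding PlanM_def using assms
  by (intro measurable_restrict_space1 measurable_component_singleton) (simp add: Hist_def)

lemma measurable_follows: "(\<lambda>a. follows a k) \<in> borel_measurable (plan_space x)"
proof (induction k rule: rev_induct)
  case (snoc sb k)
  obtain s b where sb_eq: "sb = (s, b)"
    by (cases sb)
  have "(\<lambda>a. of_bool (a (map fst k @ [s]) = b) :: real) \<in> borel_measurable (plan_space x)"
    by (rule measurable_compose[OF measurable_plan_action]) simp_all
  with snoc show ?case
    by (simp add: sb_eq follows_snoc)
qed simp

lemma integrable_follows:
  assumes P_lottery: "P \<in> lotteries x"
  shows "integrable P (\<lambda>a. follows a k)"
proof -
  interpret prob_space P
    by (rule prob_space_lottery[OF P_lottery])
  have "(\<lambda>a. follows a k) \<in> borel_measurable P"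
    using P_lottery measurable_follows[of k x] measurable_cong_sets[of P "plan_space x"]
    by (auto simp: lotteries_def)
  then show ?thesis
    by (intro integrable_const_bound[of _ 1]) auto
qed

lemma
  assumes P_lottery: "P \<in> lotteries x" and f_bounded: "bounded_payoff X A f" and x_in_X: "x \<in> X"
    and k_Htil: "k \<in> Htil A t"
  shows integrable_weighted_cont: "integrable P (\<lambda>a. weighted_cont x f (follows a) k)"
    and integral_weighted_cont: "(\<integral>a. weighted_cont x f (follows a) k \<partial>P)
        = weighted_cont x f (induced_weights P) k"
proof -
  interpret prob_space P
    by (rule prob_space_lottery[OF P_lottery])
  let ?term = "\<lambda>n m. \<beta> ^ n * descendant_sum k n (\<lambda>k'. m k' * payoff_at f \<zeta> x k')"
  have integrable_term: "integrable P (\<lambda>a. follows a k' * payoff_at f \<zeta> x k')" for k'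
    by (intro integrable_mult_left integrable_follows[OF P_lottery])
  have measurable_term: "(\<lambda>a. ?term n (follows a)) \<in> borel_measurable P" for n
    by (intro borel_measurable_integrable integrable_mult_right integrable_descendant_sum
          integrable_term)
  have term_bound: "\<bar>?term n (follows a)\<bar> \<le> \<beta> ^ n * supnorm X A f" if "a \<in> space P" for n a
    using abs_weighted_payoff_le[OF f_bounded x_in_X follows_realization_weights k_Htil] that beta
    by (simp add: abs_mult mult_left_mono space_lottery[OF P_lottery])
  have bound_summable: "summable (\<lambda>n. \<beta> ^ n * supnorm X A f)"
    using beta by (intro summable_mult2 summable_geometric) auto
  show "integrable P (\<lambda>a. weighted_cont x f (follows a) k)"
    unfolding weighted_cont_def
    by (rule integral_suminf_bounded(1)[OF measurable_term term_bound bound_summable])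
  have integral_term: "(\<integral>a. ?term n (follows a) \<partial>P) = ?term n (induced_weights P)" for n
    using integral_descendant_sum[where F = "\<lambda>a k'. follows a k' * payoff_at f \<zeta> x k'",
        OF integrable_term]
    by (simp add: induced_weights_def)
  show "(\<integral>a. weighted_cont x f (follows a) k \<partial>P) = weighted_cont x f (induced_weights P) k"
    unfolding weighted_cont_def integral_term[symmetric]
    by (rule sums_unique[OF integral_suminf_bounded(2)[OF measurable_term term_bound bound_summable]])
qed

section \<open>Kuhn's theorem\<close>

definition play :: "(('s \<times> 'a) list \<times> 's \<Rightarrow> 'a) \<Rightarrow> 's list \<Rightarrow> ('s \<times> 'a) list" where
  "play \<omega> h = foldl (\<lambda>k s. k @ [(s, \<omega> (k, s))]) [] h"

definition strategy_plan :: "(('s \<times> 'a) list \<times> 's \<Rightarrow> 'a) \<Rightarrow> 's list \<Rightarrow> 'a" where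
  "strategy_plan \<omega> h = (if h = [] then undefined else snd (last (play \<omega> h)))"

lemma play_Nil [simp]: "play \<omega> [] = []"
  by (simp add: play_def)

lemma play_snoc: "play \<omega> (h @ [s]) = play \<omega> h @ [(s, \<omega> (play \<omega> h, s))]"
  by (simp add: play_def)

lemma strategy_plan_snoc: "strategy_plan \<omega> (h @ [s]) = \<omega> (play \<omega> h, s)"
  by (simp add: strategy_plan_def play_snoc)

lemma htil_strategy_plan: "htil (strategy_plan \<omega>) h = play \<omega> h"
  by (induction h rule: rev_induct) (simp_all add: htil_snoc strategy_plan_snoc play_snoc)

lemma play_eq_iff:
  "play \<omega> (map fst k) = k \<longleftrightarrow> (\<forall>j<length k. \<omega> (take j k, fst (k ! j)) = snd (k ! j))"
proof (induction k rule: rev_induct)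
  case (snoc sb k)
  have "play \<omega> (map fst (k @ [sb])) = k @ [sb] \<longleftrightarrow> play \<omega> (map fst k) = k \<and> \<omega> (k, fst sb) = snd sb"
    by (auto simp: play_snoc prod_eq_iff)
  then show ?case
    using snoc by (auto simp: nth_append less_Suc_eq)
qed simp

definition legal_actions :: "'x \<Rightarrow> ('s \<times> 'a) list \<times> 's \<Rightarrow> 'a set" where
  "legal_actions x = (\<lambda>(k, s). if admissible A p \<zeta> x k then Atil A p (state_after \<zeta> x k) s else A)"

lemma legal_actions_subset: "legal_actions x z \<subseteq> A"
  by (auto simp: legal_actions_def Atil_def split: prod.split)

lemma legal_actions_nonempty:
  assumes "x \<in> X" and Atil_nonempty: "\<And>x s. x \<in> X \<Longrightarrow> Atil A p x s \<noteq> {}"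
  shows "legal_actions x z \<noteq> {}"
proof (cases z)
  case (Pair k s)
  have "Atil A p (state_after \<zeta> x k) s \<noteq> {}" if "admissible A p \<zeta> x k"
    by (rule Atil_nonempty[OF state_after_X[OF assms(1) admissible_in_histories[OF that]]])
  moreover have "A \<noteq> {}"
    using Atil_nonempty[OF assms(1)] by (auto simp: Atil_def)
  ultimately show ?thesis
    by (simp add: Pair legal_actions_def)
qed

lemma strategy_plan_plans:
  assumes legal: "\<And>z. \<omega> z \<in> legal_actions x z"
  shows "strategy_plan \<omega> \<in> plans x"
proof -
  have step: "\<omega> (k, s) \<in> Atil A p (state_after \<zeta> x k) s" if "admissible A p \<zeta> x k" for k s
    using legal[of "(k, s)"] that by (simp add: legal_actions_def)
  then have "admissible A p \<zeta> x (play \<omega> h)" for h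
    by (induction h rule: rev_induct) (simp_all add: play_snoc admissible_snoc)
  then show ?thesis
    using step unfolding Ainf_iff strategy_plan_snoc htil_strategy_plan by (simp add: strategy_plan_def)
qed

lemma ex_conditional_pmf:
  assumes x_in_X: "x \<in> X" and Atil_nonempty: "\<And>x s. x \<in> X \<Longrightarrow> Atil A p x s \<noteq> {}"
    and m_weights: "m \<in> realization_weights x"
  shows "\<exists>q. set_pmf q \<subseteq> legal_actions x (k, s) \<and> (\<forall>b. m (k @ [(s, b)]) = m k * pmf q b)"
proof (cases "m k = 0")
  case True
  obtain b' where b'_legal: "b' \<in> legal_actions x (k, s)"
    using legal_actions_nonempty[OF x_in_X Atil_nonempty] by blast
  have "m (k @ [(s, b)]) = 0" for b
    using True realization_weights_snoc_le[OF m_weights, of k s b]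
      realization_weights_nonneg[OF m_weights, of "k @ [(s, b)]"] by simp
  with True b'_legal show ?thesis
    by (intro exI[of _ "return_pmf b'"]) simp
next
  case False
  let ?q = "\<lambda>b. m (k @ [(s, b)]) / m k"
  have "(\<integral>\<^sup>+b. ennreal (?q b) \<partial>count_space UNIV) = (\<Sum>b\<in>A. ennreal (?q b))"
    using realization_weights_snoc_eq_0[OF m_weights] by (intro nn_integral_count_space' A_fin) auto
  also have "\<dots> = ennreal (\<Sum>b\<in>A. ?q b)"
    using realization_weights_nonneg[OF m_weights] by (intro sum_ennreal) auto
  also have "\<dots> = 1"
    using realization_weights_sum_snoc[OF m_weights, of k s] False by (simp flip: sum_divide_distrib)
  finally have pmf_eq: "pmf (embed_pmf ?q) b = ?q b" for b
    using realization_weights_nonneg[OF m_weights] by (intro pmf_embed_pmf) auto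
  have "b \<in> legal_actions x (k, s)" if "b \<in> set_pmf (embed_pmf ?q)" for b
  proof -
    have "admissible A p \<zeta> x (k @ [(s, b)])"
      using realization_weights_inadmissible[OF m_weights] that by (auto simp: set_pmf_iff pmf_eq)
    then show ?thesis
      by (simp add: admissible_snoc legal_actions_def)
  qed
  then show ?thesis
    using False pmf_eq by (intro exI[of _ "embed_pmf ?q"]) auto
qed

lemma ex_behavioural_strategy:
  assumes "x \<in> X" "\<And>x s. x \<in> X \<Longrightarrow> Atil A p x s \<noteq> {}" "m \<in> realization_weights x"
  obtains q where "\<And>z. set_pmf (q z) \<subseteq> legal_actions x z"
    and "\<And>k. m k = (\<Prod>j<length k. pmf (q (take j k, fst (k ! j))) (snd (k ! j)))"
proof -
  have "\<forall>z. \<exists>q. set_pmf q \<subseteq> legal_actions x z \<and> (\<forall>b. m (fst z @ [(snd z, b)]) = m (fst z) * pmf q b)"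
    using ex_conditional_pmf[OF assms] by simp
  from choice[OF this] obtain q where legal: "\<And>z. set_pmf (q z) \<subseteq> legal_actions x z"
    and step: "\<And>k s b. m (k @ [(s, b)]) = m k * pmf (q (k, s)) b"
    by force
  have "m k = (\<Prod>j<length k. pmf (q (take j k, fst (k ! j))) (snd (k ! j)))" for k
  proof (induction k rule: rev_induct)
    case (snoc sb k)
    then show ?case
      using step[of k "fst sb" "snd sb"] by (simp add: nth_append)
  qed (simp add: realization_weights_Nil[OF assms(3)])
  then show thesis
    using that legal by blast
qed

definition strategy_space ::
  "'x \<Rightarrow> (('s \<times> 'a) list \<times> 's \<Rightarrow> 'a pmf) \<Rightarrow> (('s \<times> 'a) list \<times> 's \<Rightarrow> 'a) measure" where
  "strategy_space x q = PiM UNIV (\<lambda>z. restrict_space (measure_pmf (q z)) (legal_actions x z))"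

lemma space_strategy_space: "space (strategy_space x q) = {\<omega>. \<forall>z. \<omega> z \<in> legal_actions x z}"
  by (auto simp: strategy_space_def space_PiM space_restrict_space)

lemma prob_space_legal_pmf:
  assumes "set_pmf (q z) \<subseteq> legal_actions x z"
  shows "prob_space (restrict_space (measure_pmf (q z)) (legal_actions x z))"
  using assms
  by (intro prob_space_restrict_space measure_pmf.emeasure_eq_1_AE) (auto simp: AE_measure_pmf_iff)

lemma measurable_strategy_action:
  assumes "\<And>b. b \<in> A \<Longrightarrow> F b \<in> B"
  shows "(\<lambda>\<omega>. F (\<omega> z)) \<in> measurable (strategy_space x q) (count_space B)"
proof (rule measurable_compose[of "\<lambda>\<omega>. \<omega> z"])
  show "(\<lambda>\<omega>. \<omega> z)
      \<in> measurable (strategy_space x q) (restrict_space (measure_pmf (q z)) (legal_actions x z))"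
    unfolding strategy_space_def by (rule measurable_component_singleton) simp
  show "F \<in> measurable (restrict_space (measure_pmf (q z)) (legal_actions x z)) (count_space B)"
    using assms legal_actions_subset[of x z]
    by (auto simp: measurable_def space_restrict_space sets_restrict_space)
qed

lemma measurable_play:
  "(\<lambda>\<omega>. play \<omega> h) \<in> measurable (strategy_space x q) (count_space (histories A (length h)))"
proof (induction h rule: rev_induct)
  case (snoc s h)
  show ?case
    unfolding play_snoc
    by (rule measurable_compose_countable'[where g = "\<lambda>\<omega>. play \<omega> h" and I = "histories A (length h)"
          and f = "\<lambda>k \<omega>. k @ [(s, \<omega> (k, s))]"])
      (use snoc A_fin in \<open>auto intro!: measurable_strategy_action countable_finite\<close>)
qed simp

lemma measurable_strategy_plan:
  "strategy_plan \<in> measurable (strategy_space x q) (plan_space x)"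
proof (rule measurable_restrict_space2)
  show "strategy_plan \<in> space (strategy_space x q) \<rightarrow> plans x"
    using strategy_plan_plans by (auto simp: space_strategy_space)
  have action: "(\<lambda>\<omega>. strategy_plan \<omega> h) \<in> measurable (strategy_space x q) (count_space A)"
    if h_Hist: "h \<in> Hist" for h
  proof -
    obtain h' s where h_eq: "h = h' @ [s]"
      using h_Hist by (cases h rule: rev_cases) (auto simp: Hist_def)
    show ?thesis
      unfolding h_eq strategy_plan_snoc
      by (rule measurable_compose_countable'[where g = "\<lambda>\<omega>. play \<omega> h'" and I = "histories A (length h')"
            and f = "\<lambda>k \<omega>. \<omega> (k, s)"])
        (use measurable_play A_fin in \<open>auto intro!: measurable_strategy_action countable_finite\<close>)
  qed
  have "(\<lambda>\<omega> h. strategy_plan \<omega> h) \<in> measurable (strategy_space x q) (PlanM A)"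
    unfolding PlanM_def using strategy_plan_plans
    by (intro measurable_PiM_single'[OF action]) (force simp: space_strategy_space Ainf_def)+
  then show "strategy_plan \<in> measurable (strategy_space x q) (PlanM A)"
    by simp
qed

lemma measure_play_eq:
  assumes legal: "\<And>z. set_pmf (q z) \<subseteq> legal_actions x z"
  shows "measure (strategy_space x q) {\<omega> \<in> space (strategy_space x q). play \<omega> (map fst k) = k}
    = (\<Prod>j<length k. pmf (q (take j k, fst (k ! j))) (snd (k ! j)))"
proof -
  interpret product_prob_space "\<lambda>z. restrict_space (measure_pmf (q z)) (legal_actions x z)" UNIV
    by (rule product_prob_spaceI) (rule prob_space_legal_pmf[OF legal])
  let ?node = "\<lambda>j. (take j k, fst (k ! j))"
  define E where "E z = {snd (k ! length (fst z))} \<inter> legal_actions x z" for z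
  have inj_node: "inj_on ?node {..<length k}"
    by (rule inj_on_inverseI[of _ "\<lambda>z. length (fst z)"]) simp
  have cylinder: "{\<omega> \<in> space (strategy_space x q). play \<omega> (map fst k) = k}
      = {\<omega> \<in> space (strategy_space x q). \<forall>z\<in>?node ` {..<length k}. \<omega> z \<in> E z}"
    unfolding play_eq_iff by (auto simp: E_def space_strategy_space)
  have "emeasure (strategy_space x q) {\<omega> \<in> space (strategy_space x q). play \<omega> (map fst k) = k}
      = (\<Prod>z\<in>?node ` {..<length k}.
          emeasure (restrict_space (measure_pmf (q z)) (legal_actions x z)) (E z))"
    unfolding cylinder unfolding strategy_space_def
    by (rule emeasure_PiM_Collect) (auto simp: E_def sets_restrict_space)
  also have "\<dots> = (\<Prod>j<length k. ennreal (pmf (q (?node j)) (snd (k ! j))))"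
    unfolding prod.reindex[OF inj_node]
    by (intro prod.cong refl) (simp add: E_def emeasure_restrict_pmf_single[OF legal])
  finally show ?thesis
    by (simp add: prod_ennreal measure_def prod_nonneg)
qed

theorem ex_lottery_with_weights:
  assumes x_in_X: "x \<in> X" and Atil_nonempty: "\<And>x s. x \<in> X \<Longrightarrow> Atil A p x s \<noteq> {}"
    and m_weights: "m \<in> realization_weights x"
  shows "\<exists>P\<in>lotteries x. induced_weights P = m"
proof -
  obtain q where legal: "\<And>z. set_pmf (q z) \<subseteq> legal_actions x z"
    and m_eq: "\<And>k. m k = (\<Prod>j<length k. pmf (q (take j k, fst (k ! j))) (snd (k ! j)))"
    using ex_behavioural_strategy[OF x_in_X Atil_nonempty m_weights] by blast
  let ?S = "strategy_space x q"
  define P where "P = distr ?S (plan_space x) strategy_plan"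
  have "prob_space ?S"
    unfolding strategy_space_def by (intro prob_space_PiM prob_space_legal_pmf legal)
  then have "P \<in> lotteries x"
    by (simp add: lotteries_def P_def prob_space.prob_space_distr[OF _ measurable_strategy_plan])
  moreover have "induced_weights P k = m k" for k
  proof -
    have "induced_weights P k = (\<integral>\<omega>. follows (strategy_plan \<omega>) k \<partial>?S)"
      unfolding induced_weights_def P_def
      by (rule integral_distr[OF measurable_strategy_plan measurable_follows])
    also have "\<dots> = (\<integral>\<omega>. indicator {\<omega> \<in> space ?S. play \<omega> (map fst k) = k} \<omega> \<partial>?S)"
      by (intro Bochner_Integration.integral_cong refl)
        (simp add: follows_def htil_strategy_plan indicator_def)
    also have "\<dots> = measure ?S {\<omega> \<in> space ?S. play \<omega> (map fst k) = k}"
      by (simp add: Int_absorb2)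
    also have "\<dots> = m k"
      by (simp add: measure_play_eq[OF legal] m_eq)
    finally show ?thesis .
  qed
  ultimately show ?thesis
    by blast
qed

end

section \<open>The Lagrangian\<close>

abbreviation (input) shift_mult :: "(('s \<times> 'a) list \<Rightarrow> 'b) \<Rightarrow> 's \<Rightarrow> 'a \<Rightarrow> ('s \<times> 'a) list \<Rightarrow> 'b" where
  "shift_mult lam s b \<equiv> \<lambda>k. lam ((s, b) # k)"

locale lottery_model = dynamics \<pi> A X \<zeta> p \<beta>
  for \<pi> :: "'s::finite \<Rightarrow> 's \<Rightarrow> real" and A :: "'a set" and X :: "'x set" and \<zeta> and p and \<beta> +
  fixes r :: "'x \<Rightarrow> 'a \<Rightarrow> 's \<Rightarrow> real"
    and g :: "'i::finite \<Rightarrow> 'x \<Rightarrow> 'a \<Rightarrow> 's \<Rightarrow> real"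
    and gbar :: "'i \<Rightarrow> real"
  assumes bounded_r: "bounded_payoff X A r"
    and bounded_g: "\<And>i. bounded_payoff X A (g i)"
    and feas_ex: "\<And>x s. x \<in> X \<Longrightarrow> \<exists>a. feasible A p \<zeta> \<pi> \<beta> g gbar x s a"
begin

abbreviation "Lag a lam \<gamma> x s \<equiv> Ltil \<beta> \<pi> \<zeta> r g gbar a lam \<gamma> x s"
abbreviation "Mult \<equiv> Lam \<beta> \<pi> A :: (('s \<times> 'a) list \<Rightarrow> real ^ 'i) set"
abbreviation "Lc \<equiv> Lconst X A \<beta> r g"
abbreviation "feasible_plan x s a \<equiv> feasible A p \<zeta> \<pi> \<beta> g gbar x s a"
abbreviation "feasible_lottery x P \<equiv> LotFeas A p \<beta> \<pi> \<zeta> g gbar x P"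
abbreviation "lottery_value \<gamma> x s P \<equiv> LotObj \<beta> \<pi> \<zeta> r g \<gamma> x s P"
abbreviation "solves_Bellman G \<equiv> Bellman X A p \<beta> \<pi> \<zeta> r g gbar G"

abbreviation weighted_payoff :: "real ^ 'i \<Rightarrow> 'x \<Rightarrow> 'a \<Rightarrow> 's \<Rightarrow> real" where
  "weighted_payoff \<gamma> \<equiv> \<lambda>x b s. r x b s + (\<Sum>i\<in>UNIV. \<gamma> $ i * g i x b s)"

definition slack :: "('s list \<Rightarrow> 'a) \<Rightarrow> 'x \<Rightarrow> 'i \<Rightarrow> 's list \<Rightarrow> real" where
  "slack a x i h = cont_value x a (g i) h - gbar i"

definition nonneg_mult :: "(('s \<times> 'a) list \<Rightarrow> real ^ 'i) \<Rightarrow> bool" where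
  "nonneg_mult lam \<longleftrightarrow> (\<forall>t. \<forall>k\<in>Htil A t. \<forall>i. 0 \<le> lam k $ i)"

definition mult_mass :: "(('s \<times> 'a) list \<Rightarrow> real ^ 'i) \<Rightarrow> nat \<Rightarrow> 's \<Rightarrow> real" where
  "mult_mass lam t s = history_sum s t (\<lambda>k. \<Sum>i\<in>UNIV. lam k $ i)"

lemma ex_plan: "x \<in> X \<Longrightarrow> \<exists>a. a \<in> plans x"
  using feas_ex[of x] unfolding feasible_def by blast

lemma Atil_nonempty:
  assumes "x \<in> X"
  shows "Atil A p x s \<noteq> {}"
  using ex_plan[OF assms] plan_first_action by (metis empty_iff)

lemma supnorm_nonneg:
  assumes "bounded_payoff X A f" "x \<in> X"
  shows "0 \<le> supnorm X A f"
proof -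
  obtain b where "b \<in> A"
    using ex_plan[OF assms(2)] plan_in_A by (metis list.distinct(1))
  then show ?thesis
    using abs_le_supnorm[OF assms] abs_ge_zero order_trans by blast
qed

lemma Lconst_eq: "Lc = supnorm X A r / (1 - \<beta>) + (\<Sum>i\<in>UNIV. supnorm X A (g i) / (1 - \<beta>))"
  by (simp add: Lconst_def add_divide_distrib sum_divide_distrib)

lemma
  assumes "x \<in> X"
  shows Lconst_nonneg: "0 \<le> Lc"
    and supnorm_r_le_Lconst: "supnorm X A r / (1 - \<beta>) \<le> Lc"
    and supnorm_g_le_Lconst: "supnorm X A (g i) / (1 - \<beta>) \<le> Lc"
proof -
  have r_nonneg: "0 \<le> supnorm X A r / (1 - \<beta>)" and g_nonneg: "0 \<le> supnorm X A (g i) / (1 - \<beta>)" for i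
    using supnorm_nonneg[OF bounded_r assms] supnorm_nonneg[OF bounded_g assms] beta by auto
  have "supnorm X A (g i) / (1 - \<beta>) \<le> (\<Sum>i\<in>UNIV. supnorm X A (g i) / (1 - \<beta>))"
    using g_nonneg by (intro member_le_sum) auto
  then show "0 \<le> Lc" "supnorm X A r / (1 - \<beta>) \<le> Lc" "supnorm X A (g i) / (1 - \<beta>) \<le> Lc"
    unfolding Lconst_eq using r_nonneg g_nonneg[of i] by linarith+
qed

lemma abs_cont_r_le: "x \<in> X \<Longrightarrow> a \<in> plans x \<Longrightarrow> h \<noteq> [] \<Longrightarrow> \<bar>cont_value x a r h\<bar> \<le> Lc"
  using abs_cont_le[OF bounded_r] supnorm_r_le_Lconst order_trans by blast

lemma abs_cont_g_le: "x \<in> X \<Longrightarrow> a \<in> plans x \<Longrightarrow> h \<noteq> [] \<Longrightarrow> \<bar>cont_value x a (g i) h\<bar> \<le> Lc"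
  using abs_cont_le[OF bounded_g] supnorm_g_le_Lconst order_trans by blast

lemma bounded_weighted_payoff: "bounded_payoff X A (weighted_payoff \<gamma>)"
  by (rule bounded_payoff_lincomb[OF bounded_r bounded_g])

lemma cont_weighted_payoff:
  assumes "x \<in> X" "a \<in> plans x" "h \<noteq> []"
  shows "cont_value x a (weighted_payoff \<gamma>) h
    = cont_value x a r h + (\<Sum>i\<in>UNIV. \<gamma> $ i * cont_value x a (g i) h)"
  by (rule cont_lincomb[OF bounded_r bounded_g assms])

lemma abs_lincomb_cont_g_le:
  assumes "x \<in> X" "a \<in> plans x" "h \<noteq> []"
  shows "\<bar>\<Sum>i\<in>UNIV. c $ i * cont_value x a (g i) h\<bar> \<le> l1norm c * Lc"
proof -
  have "\<bar>\<Sum>i\<in>UNIV. c $ i * cont_value x a (g i) h\<bar> \<le> (\<Sum>i\<in>UNIV. \<bar>c $ i\<bar> * Lc)"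
    using abs_cont_g_le[OF assms]
    by (intro order_trans[OF sum_abs] sum_mono) (simp add: abs_mult mult_left_mono)
  then show ?thesis
    by (simp add: sum_distrib_right)
qed

definition slack_bound :: real where
  "slack_bound = Lc + (\<Sum>i\<in>UNIV. \<bar>gbar i\<bar>)"

lemma slack_bound_nonneg: "x \<in> X \<Longrightarrow> 0 \<le> slack_bound"
  unfolding slack_bound_def by (intro add_nonneg_nonneg sum_nonneg Lconst_nonneg) auto

lemma abs_slack_le:
  assumes "x \<in> X" "a \<in> plans x" "h \<noteq> []"
  shows "\<bar>slack a x i h\<bar> \<le> slack_bound"
proof -
  have "\<bar>gbar i\<bar> \<le> (\<Sum>i\<in>UNIV. \<bar>gbar i\<bar>)"
    by (rule member_le_sum) auto
  then show ?thesis
    unfolding slack_def slack_bound_def using abs_cont_g_le[OF assms, of i] by linarith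
qed

lemma slack_Cons: "h \<noteq> [] \<Longrightarrow> slack a x i (s # h) = slack (continuation_plan a s) (\<zeta> x (a [s]) s) i h"
  by (simp add: slack_def cont_Cons)

lemma mult_mass_nonneg: "nonneg_mult lam \<Longrightarrow> 0 \<le> mult_mass lam t s"
  unfolding mult_mass_def nonneg_mult_def by (intro history_sum_nonneg sum_nonneg) auto

lemma mult_mass_0: "mult_mass lam 0 s = (\<Sum>b\<in>A. \<Sum>i\<in>UNIV. lam [(s, b)] $ i)"
  by (simp add: mult_mass_def history_sum_0)

lemma mult_mass_Suc: "mult_mass lam (Suc t) s = (\<Sum>b\<in>A. expect s (mult_mass (shift_mult lam s b) t))"
  by (simp add: mult_mass_def history_sum_Suc)

lemma Mult_iff: "lam \<in> Mult \<longleftrightarrow> nonneg_mult lam \<and> (\<forall>s. summable (\<lambda>t. \<beta> ^ t * mult_mass lam t s))"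
proof -
  have mass_eq: "(\<Sum>k\<in>Htil A t. \<Sum>i\<in>UNIV. lam k $ i * pathprob \<pi> (map fst k))
      = (\<Sum>s\<in>UNIV. mult_mass lam t s)" for t
    using sum_Htil_eq_history_sum[of "\<lambda>k. \<Sum>i\<in>UNIV. lam k $ i" t]
    by (simp add: mult_mass_def sum_distrib_right)
  have "summable (\<lambda>t. \<beta> ^ t * (\<Sum>s\<in>UNIV. mult_mass lam t s))
      \<longleftrightarrow> (\<forall>s. summable (\<lambda>t. \<beta> ^ t * mult_mass lam t s))"
    if "nonneg_mult lam"
    unfolding sum_distrib_left using mult_mass_nonneg[OF that] beta
    by (subst summable_sum_iff_nonneg) auto
  then show ?thesis
    unfolding Lam_def mem_Collect_eq mass_eq nonneg_mult_def[symmetric] by blast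
qed

lemma nonneg_multD: "lam \<in> Mult \<Longrightarrow> nonneg_mult lam"
  by (simp add: Mult_iff)

lemma mult_mass_summable: "lam \<in> Mult \<Longrightarrow> summable (\<lambda>t. \<beta> ^ t * mult_mass lam t s)"
  by (simp add: Mult_iff)

lemma zero_Mult: "(\<lambda>_. 0) \<in> Mult"
  using history_sum_cmult[of _ _ 0] by (simp add: Mult_iff nonneg_mult_def mult_mass_def)

lemma first_mult_nonneg: "nonneg_mult lam \<Longrightarrow> b \<in> A \<Longrightarrow> lam [(s, b)] \<in> nonneg"
  unfolding nonneg_mult_def nonneg_def using Htil_eq_histories[of A 0] by force

lemma first_mult_le_mult_mass:
  assumes "nonneg_mult lam" "b \<in> A"
  shows "l1norm (lam [(s, b)]) \<le> mult_mass lam 0 s"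
proof -
  have nonneg: "lam [(s, b)] \<in> nonneg" if "b \<in> A" for b
    by (rule first_mult_nonneg[OF assms(1) that])
  then have "(\<Sum>i\<in>UNIV. lam [(s, b)] $ i) \<le> mult_mass lam 0 s"
    unfolding mult_mass_0 using assms(2) A_fin
    by (intro member_le_sum[where f = "\<lambda>b. \<Sum>i\<in>UNIV. lam [(s, b)] $ i"] sum_nonneg)
      (auto simp: nonneg_def)
  then show ?thesis
    by (simp add: l1norm_nonneg_eq[OF nonneg[OF assms(2)]])
qed

lemma nonneg_mult_shift: "nonneg_mult lam \<Longrightarrow> b \<in> A \<Longrightarrow> nonneg_mult (shift_mult lam s b)"
  unfolding nonneg_mult_def Htil_eq_histories by (metis Cons_histories)

lemma expect_mult_mass_le:
  assumes "nonneg_mult lam" "b \<in> A"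
  shows "expect s (mult_mass (shift_mult lam s b) t) \<le> mult_mass lam (Suc t) s"
proof -
  have "0 \<le> expect s (mult_mass (shift_mult lam s b) t)" if "b \<in> A" for b
    using mult_mass_nonneg[OF nonneg_mult_shift[OF assms(1) that]] pi_pos
    by (intro sum_nonneg mult_nonneg_nonneg) (auto simp: less_imp_le)
  then show ?thesis
    unfolding mult_mass_Suc using assms(2) A_fin by (intro member_le_sum) auto
qed

lemma shift_mult_Mult:
  assumes "lam \<in> Mult" "b \<in> A"
  shows "shift_mult lam s b \<in> Mult"
  unfolding Mult_iff
proof (intro conjI allI)
  show nonneg: "nonneg_mult (shift_mult lam s b)"
    by (rule nonneg_mult_shift[OF nonneg_multD[OF assms(1)] assms(2)])
  have "summable (\<lambda>t. \<beta> ^ Suc t * mult_mass lam (Suc t) s)"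
    using mult_mass_summable[OF assms(1), of s] by (subst summable_Suc_iff)
  then have "summable (\<lambda>t. mult_mass lam (Suc t) s * \<beta> ^ t)"
    using beta summable_mult[of "\<lambda>t. \<beta> ^ Suc t * mult_mass lam (Suc t) s" "1 / \<beta>"]
    by (simp add: mult.commute)
  moreover have "expect s (mult_mass (shift_mult lam s b) t) \<le> mult_mass lam (Suc t) s" for t
    by (rule expect_mult_mass_le[OF nonneg_multD[OF assms(1)] assms(2)])
  then have "norm (expect s (mult_mass (shift_mult lam s b) t) * \<beta> ^ t)
      \<le> mult_mass lam (Suc t) s * \<beta> ^ t" for t
    using mult_mass_nonneg[OF nonneg] pi_pos beta
    by (simp add: abs_mult sum_nonneg less_imp_le)
  ultimately have "summable (\<lambda>t. expect s (mult_mass (shift_mult lam s b) t) * \<beta> ^ t)"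
    by (rule summable_comparison_test')
  then have "\<forall>s'\<in>UNIV. summable (\<lambda>t. \<pi> s s' * mult_mass (shift_mult lam s b) t s' * \<beta> ^ t)"
    using mult_mass_nonneg[OF nonneg] pi_pos beta unfolding sum_distrib_right
    by (subst summable_sum_iff_nonneg[symmetric]) (auto simp: less_imp_le)
  then show "summable (\<lambda>t. \<beta> ^ t * mult_mass (shift_mult lam s b) t s')" for s'
    using summable_mult[of "\<lambda>t. \<pi> s s' * mult_mass (shift_mult lam s b) t s' * \<beta> ^ t" "1 / \<pi> s s'"]
      pi_pos[of s s'] by (simp add: mult.commute)
qed

definition penalty ::
  "('s list \<Rightarrow> 'a) \<Rightarrow> (('s \<times> 'a) list \<Rightarrow> real ^ 'i) \<Rightarrow> 'x \<Rightarrow> 's \<Rightarrow> nat \<Rightarrow> real" where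
  "penalty a lam x s t = condE \<pi> [s] t (\<lambda>h. \<Sum>i\<in>UNIV. lam (htil a h) $ i * slack a x i h)"

lemma penalty_0: "penalty a lam x s 0 = (\<Sum>i\<in>UNIV. lam [(s, a [s])] $ i * slack a x i [s])"
  by (simp add: penalty_def htil_Cons)

lemma penalty_Suc:
  "penalty a lam x s (Suc t) = expect s (\<lambda>s'.
     penalty (continuation_plan a s) (shift_mult lam s (a [s])) (\<zeta> x (a [s]) s) s' t)"
  unfolding penalty_def condE_single_Suc
  by (intro sum.cong refl arg_cong2[where f = "(*)"] condE_cong) (simp_all add: htil_Cons slack_Cons)

lemma abs_penalty_le:
  assumes lam_nonneg: "nonneg_mult lam" and x_in_X: "x \<in> X" and a_plan: "a \<in> plans x"
  shows "\<bar>penalty a lam x s t\<bar> \<le> slack_bound * mult_mass lam t s"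
proof -
  let ?mass = "\<lambda>k. \<Sum>i\<in>UNIV. lam k $ i"
  have abs_term_le: "\<bar>\<Sum>i\<in>UNIV. lam (htil a ([s] @ e)) $ i * slack a x i ([s] @ e)\<bar>
      \<le> slack_bound * ?mass (htil a ([s] @ e))" for e
  proof -
    have "0 \<le> lam (htil a ([s] @ e)) $ i" for i
      using lam_nonneg htil_in_Htil[OF a_plan, of s e] by (simp add: nonneg_mult_def)
    then show ?thesis
      unfolding sum_distrib_left using abs_slack_le[OF x_in_X a_plan, of "[s] @ e"]
      by (intro order_trans[OF sum_abs] sum_mono)
        (simp add: abs_mult mult.commute[of slack_bound] mult_left_mono)
  qed
  have "condE \<pi> [s] t (\<lambda>h. ?mass (htil a h)) = history_sum s t (\<lambda>k. follows a k * ?mass k)"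
    using plan_in_A[OF a_plan] by (simp add: history_sum_follows)
  also have "\<dots> \<le> mult_mass lam t s"
    unfolding mult_mass_def using lam_nonneg
    by (intro history_sum_mono mult_left_le_one_le sum_nonneg) (auto simp: nonneg_mult_def)
  finally have "slack_bound * condE \<pi> [s] t (\<lambda>h. ?mass (htil a h)) \<le> slack_bound * mult_mass lam t s"
    by (rule mult_left_mono[OF _ slack_bound_nonneg[OF x_in_X]])
  moreover have "\<bar>penalty a lam x s t\<bar> \<le> condE \<pi> [s] t (\<lambda>h. slack_bound * ?mass (htil a h))"
    unfolding penalty_def by (intro condE_abs_le abs_term_le)
  ultimately show ?thesis
    by (simp add: condE_cmult)
qed

text \<open>
  Multipliers of the first \<open>T\<close> periods are discounted as if set in period \<open>T\<close>, because they raise the weight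
  \<open>\<gamma>\<close> with which the constraint payoffs after \<open>T\<close> periods are valued.
\<close>

definition delayed_mass :: "nat \<Rightarrow> (('s \<times> 'a) list \<Rightarrow> real ^ 'i) \<Rightarrow> 's \<Rightarrow> real" where
  "delayed_mass T lam s = (\<Sum>t. \<beta> ^ max t T * mult_mass lam t s)"

definition total_penalty ::
  "('s list \<Rightarrow> 'a) \<Rightarrow> (('s \<times> 'a) list \<Rightarrow> real ^ 'i) \<Rightarrow> 'x \<Rightarrow> 's \<Rightarrow> real" where
  "total_penalty a lam x s = (\<Sum>t. \<beta> ^ t * penalty a lam x s t)"

lemma
  assumes "lam \<in> Mult" "x \<in> X" "a \<in> plans x"
  shows penalty_sums: "(\<lambda>t. \<beta> ^ t * penalty a lam x s t) sums total_penalty a lam x s"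
    and abs_total_penalty_le: "\<bar>total_penalty a lam x s\<bar> \<le> slack_bound * delayed_mass 0 lam s"
proof -
  have "\<bar>penalty a lam x s t\<bar> \<le> slack_bound * mult_mass lam t s" for t
    by (rule abs_penalty_le[OF nonneg_multD[OF assms(1)] assms(2,3)])
  then have dominated: "norm (\<beta> ^ t * penalty a lam x s t) \<le> slack_bound * (\<beta> ^ t * mult_mass lam t s)"
    for t
    using beta mult_left_mono[of "\<bar>penalty a lam x s t\<bar>" _ "\<beta> ^ t"]
    by (simp add: abs_mult mult.left_commute)
  have summable: "summable (\<lambda>t. slack_bound * (\<beta> ^ t * mult_mass lam t s))"
    by (rule summable_mult[OF mult_mass_summable[OF assms(1)]])
  show "(\<lambda>t. \<beta> ^ t * penalty a lam x s t) sums total_penalty a lam x s"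
    unfolding total_penalty_def
    by (rule summable_sums[OF summable_comparison_test'[OF summable dominated]])
  show "\<bar>total_penalty a lam x s\<bar> \<le> slack_bound * delayed_mass 0 lam s"
    using norm_suminf_le[OF dominated summable] suminf_mult[OF mult_mass_summable[OF assms(1)]]
    by (simp add: total_penalty_def delayed_mass_def)
qed

lemma
  assumes "lam \<in> Mult" "x \<in> X" "a \<in> plans x"
  shows Lag_sums: "(\<lambda>t. \<beta> ^ t * (condE \<pi> [s] t (flow (weighted_payoff \<gamma>) \<zeta> x a) + penalty a lam x s t))
      sums Lag a lam \<gamma> x s"
    and Lag_eq: "Lag a lam \<gamma> x s = cont_value x a (weighted_payoff \<gamma>) [s] + total_penalty a lam x s"
proof -
  have "condE \<pi> [s] t (\<lambda>h. flow r \<zeta> x a h + (\<Sum>i\<in>UNIV. \<gamma> $ i * flow (g i) \<zeta> x a h)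
        + (\<Sum>i\<in>UNIV. lam (htil a h) $ i * (cont_value x a (g i) h - gbar i)))
      = condE \<pi> [s] t (flow (weighted_payoff \<gamma>) \<zeta> x a) + penalty a lam x s t" for t
    unfolding penalty_def slack_def condE_add[symmetric] by (simp add: flow_def)
  then have Lag_series: "Lag a lam \<gamma> x s
      = (\<Sum>t. \<beta> ^ t * (condE \<pi> [s] t (flow (weighted_payoff \<gamma>) \<zeta> x a) + penalty a lam x s t))"
    by (simp add: Ltil_def)
  have series_sums: "(\<lambda>t. \<beta> ^ t * (condE \<pi> [s] t (flow (weighted_payoff \<gamma>) \<zeta> x a) + penalty a lam x s t))
      sums (cont_value x a (weighted_payoff \<gamma>) [s] + total_penalty a lam x s)"
    unfolding distrib_left by (intro sums_add cont_sums penalty_sums bounded_weighted_payoff assms) simp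
  show "Lag a lam \<gamma> x s = cont_value x a (weighted_payoff \<gamma>) [s] + total_penalty a lam x s"
    unfolding Lag_series by (rule sums_unique[OF series_sums, symmetric])
  then show "(\<lambda>t. \<beta> ^ t * (condE \<pi> [s] t (flow (weighted_payoff \<gamma>) \<zeta> x a) + penalty a lam x s t))
      sums Lag a lam \<gamma> x s"
    using series_sums by simp
qed

lemma Lag_add:
  assumes "lam \<in> Mult" "x \<in> X" "a \<in> plans x"
  shows "Lag a lam (\<gamma> + \<mu>) x s = Lag a lam \<gamma> x s + (\<Sum>i\<in>UNIV. \<mu> $ i * cont_value x a (g i) [s])"
  using cont_weighted_payoff[OF assms(2,3), of "[s]" \<gamma>]
    cont_weighted_payoff[OF assms(2,3), of "[s]" "\<gamma> + \<mu>"]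
  by (simp add: Lag_eq[OF assms] distrib_right sum.distrib)

definition Lag_bound :: "(('s \<times> 'a) list \<Rightarrow> real ^ 'i) \<Rightarrow> real ^ 'i \<Rightarrow> 's \<Rightarrow> real" where
  "Lag_bound lam \<gamma> s = (1 + l1norm \<gamma>) * Lc + slack_bound * delayed_mass 0 lam s"

lemma abs_Lag_le:
  assumes "lam \<in> Mult" "x \<in> X" "a \<in> plans x"
  shows "\<bar>Lag a lam \<gamma> x s\<bar> \<le> Lag_bound lam \<gamma> s"
  unfolding Lag_bound_def Lag_eq[OF assms] cont_weighted_payoff[OF assms(2,3) not_Cons_self2[of _ "[]"]]
  using abs_total_penalty_le[OF assms, of s] abs_cont_r_le[OF assms(2,3), of "[s]"]
    abs_lincomb_cont_g_le[OF assms(2,3), of "[s]" \<gamma>]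
  by (simp add: distrib_right)

lemma Lag_bound_zero: "Lag_bound (\<lambda>_. 0) \<gamma> s = (1 + l1norm \<gamma>) * Lc"
  using history_sum_cmult[of _ _ 0] by (simp add: Lag_bound_def delayed_mass_def mult_mass_def)

abbreviation bellman_term ::
  "(real ^ 'i \<Rightarrow> 'x \<Rightarrow> 's \<Rightarrow> real) \<Rightarrow> real ^ 'i \<Rightarrow> 'x \<Rightarrow> 's \<Rightarrow> 'a \<Rightarrow> real ^ 'i \<Rightarrow> real" where
  "bellman_term F \<gamma> x s b \<mu> \<equiv> r x b s + (\<Sum>i\<in>UNIV. \<gamma> $ i * g i x b s + \<mu> $ i * (g i x b s - gbar i))
     + \<beta> * (\<Sum>s'\<in>UNIV. \<pi> s s' * F (\<gamma> + \<mu>) (\<zeta> x b s) s')"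

lemma bellman_term_le:
  assumes "\<And>s'. F (\<gamma> + \<mu>) (\<zeta> x b s) s' \<le> F' (\<gamma> + \<mu>) (\<zeta> x b s) s' + e s'"
  shows "bellman_term F \<gamma> x s b \<mu> \<le> bellman_term F' \<gamma> x s b \<mu> + \<beta> * expect s e"
proof -
  have "\<beta> * expect s (F (\<gamma> + \<mu>) (\<zeta> x b s)) \<le> \<beta> * expect s (\<lambda>s'. F' (\<gamma> + \<mu>) (\<zeta> x b s) s' + e s')"
    using beta assms by (intro mult_left_mono expect_mono) auto
  then show ?thesis
    unfolding expect_add by (simp add: distrib_left)
qed

lemma Lag_step:
  assumes lam_Mult: "lam \<in> Mult" and x_in_X: "x \<in> X" and a_plan: "a \<in> plans x"
  shows "Lag a lam \<gamma> x s =
    bellman_term (Lag (continuation_plan a s) (shift_mult lam s (a [s])))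
      \<gamma> x s (a [s]) (lam [(s, a [s])])"
proof -
  let ?a = "continuation_plan a s" and ?lam = "shift_mult lam s (a [s])" and ?x = "\<zeta> x (a [s]) s"
    and ?\<mu> = "lam [(s, a [s])]"
  note continuation = shift_mult_Mult[OF lam_Mult plan_step(1)[OF x_in_X a_plan]]
    plan_step(2,3)[OF x_in_X a_plan]
  have flow_Suc: "condE \<pi> [s] (Suc t) (flow f \<zeta> x a) = expect s (\<lambda>s'. condE \<pi> [s'] t (flow f \<zeta> ?x ?a))"
    for f t
    by (rule condE_flow_Suc)
  have slack_eq: "slack a x i [s]
      = g i x (a [s]) s - gbar i + \<beta> * expect s (\<lambda>s'. cont_value ?x ?a (g i) [s'])" for i
    unfolding slack_def cont_single[OF bounded_g x_in_X a_plan] by simp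
  have "(\<lambda>t. \<beta> ^ t * (condE \<pi> [s] t (flow (weighted_payoff \<gamma>) \<zeta> x a) + penalty a lam x s t))
      sums (condE \<pi> [s] 0 (flow (weighted_payoff \<gamma>) \<zeta> x a) + penalty a lam x s 0
        + \<beta> * expect s (Lag ?a ?lam \<gamma> ?x))"
    by (rule sums_discounted_Suc[OF _ Lag_sums[OF continuation]])
      (simp add: flow_Suc penalty_Suc expect_add)
  then have "Lag a lam \<gamma> x s = weighted_payoff \<gamma> x (a [s]) s + (\<Sum>i\<in>UNIV. ?\<mu> $ i * slack a x i [s])
      + \<beta> * expect s (Lag ?a ?lam \<gamma> ?x)"
    using Lag_sums[OF assms] by (simp add: penalty_0 sums_iff)
  also have "\<dots> = r x (a [s]) s + (\<Sum>i\<in>UNIV. \<gamma> $ i * g i x (a [s]) s + ?\<mu> $ i * (g i x (a [s]) s - gbar i))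
      + \<beta> * (expect s (Lag ?a ?lam \<gamma> ?x)
        + (\<Sum>i\<in>UNIV. ?\<mu> $ i * expect s (\<lambda>s'. cont_value ?x ?a (g i) [s'])))"
    unfolding slack_eq by (simp add: sum.distrib distrib_left sum_distrib_left mult.left_commute)
  also have "(\<Sum>i\<in>UNIV. ?\<mu> $ i * expect s (\<lambda>s'. cont_value ?x ?a (g i) [s']))
      = expect s (\<lambda>s'. \<Sum>i\<in>UNIV. ?\<mu> $ i * cont_value ?x ?a (g i) [s'])"
    unfolding sum_distrib_left by (subst sum.swap) (simp add: mult.left_commute)
  finally show ?thesis
    unfolding Lag_add[OF continuation] expect_add .
qed

section \<open>Optimal plans against a fixed multiplier\<close>

definition sup_Lag :: "(('s \<times> 'a) list \<Rightarrow> real ^ 'i) \<Rightarrow> real ^ 'i \<Rightarrow> 'x \<Rightarrow> 's \<Rightarrow> real" where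
  "sup_Lag lam \<gamma> x s = (SUP a\<in>plans x. Lag a lam \<gamma> x s)"

lemma bdd_above_Lag:
  assumes "lam \<in> Mult" "x \<in> X"
  shows "bdd_above ((\<lambda>a. Lag a lam \<gamma> x s) ` plans x)"
  using abs_Lag_le[OF assms, of _ \<gamma> s]
  by (intro bdd_aboveI2[where M = "Lag_bound lam \<gamma> s"]) (simp add: abs_le_iff)

lemma Lag_le_sup_Lag: "lam \<in> Mult \<Longrightarrow> x \<in> X \<Longrightarrow> a \<in> plans x \<Longrightarrow> Lag a lam \<gamma> x s \<le> sup_Lag lam \<gamma> x s"
  unfolding sup_Lag_def by (rule cSUP_upper[OF _ bdd_above_Lag])

lemma sup_Lag_least: "x \<in> X \<Longrightarrow> (\<And>a. a \<in> plans x \<Longrightarrow> Lag a lam \<gamma> x s \<le> y) \<Longrightarrow> sup_Lag lam \<gamma> x s \<le> y"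
  unfolding sup_Lag_def using ex_plan by (intro cSUP_least) auto

lemma less_sup_LagE:
  assumes "lam \<in> Mult" "x \<in> X" "y < sup_Lag lam \<gamma> x s"
  obtains a where "a \<in> plans x" "y < Lag a lam \<gamma> x s"
  using assms less_cSUP_iff[OF _ bdd_above_Lag[OF assms(1,2)]] ex_plan[OF assms(2)]
  unfolding sup_Lag_def by blast

lemma ereal_sup_Lag:
  assumes "lam \<in> Mult" "x \<in> X"
  shows "ereal (sup_Lag lam \<gamma> x s) = (SUP a\<in>plans x. ereal (Lag a lam \<gamma> x s))"
proof -
  let ?B = "Lag_bound lam \<gamma> s"
  have "- ?B \<le> Lag a lam \<gamma> x s \<and> Lag a lam \<gamma> x s \<le> ?B" if "a \<in> plans x" for a
    using abs_Lag_le[OF assms that, of \<gamma> s] by linarith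
  then show ?thesis
    unfolding sup_Lag_def using ex_plan[OF assms(2)]
    by (intro ereal_SUP ereal_SUP_not_infty[where l = "ereal (- ?B)" and u = "ereal ?B"]) auto
qed

lemma abs_sup_Lag_le:
  assumes "lam \<in> Mult" "x \<in> X"
  shows "\<bar>sup_Lag lam \<gamma> x s\<bar> \<le> Lag_bound lam \<gamma> s"
proof -
  have "sup_Lag lam \<gamma> x s \<le> Lag_bound lam \<gamma> s"
    using abs_Lag_le[OF assms] by (intro sup_Lag_least[OF assms(2)]) (simp add: abs_le_iff)
  moreover obtain a where a_plan: "a \<in> plans x"
    using ex_plan[OF assms(2)] by blast
  ultimately show ?thesis
    using Lag_le_sup_Lag[OF assms a_plan, of \<gamma> s] abs_Lag_le[OF assms a_plan, of \<gamma> s] by linarith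
qed

lemma prepend_action_plan:
  assumes x_in_X: "x \<in> X" and b_legal: "b \<in> Atil A p x s" and c_plans: "\<And>s'. c s' \<in> plans (\<zeta> x b s)"
  obtains a where "a \<in> plans x" "a [s] = b" "continuation_plan a s = splice_plans c"
proof -
  obtain a where a_plan: "a \<in> plans x"
    using ex_plan[OF x_in_X] by blast
  let ?b = "\<lambda>s'. if s' = s then b else a [s']"
    and ?c = "\<lambda>s'. if s' = s then splice_plans c else continuation_plan a s'"
  have "cons_plan ?b ?c \<in> plans x"
    using b_legal splice_plans_Ainf[OF c_plans] plan_first_action[OF a_plan]
      continuation_plan_Ainf[OF a_plan]
    by (intro cons_plan_Ainf) auto
  moreover have "continuation_plan (cons_plan ?b ?c) s = splice_plans c"
    by (subst continuation_cons_plan) (simp_all add: splice_plans_def)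
  ultimately show thesis
    using that[of "cons_plan ?b ?c"] by simp
qed

lemma bellman_term_le_sup_Lag:
  assumes lam_Mult: "lam \<in> Mult" and x_in_X: "x \<in> X" and b_legal: "b \<in> Atil A p x s"
  shows "bellman_term (sup_Lag (shift_mult lam s b)) \<gamma> x s b (lam [(s, b)]) \<le> sup_Lag lam \<gamma> x s"
proof (rule field_le_epsilon)
  fix e :: real assume e_pos: "0 < e"
  let ?\<gamma> = "\<gamma> + lam [(s, b)]" and ?lam = "shift_mult lam s b" and ?x = "\<zeta> x b s"
  have b_in_A: "b \<in> A"
    by (rule AtilD[OF b_legal])
  have "\<exists>c\<in>plans ?x. sup_Lag ?lam ?\<gamma> ?x s' - e < Lag c ?lam ?\<gamma> ?x s'" for s'
    by (rule less_sup_LagE[OF shift_mult_Mult[OF lam_Mult b_in_A] zeta_X[OF x_in_X b_in_A],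
          of "sup_Lag ?lam ?\<gamma> ?x s' - e"])
      (use e_pos in auto)
  then obtain c where c_nearly_optimal: "\<And>s'. c s' \<in> plans ?x"
      "\<And>s'. sup_Lag ?lam ?\<gamma> ?x s' - e < Lag (c s') ?lam ?\<gamma> ?x s'"
    by metis
  obtain a where a_prepended: "a \<in> plans x" "a [s] = b" "continuation_plan a s = splice_plans c"
    using prepend_action_plan[OF x_in_X b_legal c_nearly_optimal(1)] .
  have "Lag (splice_plans c) ?lam ?\<gamma> ?x s' = Lag (c s') ?lam ?\<gamma> ?x s'" for s'
    by (rule Ltil_agree) (simp_all add: splice_plans_def)
  then have "sup_Lag ?lam ?\<gamma> ?x s' \<le> Lag (continuation_plan a s) ?lam ?\<gamma> ?x s' + e" for s'
    using c_nearly_optimal(2)[of s'] a_prepended(3) by simp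
  then have "bellman_term (sup_Lag ?lam) \<gamma> x s b (lam [(s, b)])
      \<le> bellman_term (Lag (continuation_plan a s) ?lam) \<gamma> x s b (lam [(s, b)]) + \<beta> * expect s (\<lambda>_. e)"
    by (rule bellman_term_le)
  also have "\<dots> = Lag a lam \<gamma> x s + \<beta> * e"
    unfolding Lag_step[OF lam_Mult x_in_X a_prepended(1)] a_prepended(2) by simp
  also have "\<dots> \<le> sup_Lag lam \<gamma> x s + e"
    using Lag_le_sup_Lag[OF lam_Mult x_in_X a_prepended(1)] beta e_pos by (intro add_mono) auto
  finally show "bellman_term (sup_Lag ?lam) \<gamma> x s b (lam [(s, b)]) \<le> sup_Lag lam \<gamma> x s + e" .
qed

lemma sup_Lag_le_if_bellman_term_le:
  assumes lam_Mult: "lam \<in> Mult" and x_in_X: "x \<in> X"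
    and bellman_term_le_y: "\<And>b. b \<in> Atil A p x s
        \<Longrightarrow> bellman_term (sup_Lag (shift_mult lam s b)) \<gamma> x s b (lam [(s, b)]) \<le> y"
  shows "sup_Lag lam \<gamma> x s \<le> y"
proof (rule sup_Lag_least[OF x_in_X])
  fix a assume a_plan: "a \<in> plans x"
  let ?lam = "shift_mult lam s (a [s])"
  have "Lag (continuation_plan a s) ?lam \<gamma>' (\<zeta> x (a [s]) s) s' \<le> sup_Lag ?lam \<gamma>' (\<zeta> x (a [s]) s) s' + 0"
    for \<gamma>' s'
    using Lag_le_sup_Lag[OF shift_mult_Mult[OF lam_Mult plan_step(1)[OF x_in_X a_plan]]
        plan_step(2,3)[OF x_in_X a_plan]] by simp
  then have "Lag a lam \<gamma> x s
      \<le> bellman_term (sup_Lag ?lam) \<gamma> x s (a [s]) (lam [(s, a [s])]) + \<beta> * expect s (\<lambda>_. 0)"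
    unfolding Lag_step[OF lam_Mult x_in_X a_plan] by (rule bellman_term_le)
  also have "\<dots> = bellman_term (sup_Lag ?lam) \<gamma> x s (a [s]) (lam [(s, a [s])])"
    by simp
  also have "\<dots> \<le> y"
    by (rule bellman_term_le_y[OF plan_first_action[OF a_plan]])
  finally show "Lag a lam \<gamma> x s \<le> y" .
qed

section \<open>The dual value\<close>

lemma feasible_payoff_le_Lag:
  assumes lam_Mult: "lam \<in> Mult" and x_in_X: "x \<in> X" and "feasible_plan x s a"
  shows "cont_value x a (weighted_payoff \<gamma>) [s] \<le> Lag a lam \<gamma> x s"
proof -
  have a_plan: "a \<in> plans x" and slack_nonneg: "\<And>e i. 0 \<le> slack a x i ([s] @ e)"
    using assms(3) by (auto simp: feasible_def Hist_def slack_def)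
  have "0 \<le> penalty a lam x s t" for t
  proof -
    have "condE \<pi> [s] t (\<lambda>_. 0) \<le> penalty a lam x s t"
      unfolding penalty_def using nonneg_multD[OF lam_Mult] htil_in_Htil[OF a_plan, of s] slack_nonneg
      by (intro condE_mono sum_nonneg mult_nonneg_nonneg) (auto simp: nonneg_mult_def)
    then show ?thesis
      by (simp add: condE_const)
  qed
  then have "0 \<le> total_penalty a lam x s"
    using beta by (intro sums_le[OF _ sums_zero penalty_sums[OF lam_Mult x_in_X a_plan]]) simp
  then show ?thesis
    by (simp add: Lag_eq[OF lam_Mult x_in_X a_plan])
qed

text \<open>The norm of the function space evaluates at \<open>from_nat_into X\<close>, which is arbitrary if \<open>X\<close> is empty.\<close>

definition dual_value :: "real ^ 'i \<Rightarrow> 'x \<Rightarrow> 's \<Rightarrow> real" where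
  "dual_value \<gamma> x s = (if x \<in> X then INF lam\<in>Mult. sup_Lag lam \<gamma> x s else 0)"

lemma Mult_nonempty: "Mult \<noteq> {}"
  using zero_Mult by auto

lemma feasible_payoff_le_sup_Lag:
  assumes "lam \<in> Mult" "x \<in> X" "feasible_plan x s a"
  shows "cont_value x a (weighted_payoff \<gamma>) [s] \<le> sup_Lag lam \<gamma> x s"
  using assms by (intro order_trans[OF feasible_payoff_le_Lag Lag_le_sup_Lag]) (auto simp: feasible_def)

lemma bdd_below_sup_Lag:
  assumes "x \<in> X"
  shows "bdd_below ((\<lambda>lam. sup_Lag lam \<gamma> x s) ` Mult)"
proof -
  obtain a where "feasible_plan x s a"
    using feas_ex[OF assms] by blast
  then show ?thesis
    by (intro bdd_belowI2[where m = "cont_value x a (weighted_payoff \<gamma>) [s]"]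
        feasible_payoff_le_sup_Lag assms)
qed

lemma dual_value_le: "lam \<in> Mult \<Longrightarrow> x \<in> X \<Longrightarrow> dual_value \<gamma> x s \<le> sup_Lag lam \<gamma> x s"
  by (simp add: dual_value_def cINF_lower[OF bdd_below_sup_Lag])

lemma dual_value_greatest: "x \<in> X \<Longrightarrow> (\<And>lam. lam \<in> Mult \<Longrightarrow> y \<le> sup_Lag lam \<gamma> x s) \<Longrightarrow> y \<le> dual_value \<gamma> x s"
  by (simp add: dual_value_def cINF_greatest[OF Mult_nonempty])

lemma dual_value_lessE:
  assumes "x \<in> X" "dual_value \<gamma> x s < y"
  obtains lam where "lam \<in> Mult" "sup_Lag lam \<gamma> x s < y"
  using assms(2) cINF_less_iff[OF Mult_nonempty bdd_below_sup_Lag[OF assms(1)]] assms(1)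
  by (auto simp: dual_value_def)

lemma ex_nearly_optimal_mult:
  assumes "x \<in> X" "0 < e"
  shows "\<exists>lam\<in>Mult. sup_Lag lam \<gamma> x s \<le> dual_value \<gamma> x s + e"
proof -
  have "dual_value \<gamma> x s < dual_value \<gamma> x s + e"
    using assms(2) by simp
  then show ?thesis
    by (rule dual_value_lessE[OF assms(1)]) (auto intro: less_imp_le)
qed

lemma ereal_dual_value: "x \<in> X \<Longrightarrow> ereal (dual_value \<gamma> x s) = (INF lam\<in>Mult. ereal (sup_Lag lam \<gamma> x s))"
  using ereal_Inf'[OF bdd_below_sup_Lag, of x \<gamma> s] Mult_nonempty by (simp add: dual_value_def image_comp)

lemma Dtil_eq_dual_value:
  assumes "x \<in> X"
  shows "Dtil A p \<beta> \<pi> \<zeta> r g gbar \<gamma> x s = ereal (dual_value \<gamma> x s)"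
  unfolding Dtil_def ereal_dual_value[OF assms] by (intro INF_cong refl ereal_sup_Lag[symmetric] assms)

lemma feasible_payoff_le_dual_value:
  "x \<in> X \<Longrightarrow> feasible_plan x s a \<Longrightarrow> cont_value x a (weighted_payoff \<gamma>) [s] \<le> dual_value \<gamma> x s"
  by (intro dual_value_greatest feasible_payoff_le_sup_Lag)

lemma abs_dual_value_le: "x \<in> X \<Longrightarrow> \<bar>dual_value \<gamma> x s\<bar> \<le> (1 + l1norm \<gamma>) * Lc"
proof -
  assume x_in_X: "x \<in> X"
  obtain a where feasible: "feasible_plan x s a"
    using feas_ex[OF x_in_X] by blast
  then have a_plan: "a \<in> plans x"
    by (simp add: feasible_def)
  have "- ((1 + l1norm \<gamma>) * Lc) \<le> cont_value x a (weighted_payoff \<gamma>) [s]"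
    using abs_cont_r_le[OF x_in_X a_plan, of "[s]"] abs_lincomb_cont_g_le[OF x_in_X a_plan, of "[s]" \<gamma>]
      cont_weighted_payoff[OF x_in_X a_plan, of "[s]" \<gamma>] by (simp add: distrib_right)
  also have "\<dots> \<le> dual_value \<gamma> x s"
    by (rule feasible_payoff_le_dual_value[OF x_in_X feasible])
  moreover have "dual_value \<gamma> x s \<le> (1 + l1norm \<gamma>) * Lc"
    using dual_value_le[OF zero_Mult x_in_X, of \<gamma> s] abs_sup_Lag_le[OF zero_Mult x_in_X, of \<gamma> s]
    by (simp add: Lag_bound_zero)
  ultimately show ?thesis
    by linarith
qed

lemma Mult_nonneg_combination:
  assumes "lam1 \<in> Mult" "lam2 \<in> Mult" "0 \<le> c1" "0 \<le> c2"
  shows "(\<lambda>k. c1 *\<^sub>R lam1 k + c2 *\<^sub>R lam2 k) \<in> Mult"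
proof -
  have "mult_mass (\<lambda>k. c1 *\<^sub>R lam1 k + c2 *\<^sub>R lam2 k) t s
      = c1 * mult_mass lam1 t s + c2 * mult_mass lam2 t s" for t s
    by (simp add: mult_mass_def history_sum_add history_sum_cmult sum.distrib flip: sum_distrib_left)
  moreover have "summable (\<lambda>t. c1 * (\<beta> ^ t * mult_mass lam1 t s) + c2 * (\<beta> ^ t * mult_mass lam2 t s))"
    for s
    by (intro summable_add summable_mult mult_mass_summable assms)
  moreover have "nonneg_mult (\<lambda>k. c1 *\<^sub>R lam1 k + c2 *\<^sub>R lam2 k)"
    using nonneg_multD[OF assms(1)] nonneg_multD[OF assms(2)] assms(3,4) by (simp add: nonneg_mult_def)
  ultimately show ?thesis
    by (simp add: Mult_iff distrib_left mult.left_commute)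
qed

lemma total_penalty_lincomb:
  assumes lam_Mult: "lam1 \<in> Mult" "lam2 \<in> Mult" and x_in_X: "x \<in> X"
    and a_plan: "a \<in> plans x"
  shows "total_penalty a (\<lambda>k. c1 *\<^sub>R lam1 k + c2 *\<^sub>R lam2 k) x s
    = c1 * total_penalty a lam1 x s + c2 * total_penalty a lam2 x s" (is "total_penalty a ?lam x s = _")
proof -
  have "penalty a ?lam x s t = c1 * penalty a lam1 x s t + c2 * penalty a lam2 x s t" for t
    unfolding penalty_def condE_cmult[symmetric] condE_add[symmetric]
    by (simp add: sum.distrib sum_distrib_left distrib_right mult.assoc)
  then have "\<beta> ^ t * penalty a ?lam x s t
      = c1 * (\<beta> ^ t * penalty a lam1 x s t) + c2 * (\<beta> ^ t * penalty a lam2 x s t)" for t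
    by (simp add: distrib_left mult.left_commute)
  moreover have "(\<lambda>t. c1 * (\<beta> ^ t * penalty a lam1 x s t) + c2 * (\<beta> ^ t * penalty a lam2 x s t)) sums
      (c1 * total_penalty a lam1 x s + c2 * total_penalty a lam2 x s)"
    by (intro sums_add sums_mult penalty_sums lam_Mult x_in_X a_plan)
  ultimately show ?thesis
    by (simp add: total_penalty_def sums_iff)
qed

lemma Lag_convex_combination:
  assumes lam_Mult: "lam1 \<in> Mult" "lam2 \<in> Mult" and u_bounds: "0 \<le> u" "u \<le> 1" and x_in_X: "x \<in> X"
    and a_plan: "a \<in> plans x"
  shows "Lag a (\<lambda>k. (1 - u) *\<^sub>R lam1 k + u *\<^sub>R lam2 k) ((1 - u) *\<^sub>R \<gamma>1 + u *\<^sub>R \<gamma>2) x s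
    = (1 - u) * Lag a lam1 \<gamma>1 x s + u * Lag a lam2 \<gamma>2 x s"
proof -
  have "cont_value x a (weighted_payoff \<gamma>) [s]
      = cont_value x a r [s] + (\<Sum>i\<in>UNIV. \<gamma> $ i * cont_value x a (g i) [s])" for \<gamma>
    by (rule cont_weighted_payoff[OF x_in_X a_plan]) simp
  moreover have "(\<lambda>k. (1 - u) *\<^sub>R lam1 k + u *\<^sub>R lam2 k) \<in> Mult"
    using u_bounds by (intro Mult_nonneg_combination lam_Mult) auto
  moreover have "total_penalty a (\<lambda>k. (1 - u) *\<^sub>R lam1 k + u *\<^sub>R lam2 k) x s
      = (1 - u) * total_penalty a lam1 x s + u * total_penalty a lam2 x s"
    by (intro total_penalty_lincomb lam_Mult x_in_X a_plan)
  ultimately show ?thesis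
    by (simp only: Lag_eq lam_Mult x_in_X a_plan)
      (simp add: algebra_simps sum.distrib sum_distrib_left sum_subtractf)
qed

lemma dual_value_convex:
  assumes x_in_X: "x \<in> X"
  shows "convex_on nonneg (\<lambda>\<gamma>. dual_value \<gamma> x s)"
proof -
  have "convex_on nonneg (\<lambda>\<gamma>. INF lam\<in>Mult. sup_Lag lam \<gamma> x s)"
  proof (rule convex_on_cINF[OF nonneg_convex Mult_nonempty bdd_below_sup_Lag[OF x_in_X]])
    fix lam1 lam2 and \<gamma>1 \<gamma>2 :: "real ^ 'i" and u :: real
    assume lam_Mult: "lam1 \<in> Mult" "lam2 \<in> Mult" and u_bounds: "0 < u" "u < 1"
    let ?lam = "\<lambda>k. (1 - u) *\<^sub>R lam1 k + u *\<^sub>R lam2 k"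
    have "sup_Lag ?lam ((1 - u) *\<^sub>R \<gamma>1 + u *\<^sub>R \<gamma>2) x s
        \<le> (1 - u) * sup_Lag lam1 \<gamma>1 x s + u * sup_Lag lam2 \<gamma>2 x s"
    proof (rule sup_Lag_least[OF x_in_X])
      fix a assume a_plan: "a \<in> plans x"
      have "(1 - u) * Lag a lam1 \<gamma>1 x s + u * Lag a lam2 \<gamma>2 x s
          \<le> (1 - u) * sup_Lag lam1 \<gamma>1 x s + u * sup_Lag lam2 \<gamma>2 x s"
        using u_bounds by (intro add_mono mult_left_mono Lag_le_sup_Lag lam_Mult x_in_X a_plan) auto
      then show "Lag a ?lam ((1 - u) *\<^sub>R \<gamma>1 + u *\<^sub>R \<gamma>2) x s
          \<le> (1 - u) * sup_Lag lam1 \<gamma>1 x s + u * sup_Lag lam2 \<gamma>2 x s"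
        using Lag_convex_combination[OF lam_Mult _ _ x_in_X a_plan] u_bounds by simp
    qed
    moreover have "?lam \<in> Mult"
      using u_bounds by (intro Mult_nonneg_combination lam_Mult) auto
    ultimately show "\<exists>lam\<in>Mult. sup_Lag lam ((1 - u) *\<^sub>R \<gamma>1 + u *\<^sub>R \<gamma>2) x s
        \<le> (1 - u) * sup_Lag lam1 \<gamma>1 x s + u * sup_Lag lam2 \<gamma>2 x s"
      by blast
  qed
  then show ?thesis
    by (simp add: dual_value_def x_in_X)
qed

lemma sup_Lag_add_le:
  assumes "lam \<in> Mult" "x \<in> X"
  shows "sup_Lag lam (\<gamma> + \<mu>) x s \<le> sup_Lag lam \<gamma> x s + Lc * l1norm \<mu>"
proof (rule sup_Lag_least[OF assms(2)])
  fix a assume a_plan: "a \<in> plans x"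
  show "Lag a lam (\<gamma> + \<mu>) x s \<le> sup_Lag lam \<gamma> x s + Lc * l1norm \<mu>"
    using Lag_add[OF assms a_plan, of \<gamma> \<mu> s] Lag_le_sup_Lag[OF assms a_plan, of \<gamma> s]
      abs_lincomb_cont_g_le[OF assms(2) a_plan, of "[s]" \<mu>] by (simp add: mult.commute)
qed

lemma dual_value_add_le:
  assumes "x \<in> X"
  shows "dual_value (\<gamma> + \<mu>) x s \<le> dual_value \<gamma> x s + Lc * l1norm \<mu>"
proof -
  have "dual_value (\<gamma> + \<mu>) x s - Lc * l1norm \<mu> \<le> dual_value \<gamma> x s"
  proof (rule dual_value_greatest[OF assms])
    fix lam assume lam_Mult: "lam \<in> Mult"
    show "dual_value (\<gamma> + \<mu>) x s - Lc * l1norm \<mu> \<le> sup_Lag lam \<gamma> x s"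
      using dual_value_le[OF lam_Mult assms, of "\<gamma> + \<mu>" s] sup_Lag_add_le[OF lam_Mult assms, of \<gamma> \<mu> s]
      by linarith
  qed
  then show ?thesis
    by simp
qed

lemma dual_value_lipschitz:
  assumes "x \<in> X"
  shows "\<bar>dual_value \<gamma>1 x s - dual_value \<gamma>2 x s\<bar> \<le> Lc * l1norm (\<gamma>1 - \<gamma>2)"
proof -
  have "l1norm (\<gamma>2 - \<gamma>1) = l1norm (\<gamma>1 - \<gamma>2)"
    by (simp add: abs_minus_commute)
  then show ?thesis
    using dual_value_add_le[OF assms, of \<gamma>1 "\<gamma>2 - \<gamma>1" s] dual_value_add_le[OF assms, of \<gamma>2 "\<gamma>1 - \<gamma>2" s]
    by (simp add: abs_le_iff)
qed

lemma dual_value_inM: "inM X dual_value"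
proof (rule inM_if_linear_growth)
  show "continuous_on nonneg (\<lambda>\<gamma>. dual_value \<gamma> x s)" for x s
  proof (cases "x \<in> X")
    case True
    then show ?thesis
      by (intro continuous_on_if_l1_lipschitz[OF Lconst_nonneg dual_value_lipschitz])
  qed (simp add: dual_value_def)
  show "\<bar>dual_value \<gamma> x s\<bar> \<le> (1 + l1norm \<gamma>) * max 0 Lc" for \<gamma> x s
  proof (cases "x \<in> X")
    case True
    then show ?thesis
      using abs_dual_value_le[of x \<gamma> s] Lconst_nonneg by (simp add: max_absorb2)
  qed (simp add: dual_value_def sum_nonneg)
qed simp

theorem dual_value_inN: "inN X A p \<beta> \<pi> \<zeta> r g gbar dual_value"
  unfolding inN_def
proof (intro conjI ballI allI impI dual_value_inM dual_value_convex)
  fix x s and \<gamma>1 \<gamma>2 :: "real ^ 'i" assume "x \<in> X"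
  then show "\<bar>dual_value \<gamma>1 x s - dual_value \<gamma>2 x s\<bar> \<le> Lc * (\<Sum>i\<in>UNIV. \<bar>\<gamma>1 $ i - \<gamma>2 $ i\<bar>)"
    using dual_value_lipschitz[of x \<gamma>1 s \<gamma>2] by simp
next
  fix x s a and \<gamma> :: "real ^ 'i" assume x_in_X: "x \<in> X" and feasible: "feasible_plan x s a"
  then have "a \<in> plans x"
    by (simp add: feasible_def)
  then show "cont_value x a r [s] + (\<Sum>i\<in>UNIV. \<gamma> $ i * cont_value x a (g i) [s]) \<le> dual_value \<gamma> x s"
    using feasible_payoff_le_dual_value[OF x_in_X feasible, of \<gamma>]
      cont_weighted_payoff[OF x_in_X, of a "[s]" \<gamma>] by simp
next
  fix x s and \<gamma> :: "real ^ 'i" assume "x \<in> X" "\<gamma> \<in> nonneg"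
  then show "dual_value \<gamma> x s \<le> (1 + (\<Sum>i\<in>UNIV. \<gamma> $ i)) * Lc"
    using abs_dual_value_le[of x \<gamma> s] by (simp add: l1norm_nonneg_eq)
qed

section \<open>The functional equation\<close>

definition paste_mult ::
  "('a \<Rightarrow> 'v) \<Rightarrow> ('a \<Rightarrow> 's \<Rightarrow> ('s \<times> 'a) list \<Rightarrow> 'v::zero) \<Rightarrow> ('s \<times> 'a) list \<Rightarrow> 'v" where
  "paste_mult \<mu> l k = (case k of [] \<Rightarrow> 0 | (s, b) # k' \<Rightarrow> if k' = [] then \<mu> b else l b (fst (hd k')) k')"

lemma paste_mult_single [simp]: "paste_mult \<mu> l [(s, b)] = \<mu> b"
  by (simp add: paste_mult_def)

lemma paste_mult_Cons: "k \<noteq> [] \<Longrightarrow> paste_mult \<mu> l ((s, b) # k) = l b (fst (hd k)) k"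
  by (simp add: paste_mult_def)

lemma mult_mass_shift_paste: "mult_mass (shift_mult (paste_mult \<mu> l) s b) t s' = mult_mass (l b s') t s'"
  unfolding mult_mass_def by (rule history_sum_cong) (simp add: paste_mult_Cons Htil_nonempty)

lemma sup_Lag_shift_paste: "sup_Lag (shift_mult (paste_mult \<mu> l) s b) \<gamma> x s' = sup_Lag (l b s') \<gamma> x s'"
proof -
  have "Lag a (shift_mult (paste_mult \<mu> l) s b) \<gamma> x s' = Lag a (l b s') \<gamma> x s'" for a
    by (rule Ltil_agree) (simp_all add: paste_mult_Cons)
  then show ?thesis
    by (simp add: sup_Lag_def)
qed

lemma paste_mult_Mult:
  assumes \<mu>_nonneg: "\<And>b. b \<in> A \<Longrightarrow> \<mu> b \<in> nonneg" and l_Mult: "\<And>b s. b \<in> A \<Longrightarrow> l b s \<in> Mult"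
  shows "paste_mult \<mu> l \<in> Mult"
  unfolding Mult_iff nonneg_mult_def
proof (intro conjI allI ballI)
  fix t i and k :: "('s \<times> 'a) list" assume "k \<in> Htil A t"
  then obtain s b k' where k_eq: "k = (s, b) # k'" and b_in_A: "b \<in> A"
    and k'_histories: "k' \<in> histories A t"
    by (cases k) (auto simp: Htil_eq_histories histories_def)
  show "0 \<le> paste_mult \<mu> l k $ i"
  proof (cases t)
    case 0
    then show ?thesis
      using \<mu>_nonneg[OF b_in_A] k'_histories by (simp add: k_eq nonneg_def)
  next
    case (Suc t')
    then have "k' \<in> Htil A t'"
      using k'_histories by (simp add: Htil_eq_histories)
    then show ?thesis
      using nonneg_multD[OF l_Mult[OF b_in_A]] Htil_nonempty[of k' A t']
      by (simp add: k_eq paste_mult_Cons nonneg_mult_def)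
  qed
next
  fix s
  have "summable (\<lambda>t. \<Sum>b\<in>A. \<beta> * expect s (\<lambda>s'. \<beta> ^ t * mult_mass (l b s') t s'))"
    by (intro summable_sum summable_mult mult_mass_summable l_Mult)
  moreover have "(\<Sum>b\<in>A. \<beta> * expect s (\<lambda>s'. \<beta> ^ t * mult_mass (l b s') t s'))
      = \<beta> ^ Suc t * mult_mass (paste_mult \<mu> l) (Suc t) s" for t
    by (simp add: mult_mass_Suc mult_mass_shift_paste sum_distrib_left ac_simps)
  ultimately have "summable (\<lambda>t. \<beta> ^ Suc t * mult_mass (paste_mult \<mu> l) (Suc t) s)"
    by simp
  then show "summable (\<lambda>t. \<beta> ^ t * mult_mass (paste_mult \<mu> l) t s)"
    by (subst (asm) summable_Suc_iff)
qed

lemma INF_bellman_term_le_dual_value: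
  assumes x_in_X: "x \<in> X" and b_legal: "b \<in> Atil A p x s"
  shows "(INF \<mu>\<in>nonneg. ereal (bellman_term dual_value \<gamma> x s b \<mu>)) \<le> ereal (dual_value \<gamma> x s)"
  unfolding ereal_dual_value[OF x_in_X]
proof (rule INF_greatest)
  fix lam assume lam_Mult: "lam \<in> Mult"
  note b_in_A = AtilD[OF b_legal]
  have "bellman_term dual_value \<gamma> x s b (lam [(s, b)])
      \<le> bellman_term (sup_Lag (shift_mult lam s b)) \<gamma> x s b (lam [(s, b)]) + \<beta> * expect s (\<lambda>_. 0)"
    using dual_value_le[OF shift_mult_Mult[OF lam_Mult b_in_A] zeta_X[OF x_in_X b_in_A]]
    by (intro bellman_term_le) simp
  also have "\<dots> \<le> sup_Lag lam \<gamma> x s"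
    using bellman_term_le_sup_Lag[OF lam_Mult x_in_X b_legal] by simp
  finally show "(INF \<mu>\<in>nonneg. ereal (bellman_term dual_value \<gamma> x s b \<mu>)) \<le> ereal (sup_Lag lam \<gamma> x s)"
    by (intro INF_lower2[OF first_mult_nonneg[OF nonneg_multD[OF lam_Mult] b_in_A]]) simp
qed

lemma dual_value_le_if_bellman_term_le:
  assumes x_in_X: "x \<in> X"
    and ex_bellman_term_le: "\<And>b. b \<in> Atil A p x s \<Longrightarrow> \<exists>\<mu>\<in>nonneg. bellman_term dual_value \<gamma> x s b \<mu> \<le> y"
  shows "dual_value \<gamma> x s \<le> y"
proof (rule field_le_epsilon)
  fix e :: real assume "0 < e"
  have "\<exists>\<mu>. \<mu> \<in> nonneg \<and> (b \<in> Atil A p x s \<longrightarrow> bellman_term dual_value \<gamma> x s b \<mu> \<le> y)" for b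
    using ex_bellman_term_le[of b]
    by (cases "b \<in> Atil A p x s") (auto simp: nonneg_def intro: exI[of _ 0])
  then have "\<exists>\<mu>. \<forall>b. \<mu> b \<in> nonneg \<and> (b \<in> Atil A p x s \<longrightarrow> bellman_term dual_value \<gamma> x s b (\<mu> b) \<le> y)"
    by (intro choice allI)
  then obtain \<mu> where \<mu>_nonneg: "\<And>b. \<mu> b \<in> nonneg"
    and \<mu>_le: "\<And>b. b \<in> Atil A p x s \<Longrightarrow> bellman_term dual_value \<gamma> x s b (\<mu> b) \<le> y"
    by blast
  have "\<exists>lam\<in>Mult. b \<in> A \<longrightarrow>
      sup_Lag lam (\<gamma> + \<mu> b) (\<zeta> x b s) s' \<le> dual_value (\<gamma> + \<mu> b) (\<zeta> x b s) s' + e" for b s'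
    using ex_nearly_optimal_mult[OF zeta_X[OF x_in_X] \<open>0 < e\<close>] zero_Mult by (cases "b \<in> A") auto
  then obtain l where l_Mult: "\<And>b s'. l b s' \<in> Mult"
    and nearly_optimal: "\<And>b s'. b \<in> A \<Longrightarrow>
      sup_Lag (l b s') (\<gamma> + \<mu> b) (\<zeta> x b s) s' \<le> dual_value (\<gamma> + \<mu> b) (\<zeta> x b s) s' + e"
    by metis
  let ?lam = "paste_mult \<mu> l"
  have lam_Mult: "?lam \<in> Mult"
    by (intro paste_mult_Mult l_Mult \<mu>_nonneg)
  have "sup_Lag ?lam \<gamma> x s \<le> y + e"
  proof (rule sup_Lag_le_if_bellman_term_le[OF lam_Mult x_in_X])
    fix b assume b_legal: "b \<in> Atil A p x s"
    have "bellman_term (sup_Lag (shift_mult ?lam s b)) \<gamma> x s b (\<mu> b)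
        \<le> bellman_term dual_value \<gamma> x s b (\<mu> b) + \<beta> * expect s (\<lambda>_. e)"
      using nearly_optimal[OF AtilD[OF b_legal]]
      by (intro bellman_term_le) (simp add: sup_Lag_shift_paste)
    also have "\<dots> \<le> y + e"
      using \<mu>_le[OF b_legal] beta \<open>0 < e\<close> by (intro add_mono) auto
    finally show "bellman_term (sup_Lag (shift_mult ?lam s b)) \<gamma> x s b (?lam [(s, b)]) \<le> y + e"
      by simp
  qed
  then show "dual_value \<gamma> x s \<le> y + e"
    using dual_value_le[OF lam_Mult x_in_X, of \<gamma> s] by linarith
qed

theorem dual_value_Bellman: "solves_Bellman dual_value"
  unfolding Bellman_def
proof (intro ballI allI antisym)
  fix \<gamma> :: "real ^ 'i" and x s assume x_in_X: "x \<in> X"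
  let ?rhs = "SUP b\<in>Atil A p x s. INF \<mu>\<in>nonneg. ereal (bellman_term dual_value \<gamma> x s b \<mu>)"
  show "?rhs \<le> ereal (dual_value \<gamma> x s)"
    by (intro SUP_least INF_bellman_term_le_dual_value x_in_X)
  show "ereal (dual_value \<gamma> x s) \<le> ?rhs"
  proof (rule dense_ge)
    fix w assume rhs_less: "?rhs < w"
    show "ereal (dual_value \<gamma> x s) \<le> w"
    proof (cases w)
      case (real y)
      have "\<exists>\<mu>\<in>nonneg. bellman_term dual_value \<gamma> x s b \<mu> \<le> y" if "b \<in> Atil A p x s" for b
      proof -
        have "(INF \<mu>\<in>nonneg. ereal (bellman_term dual_value \<gamma> x s b \<mu>)) < ereal y"
          using le_less_trans[OF SUP_upper[OF that] rhs_less] by (simp add: real)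
        then show ?thesis
          unfolding INF_less_iff by (auto intro: less_imp_le)
      qed
      then show ?thesis
        by (simp add: real dual_value_le_if_bellman_term_le[OF x_in_X])
    qed (use rhs_less in auto)
  qed
qed

lemma Bellman_greedy_action:
  assumes "solves_Bellman G" "x \<in> X" "\<gamma> \<in> nonneg"
  obtains b where "b \<in> Atil A p x s" "\<And>\<mu>. \<mu> \<in> nonneg \<Longrightarrow> G \<gamma> x s \<le> bellman_term G \<gamma> x s b \<mu>"
proof -
  let ?f = "\<lambda>b. INF \<mu>\<in>nonneg. ereal (bellman_term G \<gamma> x s b \<mu>)"
  obtain a where "a \<in> plans x"
    using ex_plan[OF assms(2)] by blast
  then have nonempty: "Atil A p x s \<noteq> {}"
    using plan_first_action[of a A p \<zeta> x s] by blast
  have "finite (Atil A p x s)"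
    using A_fin by (simp add: Atil_def)
  with nonempty have finite_nonempty: "finite (?f ` Atil A p x s)" "?f ` Atil A p x s \<noteq> {}"
    by auto
  have "ereal (G \<gamma> x s) = Max (?f ` Atil A p x s)"
    using assms finite_nonempty by (simp add: Bellman_def Max_Sup)
  then obtain b where b_maximal: "b \<in> Atil A p x s" "ereal (G \<gamma> x s) = ?f b"
    using Max_in[OF finite_nonempty] by (metis (no_types, lifting) imageE)
  have "ereal (G \<gamma> x s) \<le> ereal (bellman_term G \<gamma> x s b \<mu>)" if "\<mu> \<in> nonneg" for \<mu>
    unfolding b_maximal(2) by (rule INF_lower[OF that])
  then show thesis
    using that[OF b_maximal(1)] by simp
qed

lemma delayed_mass_sums:
  assumes "lam \<in> Mult"
  shows "(\<lambda>t. \<beta> ^ max t T * mult_mass lam t s) sums delayed_mass T lam s"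
  unfolding delayed_mass_def using mult_mass_nonneg[OF nonneg_multD[OF assms]] beta
  by (intro summable_sums summable_comparison_test'[OF mult_mass_summable[OF assms]])
    (auto simp: abs_mult intro!: mult_right_mono power_decreasing)

lemma delayed_mass_step:
  assumes lam_Mult: "lam \<in> Mult" and b_in_A: "b \<in> A"
  shows "\<beta> ^ Suc T * l1norm (lam [(s, b)]) + \<beta> * expect s (delayed_mass T (shift_mult lam s b))
    \<le> delayed_mass (Suc T) lam s"
proof -
  let ?lam = "shift_mult lam s b"
  have "\<beta> * expect s (\<lambda>s'. \<beta> ^ max t T * mult_mass ?lam t s')
      \<le> \<beta> ^ max (Suc t) (Suc T) * mult_mass lam (Suc t) s" for t
  proof -
    have "\<beta> * expect s (\<lambda>s'. \<beta> ^ max t T * mult_mass ?lam t s')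
        = \<beta> ^ max (Suc t) (Suc T) * expect s (mult_mass ?lam t)"
      by (simp add: sum_distrib_left ac_simps)
    also have "\<dots> \<le> \<beta> ^ max (Suc t) (Suc T) * mult_mass lam (Suc t) s"
      using beta by (intro mult_left_mono expect_mult_mass_le nonneg_multD lam_Mult b_in_A) auto
    finally show ?thesis .
  qed
  moreover have "(\<lambda>t. \<beta> * expect s (\<lambda>s'. \<beta> ^ max t T * mult_mass ?lam t s'))
      sums (\<beta> * expect s (delayed_mass T ?lam))"
    by (intro sums_mult sums_sum delayed_mass_sums shift_mult_Mult lam_Mult b_in_A)
  moreover have "(\<lambda>t. \<beta> ^ max (Suc t) (Suc T) * mult_mass lam (Suc t) s)
      sums (delayed_mass (Suc T) lam s - \<beta> ^ Suc T * mult_mass lam 0 s)"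
    using delayed_mass_sums[OF lam_Mult, of "Suc T" s] by (subst sums_Suc_iff) simp
  ultimately have "\<beta> * expect s (delayed_mass T ?lam)
      \<le> delayed_mass (Suc T) lam s - \<beta> ^ Suc T * mult_mass lam 0 s"
    by (rule sums_le)
  moreover have "\<beta> ^ Suc T * l1norm (lam [(s, b)]) \<le> \<beta> ^ Suc T * mult_mass lam 0 s"
    using beta by (intro mult_left_mono first_mult_le_mult_mass nonneg_multD lam_Mult b_in_A) auto
  ultimately show ?thesis
    by linarith
qed

lemma delayed_mass_tendsto_0:
  assumes "lam \<in> Mult"
  shows "(\<lambda>T. delayed_mass T lam s) \<longlonglongrightarrow> 0"
proof -
  have term_tendsto_0: "(\<lambda>T. \<beta> ^ max t T * mult_mass lam t s) \<longlonglongrightarrow> 0" for t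
  proof (rule tendsto_mult_left_zero)
    have "\<forall>\<^sub>F T in sequentially. \<beta> ^ T = \<beta> ^ max t T"
      using eventually_ge_at_top[of t] by eventually_elim (simp add: max_def)
    then show "(\<lambda>T. \<beta> ^ max t T) \<longlonglongrightarrow> 0"
      using beta by (intro Lim_transform_eventually[OF LIMSEQ_power_zero[of \<beta>]]) auto
  qed
  have "norm (\<beta> ^ max t T * mult_mass lam t s) \<le> \<beta> ^ t * mult_mass lam t s" for t T
    using mult_mass_nonneg[OF nonneg_multD[OF assms]] beta
    by (auto simp: abs_mult intro!: mult_right_mono power_decreasing)
  then have "(\<lambda>T. \<Sum>t. \<beta> ^ max t T * mult_mass lam t s) \<longlonglongrightarrow> (\<Sum>t. 0)"
    using tannerys_theorem[OF term_tendsto_0 _ mult_mass_summable[OF assms, of s]]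
    by (simp add: always_eventually case_prod_beta)
  then show ?thesis
    by (simp add: delayed_mass_def)
qed

text \<open>Bound on what is lost by playing greedily for \<open>T\<close> periods and arbitrarily afterwards.\<close>

definition greedy_loss :: "nat \<Rightarrow> (('s \<times> 'a) list \<Rightarrow> real ^ 'i) \<Rightarrow> real ^ 'i \<Rightarrow> 's \<Rightarrow> real" where
  "greedy_loss T lam \<gamma> s = (2 * Lc + slack_bound) * (\<beta> ^ T * (1 + l1norm \<gamma>) + delayed_mass T lam s)"

lemma greedy_loss_step:
  assumes lam_Mult: "lam \<in> Mult" and b_in_A: "b \<in> A" and x_in_X: "x \<in> X"
  shows "\<beta> * expect s (greedy_loss T (shift_mult lam s b) (\<gamma> + lam [(s, b)]))
      \<le> greedy_loss (Suc T) lam \<gamma> s"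
proof -
  let ?lam = "shift_mult lam s b" and ?\<mu> = "lam [(s, b)]"
  have "\<beta> ^ Suc T * (1 + l1norm (\<gamma> + ?\<mu>)) + \<beta> * expect s (delayed_mass T ?lam)
      \<le> \<beta> ^ Suc T * (1 + l1norm \<gamma>) + (\<beta> ^ Suc T * l1norm ?\<mu> + \<beta> * expect s (delayed_mass T ?lam))"
    using mult_left_mono[OF l1norm_add[of \<gamma> ?\<mu>], of "\<beta> ^ Suc T"] beta by (simp add: distrib_left)
  also have "\<dots> \<le> \<beta> ^ Suc T * (1 + l1norm \<gamma>) + delayed_mass (Suc T) lam s"
    by (intro add_left_mono delayed_mass_step lam_Mult b_in_A)
  finally have "(2 * Lc + slack_bound)
        * (\<beta> ^ Suc T * (1 + l1norm (\<gamma> + ?\<mu>)) + \<beta> * expect s (delayed_mass T ?lam))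
      \<le> greedy_loss (Suc T) lam \<gamma> s"
    unfolding greedy_loss_def using Lconst_nonneg[OF x_in_X] slack_bound_nonneg[OF x_in_X]
    by (intro mult_left_mono) auto
  moreover have "expect s (greedy_loss T ?lam (\<gamma> + ?\<mu>))
      = (2 * Lc + slack_bound) * (\<beta> ^ T * (1 + l1norm (\<gamma> + ?\<mu>)) + expect s (delayed_mass T ?lam))"
  proof -
    have "expect s (greedy_loss T ?lam (\<gamma> + ?\<mu>)) = (2 * Lc + slack_bound)
        * expect s (\<lambda>s'. \<beta> ^ T * (1 + l1norm (\<gamma> + ?\<mu>)) + delayed_mass T ?lam s')"
      unfolding greedy_loss_def sum_distrib_left by (simp add: mult.left_commute)
    then show ?thesis
      unfolding expect_add expect_const .
  qed
  ultimately show ?thesis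
    by (simp add: distrib_left mult.left_commute)
qed

lemma greedy_loss_tendsto_0:
  assumes "lam \<in> Mult"
  shows "(\<lambda>T. greedy_loss T lam \<gamma> s) \<longlonglongrightarrow> 0"
proof -
  have "(\<lambda>T. (2 * Lc + slack_bound) * (\<beta> ^ T * (1 + l1norm \<gamma>) + delayed_mass T lam s))
      \<longlonglongrightarrow> (2 * Lc + slack_bound) * (0 * (1 + l1norm \<gamma>) + 0)"
    using beta by (intro tendsto_intros LIMSEQ_power_zero delayed_mass_tendsto_0 assms) auto
  then show ?thesis
    by (simp add: greedy_loss_def)
qed

lemma Bellman_le_sup_Lag:
  assumes Bellman: "solves_Bellman G"
    and growth: "\<And>\<gamma> x s. x \<in> X \<Longrightarrow> \<gamma> \<in> nonneg \<Longrightarrow> G \<gamma> x s \<le> (1 + l1norm \<gamma>) * Lc"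
    and "x \<in> X" "\<gamma> \<in> nonneg" "lam \<in> Mult"
  shows "G \<gamma> x s \<le> sup_Lag lam \<gamma> x s + greedy_loss T lam \<gamma> s"
  using assms(3-)
proof (induction T arbitrary: x \<gamma> lam s)
  case 0
  have "0 \<le> delayed_mass 0 lam s"
    using sums_le[OF _ sums_zero delayed_mass_sums[OF 0(3)]] mult_mass_nonneg[OF nonneg_multD[OF 0(3)]]
      beta by simp
  then have "(1 + l1norm \<gamma>) * Lc + Lag_bound lam \<gamma> s \<le> greedy_loss 0 lam \<gamma> s"
    using Lconst_nonneg[OF 0(1)] slack_bound_nonneg[OF 0(1)]
    by (simp add: Lag_bound_def greedy_loss_def distrib_left distrib_right sum_nonneg)
  then show ?case
    using growth[OF 0(1,2), of s] abs_sup_Lag_le[OF 0(3,1), of \<gamma> s] by linarith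
next
  case (Suc T)
  obtain b where b_legal: "b \<in> Atil A p x s"
    and greedy: "\<And>\<mu>. \<mu> \<in> nonneg \<Longrightarrow> G \<gamma> x s \<le> bellman_term G \<gamma> x s b \<mu>"
    using Bellman_greedy_action[OF Bellman Suc.prems(1,2)] by blast
  note b_in_A = AtilD[OF b_legal]
  let ?lam = "shift_mult lam s b" and ?\<mu> = "lam [(s, b)]"
  have \<mu>_nonneg: "?\<mu> \<in> nonneg"
    by (rule first_mult_nonneg[OF nonneg_multD[OF Suc.prems(3)] b_in_A])
  have "G \<gamma> x s \<le> bellman_term G \<gamma> x s b ?\<mu>"
    by (rule greedy[OF \<mu>_nonneg])
  also have "\<dots> \<le> bellman_term (sup_Lag ?lam) \<gamma> x s b ?\<mu> + \<beta> * expect s (greedy_loss T ?lam (\<gamma> + ?\<mu>))"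
    by (intro bellman_term_le Suc.IH zeta_X nonneg_add shift_mult_Mult Suc.prems \<mu>_nonneg b_in_A)
  also have "\<dots> \<le> sup_Lag lam \<gamma> x s + greedy_loss (Suc T) lam \<gamma> s"
    by (intro add_mono bellman_term_le_sup_Lag greedy_loss_step[OF _ _ Suc.prems(1)] Suc.prems b_legal b_in_A)
  finally show ?case .
qed

theorem Bellman_le_dual_value:
  assumes "inN X A p \<beta> \<pi> \<zeta> r g gbar G" "solves_Bellman G" "x \<in> X" "\<gamma> \<in> nonneg"
  shows "G \<gamma> x s \<le> dual_value \<gamma> x s"
proof (rule dual_value_greatest[OF assms(3)])
  fix lam assume lam_Mult: "lam \<in> Mult"
  have "G \<gamma> x s \<le> (1 + l1norm \<gamma>) * Lc" if "x \<in> X" "\<gamma> \<in> nonneg" for \<gamma> x s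
    using assms(1) that by (simp add: inN_def l1norm_nonneg_eq)
  then have "G \<gamma> x s \<le> sup_Lag lam \<gamma> x s + greedy_loss T lam \<gamma> s" for T
    by (rule Bellman_le_sup_Lag[OF assms(2) _ assms(3,4) lam_Mult])
  moreover have "(\<lambda>T. sup_Lag lam \<gamma> x s + greedy_loss T lam \<gamma> s) \<longlonglongrightarrow> sup_Lag lam \<gamma> x s + 0"
    by (intro tendsto_intros greedy_loss_tendsto_0 lam_Mult)
  ultimately show "G \<gamma> x s \<le> sup_Lag lam \<gamma> x s"
    using LIMSEQ_le_const by fastforce
qed

section \<open>Finitely supported multipliers\<close>

definition constraints :: "(('s \<times> 'a) list \<times> 'i) set" where
  "constraints = (\<Union>t. Htil A t) \<times> UNIV"

lemma constraintsI: "k \<in> Htil A t \<Longrightarrow> (k, i) \<in> constraints"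
  by (auto simp: constraints_def)

lemma constraintsE:
  assumes "j \<in> constraints"
  obtains t where "fst j \<in> Htil A t"
  using assms by (auto simp: constraints_def)

definition weighted_objective ::
  "'x \<Rightarrow> real ^ 'i \<Rightarrow> 's \<Rightarrow> (('s \<times> 'a) list \<Rightarrow> real) \<Rightarrow> real" where
  "weighted_objective x \<gamma> s m = (\<Sum>b\<in>A. weighted_cont x (weighted_payoff \<gamma>) m [(s, b)])"

definition weighted_slack ::
  "'x \<Rightarrow> ('s \<times> 'a) list \<times> 'i \<Rightarrow> (('s \<times> 'a) list \<Rightarrow> real) \<Rightarrow> real" where
  "weighted_slack x j m = weighted_cont x (g (snd j)) m (fst j) - gbar (snd j) * m (fst j)"

lemma single_in_Htil: "b \<in> A \<Longrightarrow> [(s, b)] \<in> Htil A 0"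
  by (simp add: Htil_eq_histories)

lemma continuous_on_weighted_objective:
  assumes "x \<in> X"
  shows "continuous_on (realization_weights x) (weighted_objective x \<gamma> s)"
  unfolding weighted_objective_def
  by (intro continuous_on_sum
        continuous_on_weighted_cont[OF bounded_weighted_payoff assms single_in_Htil])

lemma continuous_on_weighted_slack:
  assumes "x \<in> X" "j \<in> constraints"
  shows "continuous_on (realization_weights x) (weighted_slack x j)"
proof -
  obtain t where "fst j \<in> Htil A t"
    using constraintsE[OF assms(2)] .
  then show ?thesis
    unfolding weighted_slack_def
    by (intro continuous_intros continuous_on_weighted_cont[OF bounded_g assms(1)] continuous_on_apply)
qed

lemma concavelike_on_objective_slacks:
  assumes x_in_X: "x \<in> X"
  shows "concavelike_on (realization_weights x)
    (insert (weighted_objective x \<gamma> s) (weighted_slack x ` constraints))"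
proof (rule concavelike_on_realization_weights)
  fix f m m' and u :: real
  assume "f \<in> insert (weighted_objective x \<gamma> s) (weighted_slack x ` constraints)"
    and m_weights: "m \<in> realization_weights x" "m' \<in> realization_weights x"
  then consider (objective) "f = weighted_objective x \<gamma> s"
    | (constraint) j t where "f = weighted_slack x j" "fst j \<in> Htil A t"
    using constraintsE by blast
  then show "f (\<lambda>k. (1 - u) * m k + u * m' k) = (1 - u) * f m + u * f m'"
  proof cases
    case objective
    then show ?thesis
      using weighted_cont_affine[OF bounded_weighted_payoff x_in_X m_weights single_in_Htil]
      by (simp add: weighted_objective_def sum.distrib sum_distrib_left)
  next
    case constraint
    then show ?thesis
      using weighted_cont_affine[OF bounded_g x_in_X m_weights]
      by (simp add: weighted_slack_def algebra_simps)
  qed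
qed

lemma weighted_objective_follows:
  assumes "a \<in> plans x"
  shows "weighted_objective x \<gamma> s (follows a) = cont_value x a (weighted_payoff \<gamma>) [s]"
  using sum_follows_first_action[OF assms, of s]
  by (simp add: weighted_objective_def weighted_cont_follows[OF assms])

lemma weighted_slack_follows:
  assumes "a \<in> plans x" "fst j \<noteq> []"
  shows "weighted_slack x j (follows a) = follows a (fst j) * slack a x (snd j) (map fst (fst j))"
  by (simp add: weighted_slack_def weighted_cont_follows[OF assms] slack_def algebra_simps)

text \<open>Normalised such that the total penalty is the slack of the constraint.\<close>

definition point_mult ::
  "('s \<times> 'a) list \<times> 'i \<Rightarrow> ('s \<times> 'a) list \<Rightarrow> real ^ 'i" where
  "point_mult j k
      = (if k = fst j then axis (snd j) (1 / (\<beta> ^ (length k - 1) * pathprob \<pi> (map fst k))) else 0)"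

lemma point_mult_Mult: "point_mult j \<in> Mult"
proof -
  have "mult_mass (point_mult j) t s = 0" if "t \<noteq> length (fst j) - 1" for t s
  proof -
    have "mult_mass (point_mult j) t s = history_sum s t (\<lambda>_. 0 * 0)"
      unfolding mult_mass_def using that by (intro history_sum_cong) (auto simp: point_mult_def Htil_def)
    then show ?thesis
      unfolding history_sum_cmult by simp
  qed
  then have "summable (\<lambda>t. \<beta> ^ t * mult_mass (point_mult j) t s)" for s
    by (intro summable_finite[of "{length (fst j) - 1}"]) auto
  then show ?thesis
    using pathprob_pos beta by (auto simp: Mult_iff nonneg_mult_def point_mult_def axis_def less_imp_le)
qed

lemma total_penalty_point_mult:
  assumes a_plan: "a \<in> plans x" and history_nonempty: "fst j \<noteq> []"
  shows "total_penalty a (point_mult j) x s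
      = (if fst (hd (fst j)) = s then weighted_slack x j (follows a) else 0)"
proof -
  define k where "k = fst j"
  let ?c = "1 / (\<beta> ^ (length k - 1) * pathprob \<pi> (map fst k))"
  have "(\<Sum>i\<in>UNIV. point_mult j (htil a h) $ i * slack a x i h)
      = (if h = map fst k then ?c * weighted_slack x j (follows a) else 0)" for h
  proof (cases "htil a h = k")
    case True
    then have "h = map fst k" "follows a k = 1"
      by (auto simp: follows_def)
    then show ?thesis
      using True
      by (simp add: point_mult_def axis_def k_def if_distrib if_distribR sum.delta
          weighted_slack_follows[OF a_plan history_nonempty] cong: if_cong)
  next
    case False
    then have "follows a k = 0" if "h = map fst k"
      using that by (simp add: follows_def)
    with False show ?thesis
      by (simp add: point_mult_def k_def weighted_slack_follows[OF a_plan history_nonempty])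
  qed
  then have "\<beta> ^ t * penalty a (point_mult j) x s t
      = (if t = length k - 1 then if fst (hd k) = s then weighted_slack x j (follows a) else 0 else 0)"
    for t
    using pathprob_pos[of "map fst k"] beta history_nonempty
    by (simp add: penalty_def condE_single_point k_def hd_map)
  then show ?thesis
    using sums_single[of "length k - 1"
        "\<lambda>_. if fst (hd k) = s then weighted_slack x j (follows a) else 0"]
    by (simp add: total_penalty_def sums_iff k_def)
qed

lemma sum_Mult:
  assumes "finite J" "\<And>j. j \<in> J \<Longrightarrow> lam j \<in> Mult" "\<And>j. j \<in> J \<Longrightarrow> 0 \<le> l j"
  shows "(\<lambda>k. \<Sum>j\<in>J. l j *\<^sub>R lam j k) \<in> Mult"
  using assms
proof (induction J rule: finite_induct)
  case (insert i J)
  then have "(\<lambda>k. l i *\<^sub>R lam i k + 1 *\<^sub>R (\<Sum>j\<in>J. l j *\<^sub>R lam j k)) \<in> Mult"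
    by (intro Mult_nonneg_combination) auto
  then show ?case
    using insert.hyps by simp
qed (simp add: zero_Mult)

lemma total_penalty_sum:
  assumes "finite J" "\<And>j. j \<in> J \<Longrightarrow> lam j \<in> Mult" "\<And>j. j \<in> J \<Longrightarrow> 0 \<le> l j" and x_in_X: "x \<in> X"
    and a_plan: "a \<in> plans x"
  shows "total_penalty a (\<lambda>k. \<Sum>j\<in>J. l j *\<^sub>R lam j k) x s = (\<Sum>j\<in>J. l j * total_penalty a (lam j) x s)"
  using assms(1-3)
proof (induction J rule: finite_induct)
  case empty
  show ?case
    by (simp add: total_penalty_def penalty_def condE_const)
next
  case (insert i J)
  have "total_penalty a (\<lambda>k. l i *\<^sub>R lam i k + 1 *\<^sub>R (\<Sum>j\<in>J. l j *\<^sub>R lam j k)) x s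
      = l i * total_penalty a (lam i) x s + 1 * total_penalty a (\<lambda>k. \<Sum>j\<in>J. l j *\<^sub>R lam j k) x s"
    using insert.prems insert.hyps
    by (intro total_penalty_lincomb sum_Mult x_in_X a_plan) auto
  then show ?case
    using insert by simp
qed

lemma Lag_finite_mult:
  assumes J_constraints: "finite J" "J \<subseteq> constraints" and l_nonneg: "\<And>j. j \<in> J \<Longrightarrow> 0 \<le> l j"
    and x_in_X: "x \<in> X" and a_plan: "a \<in> plans x"
  shows "Lag a (\<lambda>k. \<Sum>j\<in>J. l j *\<^sub>R point_mult j k) \<gamma> x s
    = weighted_objective x \<gamma> s (follows a)
      + (\<Sum>j\<in>J. if fst (hd (fst j)) = s then l j * weighted_slack x j (follows a) else 0)"
proof -
  have "total_penalty a (\<lambda>k. \<Sum>j\<in>J. l j *\<^sub>R point_mult j k) x s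
      = (\<Sum>j\<in>J. l j * total_penalty a (point_mult j) x s)"
    by (rule total_penalty_sum[OF J_constraints(1) point_mult_Mult l_nonneg x_in_X a_plan])
  also have "\<dots> = (\<Sum>j\<in>J. if fst (hd (fst j)) = s then l j * weighted_slack x j (follows a) else 0)"
  proof (rule sum.cong[OF refl])
    fix j assume "j \<in> J"
    then have "fst j \<noteq> []"
      using J_constraints(2) constraintsE Htil_nonempty by blast
    then show "l j * total_penalty a (point_mult j) x s
        = (if fst (hd (fst j)) = s then l j * weighted_slack x j (follows a) else 0)"
      by (simp add: total_penalty_point_mult[OF a_plan])
  qed
  finally show ?thesis
    using Lag_eq[OF sum_Mult[OF J_constraints(1) point_mult_Mult l_nonneg] x_in_X a_plan]
    by (simp add: weighted_objective_follows[OF a_plan])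
qed

section \<open>Strong duality for realization weights\<close>

lemma nonneg_weighted_slack_feasible:
  assumes a_plan: "a \<in> plans x" and j_constraint: "j \<in> constraints" and c_feasible: "feasible_plan x s c"
    and starts_with_s: "fst (hd (fst j)) = s" and agree: "\<And>h. h \<noteq> [] \<Longrightarrow> hd h = s \<Longrightarrow> a h = c h"
  shows "0 \<le> weighted_slack x j (follows a)"
proof -
  have history_nonempty: "fst j \<noteq> []"
    using j_constraint constraintsE Htil_nonempty by blast
  then have shocks_start_with_s: "map fst (fst j) \<noteq> []" "hd (map fst (fst j)) = s"
    using starts_with_s by (auto simp: hd_map)
  have "cont_value x a (g (snd j)) (map fst (fst j)) = cont_value x c (g (snd j)) (map fst (fst j))"
    by (rule cont_agree[OF agree shocks_start_with_s])
  also have "\<dots> \<ge> gbar (snd j)"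
    using c_feasible shocks_start_with_s by (auto simp: feasible_def Hist_def)
  finally show ?thesis
    by (simp add: weighted_slack_follows[OF a_plan history_nonempty] slack_def)
qed

lemma feasible_plan_choice:
  assumes "x \<in> X"
  obtains c where "\<And>s. feasible_plan x s (c s)" "\<And>s. c s \<in> plans x"
  using feas_ex[OF assms] unfolding feasible_def by metis

lemma ex_realization_weights_slacks_nonneg:
  assumes x_in_X: "x \<in> X"
  shows "\<exists>m\<in>realization_weights x. \<forall>j\<in>constraints. 0 \<le> weighted_slack x j m"
proof -
  obtain c where c_feasible: "\<And>s. feasible_plan x s (c s)" "\<And>s. c s \<in> plans x"
    using feasible_plan_choice[OF x_in_X] by blast
  have splice_plan: "splice_plans c \<in> plans x"
    by (rule splice_plans_Ainf[OF c_feasible(2)])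
  then show ?thesis
    using nonneg_weighted_slack_feasible[OF splice_plan _ c_feasible(1) refl]
    by (intro bexI[OF _ follows_realization_weights[OF splice_plan]]) (auto simp: splice_plans_def)
qed

text \<open>
  The Lagrangian only sees histories that start with \<open>s\<close>; after other initial shocks a feasible plan is
  played.
\<close>

lemma ex_realization_weights_Lagrangian_ge:
  assumes x_in_X: "x \<in> X" and J_constraints: "finite J" "J \<subseteq> constraints"
    and l_nonneg: "\<And>j. j \<in> J \<Longrightarrow> 0 \<le> l j"
    and y_less: "y < dual_value \<gamma> x s"
  shows "\<exists>m\<in>realization_weights x. y \<le> weighted_objective x \<gamma> s m + (\<Sum>j\<in>J. l j * weighted_slack x j m)"
proof -
  let ?lam = "\<lambda>k. \<Sum>j\<in>J. l j *\<^sub>R point_mult j k"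
  have lam_Mult: "?lam \<in> Mult"
    by (rule sum_Mult[OF J_constraints(1) point_mult_Mult l_nonneg])
  have "y < sup_Lag ?lam \<gamma> x s"
    using dual_value_le[OF lam_Mult x_in_X, of \<gamma> s] y_less by simp
  then obtain a where a_nearly_optimal: "a \<in> plans x" "y < Lag a ?lam \<gamma> x s"
    by (rule less_sup_LagE[OF lam_Mult x_in_X])
  obtain c where c_feasible: "\<And>s. feasible_plan x s (c s)" "\<And>s. c s \<in> plans x"
    using feasible_plan_choice[OF x_in_X] by blast
  define a' where "a' = splice_plans (c(s := a))"
  have a'_plan: "a' \<in> plans x"
    unfolding a'_def using a_nearly_optimal(1) c_feasible(2) by (intro splice_plans_Ainf) simp
  have "Lag a ?lam \<gamma> x s = Lag a' ?lam \<gamma> x s"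
    by (rule Ltil_agree) (simp_all add: a'_def splice_plans_def)
  with a_nearly_optimal(2) have "y < Lag a' ?lam \<gamma> x s"
    by simp
  also have "\<dots> = weighted_objective x \<gamma> s (follows a')
      + (\<Sum>j\<in>J. if fst (hd (fst j)) = s then l j * weighted_slack x j (follows a') else 0)"
    by (rule Lag_finite_mult[OF J_constraints l_nonneg x_in_X a'_plan])
  also have "\<dots> \<le> weighted_objective x \<gamma> s (follows a') + (\<Sum>j\<in>J. l j * weighted_slack x j (follows a'))"
  proof (intro add_left_mono sum_mono)
    fix j assume j_in_J: "j \<in> J"
    have "0 \<le> weighted_slack x j (follows a')" if "fst (hd (fst j)) \<noteq> s"
      using that j_in_J J_constraints(2)
      by (intro nonneg_weighted_slack_feasible[OF a'_plan _ c_feasible(1) refl])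
        (auto simp: a'_def splice_plans_def)
    then show "(if fst (hd (fst j)) = s then l j * weighted_slack x j (follows a') else 0)
        \<le> l j * weighted_slack x j (follows a')"
      using l_nonneg[OF j_in_J] by simp
  qed
  finally show ?thesis
    using follows_realization_weights[OF a'_plan] less_imp_le by blast
qed

theorem strong_duality_realization_weights:
  assumes "x \<in> X"
  shows "\<exists>m\<in>realization_weights x. dual_value \<gamma> x s \<le> weighted_objective x \<gamma> s m
    \<and> (\<forall>j\<in>constraints. 0 \<le> weighted_slack x j m)"
  by (intro lagrange_duality compact_realization_weights
      continuous_on_weighted_objective continuous_on_weighted_slack concavelike_on_objective_slacks
      ex_realization_weights_slacks_nonneg ex_realization_weights_Lagrangian_ge assms)

section \<open>Duality for lotteries\<close>

lemma
  assumes P_lottery: "P \<in> lotteries x" and x_in_X: "x \<in> X" and j_constraint: "j \<in> constraints"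
  shows integrable_weighted_slack: "integrable P (\<lambda>a. weighted_slack x j (follows a))"
    and integral_weighted_slack: "(\<integral>a. weighted_slack x j (follows a) \<partial>P)
        = weighted_slack x j (induced_weights P)"
proof -
  obtain t where history_Htil: "fst j \<in> Htil A t"
    using constraintsE[OF j_constraint] .
  note integrable_parts = integrable_weighted_cont[OF P_lottery bounded_g x_in_X history_Htil]
    integrable_mult_right[OF integrable_follows[OF P_lottery]]
  show "integrable P (\<lambda>a. weighted_slack x j (follows a))"
    unfolding weighted_slack_def by (intro Bochner_Integration.integrable_diff integrable_parts)
  show "(\<integral>a. weighted_slack x j (follows a) \<partial>P) = weighted_slack x j (induced_weights P)"
    unfolding weighted_slack_def Bochner_Integration.integral_diff[OF integrable_parts]
      integral_weighted_cont[OF P_lottery bounded_g x_in_X history_Htil]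
    by (simp add: induced_weights_def)
qed

lemma
  assumes P_lottery: "P \<in> lotteries x" and x_in_X: "x \<in> X"
  shows integrable_lottery_objective: "integrable P (\<lambda>a. cont_value x a (weighted_payoff \<gamma>) [s])"
    and LotObj_eq: "lottery_value \<gamma> x s P = weighted_objective x \<gamma> s (induced_weights P)"
proof -
  have objective_eq: "cont_value x a (weighted_payoff \<gamma>) [s] = weighted_objective x \<gamma> s (follows a)"
    if "a \<in> space P" for a
    using that by (simp add: weighted_objective_follows space_lottery[OF P_lottery])
  note integrable_objective =
    integrable_weighted_cont[OF P_lottery bounded_weighted_payoff x_in_X single_in_Htil]
  have "integrable P (\<lambda>a. weighted_objective x \<gamma> s (follows a))"
    unfolding weighted_objective_def by (intro Bochner_Integration.integrable_sum integrable_objective)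
  then show "integrable P (\<lambda>a. cont_value x a (weighted_payoff \<gamma>) [s])"
    by (simp add: objective_eq cong: Bochner_Integration.integrable_cong)
  have "lottery_value \<gamma> x s P = (\<integral>a. weighted_objective x \<gamma> s (follows a) \<partial>P)"
    unfolding LotObj_def by (rule Bochner_Integration.integral_cong[OF refl objective_eq])
  also have "\<dots> = weighted_objective x \<gamma> s (induced_weights P)"
    unfolding weighted_objective_def
    by (simp add: Bochner_Integration.integral_sum[OF integrable_objective]
          integral_weighted_cont[OF P_lottery bounded_weighted_payoff x_in_X single_in_Htil])
  finally show "lottery_value \<gamma> x s P = weighted_objective x \<gamma> s (induced_weights P)" .
qed

lemma LotFeas_iff:
  assumes x_in_X: "x \<in> X"
  shows "feasible_lottery x P
    \<longleftrightarrow> P \<in> lotteries x \<and> (\<forall>j\<in>constraints. 0 \<le> weighted_slack x j (induced_weights P))"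
proof -
  have "(\<integral>a. (if map (\<lambda>j. a (take (Suc j) (map fst k))) [0..<Suc t] = map snd k
        then cont_value x a (g i) (map fst k) - gbar i else 0) \<partial>P)
      = weighted_slack x (k, i) (induced_weights P)"
    if P_lottery: "P \<in> lotteries x" and k_Htil: "k \<in> Htil A t" for t k i
  proof -
    have "length k = Suc t" "(k, i) \<in> constraints" "k \<noteq> []"
      using k_Htil by (auto simp: Htil_def constraints_def)
    moreover have "(if map (\<lambda>j. a (take (Suc j) (map fst k))) [0..<length k] = map snd k
        then cont_value x a (g i) (map fst k) - gbar i else 0) = weighted_slack x (k, i) (follows a)"
      if "a \<in> space P" for a
      unfolding htil_eq_iff_actions[symmetric] using that \<open>k \<noteq> []\<close>
      by (simp add: space_lottery[OF P_lottery] weighted_slack_follows follows_def slack_def)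
    ultimately show ?thesis
      using integral_weighted_slack[OF P_lottery x_in_X, of "(k, i)"]
      by (simp cong: Bochner_Integration.integral_cong)
  qed
  then show ?thesis
    unfolding LotFeas_def constraints_def by (auto simp: lotteries_def)
qed

lemma penalty_eq_history_sum:
  assumes "a \<in> plans x"
  shows "penalty a lam x s t
      = history_sum s t (\<lambda>k. \<Sum>i\<in>UNIV. lam k $ i * weighted_slack x (k, i) (follows a))"
proof -
  have "penalty a lam x s t
      = history_sum s t (\<lambda>k. follows a k * (\<Sum>i\<in>UNIV. lam k $ i * slack a x i (map fst k)))"
    using plan_in_A[OF assms] by (simp add: penalty_def history_sum_follows)
  also have "\<dots> = history_sum s t (\<lambda>k. \<Sum>i\<in>UNIV. lam k $ i * weighted_slack x (k, i) (follows a))"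
    by (rule history_sum_cong)
      (simp add: weighted_slack_follows[OF assms] Htil_nonempty sum_distrib_left mult.left_commute)
  finally show ?thesis .
qed

lemma weighted_penalty_nonneg:
  assumes "nonneg_mult lam" "\<And>j. j \<in> constraints \<Longrightarrow> 0 \<le> weighted_slack x j m"
  shows "0 \<le> history_sum s t (\<lambda>k. \<Sum>i\<in>UNIV. lam k $ i * weighted_slack x (k, i) m)"
  using assms(1)
  by (intro history_sum_nonneg sum_nonneg mult_nonneg_nonneg assms(2) constraintsI)
    (auto simp: nonneg_mult_def)

lemma
  assumes P_lottery: "P \<in> lotteries x" and x_in_X: "x \<in> X"
  shows integrable_penalty: "integrable P (\<lambda>a. penalty a lam x s t)"
    and integral_penalty: "(\<integral>a. penalty a lam x s t \<partial>P)
      = history_sum s t (\<lambda>k. \<Sum>i\<in>UNIV. lam k $ i * weighted_slack x (k, i) (induced_weights P))"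
proof -
  let ?F = "\<lambda>a k. \<Sum>i\<in>UNIV. lam k $ i * weighted_slack x (k, i) (follows a)"
  have integrable_slack: "integrable P (\<lambda>a. weighted_slack x (k, i) (follows a))"
    if k_Htil: "k \<in> Htil A t" for k i
    by (rule integrable_weighted_slack[OF P_lottery x_in_X constraintsI[OF k_Htil]])
  then have integrable_F: "integrable P (\<lambda>a. ?F a k)" if "k \<in> Htil A t" for k
    using that by simp
  have penalty_eq: "penalty a lam x s t = history_sum s t (?F a)" if "a \<in> space P" for a
    using that by (simp add: penalty_eq_history_sum space_lottery[OF P_lottery])
  show "integrable P (\<lambda>a. penalty a lam x s t)"
    using integrable_history_sum[OF integrable_F]
    by (simp add: penalty_eq cong: Bochner_Integration.integrable_cong)
  have "(\<integral>a. penalty a lam x s t \<partial>P) = history_sum s t (\<lambda>k. \<integral>a. ?F a k \<partial>P)"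
    using integral_history_sum[OF integrable_F]
    by (simp add: penalty_eq cong: Bochner_Integration.integral_cong)
  also have "\<dots> = history_sum s t (\<lambda>k. \<Sum>i\<in>UNIV. lam k $ i * weighted_slack x (k, i) (induced_weights P))"
  proof (rule history_sum_cong)
    fix k :: "('s \<times> 'a) list" assume k_Htil: "k \<in> Htil A t"
    show "(\<integral>a. ?F a k \<partial>P) = (\<Sum>i\<in>UNIV. lam k $ i * weighted_slack x (k, i) (induced_weights P))"
      by (simp add: Bochner_Integration.integral_sum integrable_slack[OF k_Htil]
          integral_weighted_slack[OF P_lottery x_in_X constraintsI[OF k_Htil]])
  qed
  finally show "(\<integral>a. penalty a lam x s t \<partial>P)
      = history_sum s t (\<lambda>k. \<Sum>i\<in>UNIV. lam k $ i * weighted_slack x (k, i) (induced_weights P))" .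
qed

lemma
  assumes lot_feasible: "feasible_lottery x P" and x_in_X: "x \<in> X" and lam_Mult: "lam \<in> Mult"
  shows integrable_total_penalty: "integrable P (\<lambda>a. total_penalty a lam x s)"
    and integral_total_penalty_nonneg: "0 \<le> (\<integral>a. total_penalty a lam x s \<partial>P)"
proof -
  have P_lottery: "P \<in> lotteries x"
    and "\<And>j. j \<in> constraints \<Longrightarrow> 0 \<le> weighted_slack x j (induced_weights P)"
    using lot_feasible by (auto simp: LotFeas_iff[OF x_in_X])
  then have penalty_nonneg: "0 \<le> (\<integral>a. penalty a lam x s t \<partial>P)" for t
    unfolding integral_penalty[OF P_lottery x_in_X]
    by (intro weighted_penalty_nonneg nonneg_multD[OF lam_Mult])
  interpret prob_space P
    by (rule prob_space_lottery[OF P_lottery])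
  have "\<bar>\<beta> ^ t * penalty a lam x s t\<bar> \<le> slack_bound * (\<beta> ^ t * mult_mass lam t s)"
    if "a \<in> space P" for a t
    using mult_left_mono[OF abs_penalty_le[OF nonneg_multD[OF lam_Mult] x_in_X, of a s t], of "\<beta> ^ t"]
      that beta
    by (simp add: space_lottery[OF P_lottery] abs_mult mult.left_commute)
  note series = integral_suminf_bounded[OF _ this summable_mult[OF mult_mass_summable[OF lam_Mult]]]
  have measurable: "(\<lambda>a. \<beta> ^ t * penalty a lam x s t) \<in> borel_measurable P" for t
    by (intro borel_measurable_integrable integrable_mult_right integrable_penalty[OF P_lottery x_in_X])
  show "integrable P (\<lambda>a. total_penalty a lam x s)"
    unfolding total_penalty_def by (rule series(1)[OF measurable])
  show "0 \<le> (\<integral>a. total_penalty a lam x s \<partial>P)"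
    unfolding total_penalty_def using penalty_nonneg beta
    by (intro sums_le[OF _ sums_zero series(2)[OF measurable]]) simp
qed

theorem weak_duality:
  assumes P_feasible: "feasible_lottery x P" and x_in_X: "x \<in> X"
  shows "lottery_value \<gamma> x s P \<le> dual_value \<gamma> x s"
proof (rule dual_value_greatest[OF x_in_X])
  fix lam assume lam_Mult: "lam \<in> Mult"
  have P_lottery: "P \<in> lotteries x"
    using P_feasible by (simp add: LotFeas_iff[OF x_in_X])
  interpret prob_space P
    by (rule prob_space_lottery[OF P_lottery])
  note objective = integrable_lottery_objective[OF P_lottery x_in_X, of \<gamma> s]
    and penalty = integrable_total_penalty[OF P_feasible x_in_X lam_Mult, of s]
  have "lottery_value \<gamma> x s P
      \<le> (\<integral>a. cont_value x a (weighted_payoff \<gamma>) [s] \<partial>P) + (\<integral>a. total_penalty a lam x s \<partial>P)"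
    using integral_total_penalty_nonneg[OF P_feasible x_in_X lam_Mult, of s] by (simp add: LotObj_def)
  also have "\<dots> = (\<integral>a. cont_value x a (weighted_payoff \<gamma>) [s] + total_penalty a lam x s \<partial>P)"
    using objective penalty by simp
  also have "\<dots> \<le> sup_Lag lam \<gamma> x s"
  proof (rule integral_le_const)
    show "AE a in P. cont_value x a (weighted_payoff \<gamma>) [s] + total_penalty a lam x s
        \<le> sup_Lag lam \<gamma> x s"
      using Lag_le_sup_Lag[OF lam_Mult x_in_X] Lag_eq[OF lam_Mult x_in_X]
      by (intro AE_I2) (simp add: space_lottery[OF P_lottery])
  qed (use objective penalty in simp)
  finally show "lottery_value \<gamma> x s P \<le> sup_Lag lam \<gamma> x s" .
qed

theorem strong_duality:
  assumes x_in_X: "x \<in> X"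
  obtains P where "feasible_lottery x P" "lottery_value \<gamma> x s P = dual_value \<gamma> x s"
proof -
  obtain m where m_optimal: "m \<in> realization_weights x" "dual_value \<gamma> x s \<le> weighted_objective x \<gamma> s m"
    "\<forall>j\<in>constraints. 0 \<le> weighted_slack x j m"
    using strong_duality_realization_weights[OF x_in_X] by blast
  obtain P where P_induces_m: "P \<in> lotteries x" "induced_weights P = m"
    using ex_lottery_with_weights[OF x_in_X Atil_nonempty m_optimal(1)] by blast
  have "feasible_lottery x P"
    using P_induces_m m_optimal(3) by (simp add: LotFeas_iff[OF x_in_X])
  moreover have "lottery_value \<gamma> x s P = dual_value \<gamma> x s"
    using weak_duality[OF \<open>feasible_lottery x P\<close> x_in_X, of \<gamma> s] m_optimal(2) P_induces_m
    by (simp add: LotObj_eq[OF P_induces_m(1) x_in_X])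
  ultimately show thesis
    by (rule that)
qed

end

theorem theorem4p7:
  fixes \<pi> :: "'s::finite \<Rightarrow> 's \<Rightarrow> real"
    and A :: "(real ^ 'n) set"
    and X :: "(real ^ 'm) set"
    and \<zeta> :: "real ^ 'm \<Rightarrow> real ^ 'n \<Rightarrow> 's \<Rightarrow> real ^ 'm"
    and p r :: "real ^ 'm \<Rightarrow> real ^ 'n \<Rightarrow> 's \<Rightarrow> real"
    and g :: "'i::finite \<Rightarrow> real ^ 'm \<Rightarrow> real ^ 'n \<Rightarrow> 's \<Rightarrow> real"
    and gbar :: "'i \<Rightarrow> real"
    and \<beta> :: real
  assumes pi_pos: "\<And>s s'. \<pi> s s' > 0"
    and pi_sum: "\<And>s. (\<Sum>s'\<in>UNIV. \<pi> s s') = 1"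
    and A_fin: "finite A"
    and X_cnt: "countable X"
    and zeta_X: "\<And>x a s. x \<in> X \<Longrightarrow> a \<in> A \<Longrightarrow> \<zeta> x a s \<in> X"
    and r_bdd: "\<exists>B. \<forall>x\<in>X. \<forall>a\<in>A. \<forall>s. \<bar>r x a s\<bar> \<le> B"
    and g_bdd: "\<And>i. \<exists>B. \<forall>x\<in>X. \<forall>a\<in>A. \<forall>s. \<bar>g i x a s\<bar> \<le> B"
    and beta: "0 < \<beta>" "\<beta> < 1"
    and feas_ex: "\<And>x0 s0. x0 \<in> X \<Longrightarrow> \<exists>a. feasible A p \<zeta> \<pi> \<beta> g gbar x0 s0 a"
  shows "(\<forall>\<gamma>\<in>nonneg. \<forall>x0\<in>X. \<forall>s0.
            \<exists>P. LotFeas A p \<beta> \<pi> \<zeta> g gbar x0 P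
              \<and> (\<forall>Q. LotFeas A p \<beta> \<pi> \<zeta> g gbar x0 Q \<longrightarrow> LotObj \<beta> \<pi> \<zeta> r g \<gamma> x0 s0 Q \<le> LotObj \<beta> \<pi> \<zeta> r g \<gamma> x0 s0 P)
              \<and> ereal (LotObj \<beta> \<pi> \<zeta> r g \<gamma> x0 s0 P) = Dtil A p \<beta> \<pi> \<zeta> r g gbar \<gamma> x0 s0)
       \<and> (\<exists>F. inN X A p \<beta> \<pi> \<zeta> r g gbar F \<and> Bellman X A p \<beta> \<pi> \<zeta> r g gbar F
              \<and> (\<forall>\<gamma>\<in>nonneg. \<forall>x\<in>X. \<forall>s. ereal (F \<gamma> x s) = Dtil A p \<beta> \<pi> \<zeta> r g gbar \<gamma> x s)
              \<and> (\<forall>G. inN X A p \<beta> \<pi> \<zeta> r g gbar G \<and> Bellman X A p \<beta> \<pi> \<zeta> r g gbar G \<longrightarrow>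
                   (\<forall>\<gamma>\<in>nonneg. \<forall>x\<in>X. \<forall>s. G \<gamma> x s \<le> F \<gamma> x s)))"
proof -
  interpret lottery_model \<pi> A X \<zeta> p \<beta> r g gbar
    by unfold_locales (use assms in \<open>auto simp: bounded_payoff_def\<close>)
  have "\<exists>P. LotFeas A p \<beta> \<pi> \<zeta> g gbar x P
      \<and> (\<forall>Q. LotFeas A p \<beta> \<pi> \<zeta> g gbar x Q \<longrightarrow> LotObj \<beta> \<pi> \<zeta> r g \<gamma> x s Q \<le> LotObj \<beta> \<pi> \<zeta> r g \<gamma> x s P)
      \<and> ereal (LotObj \<beta> \<pi> \<zeta> r g \<gamma> x s P) = Dtil A p \<beta> \<pi> \<zeta> r g gbar \<gamma> x s" if x: "x \<in> X" for \<gamma> x s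
  proof -
    obtain P where "LotFeas A p \<beta> \<pi> \<zeta> g gbar x P" and "LotObj \<beta> \<pi> \<zeta> r g \<gamma> x s P = dual_value \<gamma> x s"
      by (rule strong_duality[OF x])
    then show ?thesis
      using weak_duality[OF _ x] by (intro exI[of _ P]) (simp add: Dtil_eq_dual_value[OF x])
  qed
  then show ?thesis
    using dual_value_inN dual_value_Bellman Dtil_eq_dual_value Bellman_le_dual_value
    by (intro conjI exI[of _ dual_value]) auto
qed

end
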